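(* Let $0<\alpha<d$ and $\theta\in(\alpha,\alpha+d/3)$, and write $a_0:=2-\theta\alpha^{-1}$ and $d_n:=\lfloor n/2\rfloor$. Consider the estimate $$(\star)\qquad \mathbb{P}(0\leftrightarrow x)\asymp\begin{cases}\zeta_n^{-1}\|x\|^{-\alpha}, & \text{if } 0<\|x\|\le d_n^{\,a_0},\\ n^{-(d+\alpha-\theta)}, & \text{if } d_n^{\,a_0}<\|x\|\le d_n,\end{cases}\qquad x\in\mathbb{T}_n^d\setminus\{0\}.$$ (a) If $0<\alpha<d/3$ and $\alpha<\theta<2\alpha$, then $(\star)$ holds. (b) If $0<\alpha<d/3$ and $2\alpha\le\theta<\alpha+d/3$, then $$\mathbb{P}(0\leftrightarrow x)\asymp n^{-(d+\alpha-\theta)}\quad\text{for } x\in\mathbb{T}_n^d\setminus\{0\}.$$ (c) If $d/3\le\alpha\le 5d/6$ and $\alpha<\theta<\alpha+d/3$, then $(\star)$ holds. (d) If $5d/6<\alpha<d$ and $\alpha<\theta<2d-\alpha$, then $(\star)$ holds.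
   Context: Let $d\ge 1$ be an integer. For $n\ge 3$, $\mathbb{T}_n^d=\mathbb{Z}^d/n\mathbb{Z}^d$ is the discrete torus on $n^d$ vertices; $\|x-y\|$ is the distance between $x,y\in\mathbb{T}_n^d$ in the quotient metric inherited from the $\ell^\infty$ distance on $\mathbb{Z}^d$, and $\|x\|=\|x-0\|$. Its diameter is $d_n=\lfloor n/2\rfloor$. Let $0<A_1\le A_2$ and let $\rho:[0,\infty)\to[0,\infty)$ satisfy $\rho(0)=0$ and $A_1r^{-\alpha}\le\rho(r)\le A_2r^{-\alpha}$ for all $r\ge 1$. For $n\ge 3$, $\zeta_n$ is the unique positive number satisfying $$\sum_{i=1}^{d_n-1}\big((2i+1)^d-(2i-1)^d\big)\exp(-\zeta_n^{-1}\rho(i))+\big(n^d-(2d_n-1)^d\big)\exp(-\zeta_n^{-1}\rho(d_n))=n^d-2 .$$ Let $\rho^-(r)=\max\{\rho(r)-n^{-\theta},0\}$ and $\kappa^{(n),-}(x,y)=\zeta_n^{-1}\rho^-(\|x-y\|)$. Let $G_n^-$ be the random graph with vertex set $\mathbb{T}_n^d$ in which each pair $x\ne y$ is joined by an edge independently with probability $1-\exp(-\kappa^{(n),-}(x,y))$. $\{x\leftrightarrow y\}$ is the event that there is a path between $x$ and $y$ in $G_n^-$. Convention: "$a_n^{(i)}\lesssim b_n^{(i)}$ for $i\in\mathcal{I}_n$" means there exist $n_0$ depending only on $(A_1,A_2,d,\alpha,\theta)$ and $C>0$ depending only on $(A_1,A_2,d,\alpha)$ such that $a_n^{(i)}\le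 C b_n^{(i)}$ for all $n\ge n_0$ and all $i\in\mathcal{I}_n$; "$a_n^{(i)}\asymp b_n^{(i)}$" means both $a_n^{(i)}\lesssim b_n^{(i)}$ and $b_n^{(i)}\lesssim a_n^{(i)}$. *)

theory Defs
  imports "HOL-Probability.Probability" "HOL-Number_Theory.Cong"
    "HOL-Real_Asymp.Real_Asymp"
begin

text \<open>The dimension is d = CARD('d). Vertices of the torus are the residue classes of integer
  vectors modulo n, i.e. sets of integer vectors.\<close>

definition torus_rel :: "nat \<Rightarrow> ((int ^ 'd) \<times> (int ^ 'd)) set" where
  "torus_rel n = {(a, b). \<forall>i. [a $ i = b $ i] (mod int n)}"

definition torus :: "nat \<Rightarrow> (int ^ 'd) set set" where
  "torus n = UNIV // torus_rel n"

definition torus_zero :: "nat \<Rightarrow> (int ^ 'd) set" where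
  "torus_zero n = torus_rel n `` {0}"

definition linf_dist :: "int ^ 'd \<Rightarrow> int ^ 'd \<Rightarrow> real" where
  "linf_dist a b = real_of_int (MAX i. \<bar>a $ i - b $ i\<bar>)"

definition torus_dist :: "(int ^ 'd) set \<Rightarrow> (int ^ 'd) set \<Rightarrow> real" where
  "torus_dist x y = (INF (a, b) \<in> x \<times> y. linf_dist a b)"

definition torus_norm :: "nat \<Rightarrow> (int ^ 'd) set \<Rightarrow> real" where
  "torus_norm n x = torus_dist x (torus_zero n)"

definition torus_diam :: "nat \<Rightarrow> nat" where
  "torus_diam n = n div 2"

definition admissible_rho :: "real \<Rightarrow> real \<Rightarrow> real \<Rightarrow> (real \<Rightarrow> real) \<Rightarrow> bool" where
  "admissible_rho A1 A2 \<alpha> \<rho> \<longleftrightarrow>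
     (\<forall>r\<ge>0. 0 \<le> \<rho> r) \<and> \<rho> 0 = 0 \<and>
     (\<forall>r\<ge>1. A1 * r powr (- \<alpha>) \<le> \<rho> r \<and> \<rho> r \<le> A2 * r powr (- \<alpha>))"

definition zeta_eq :: "nat \<Rightarrow> (real \<Rightarrow> real) \<Rightarrow> nat \<Rightarrow> real \<Rightarrow> bool" where
  "zeta_eq d \<rho> n z \<longleftrightarrow>
     (\<Sum>i = 1..torus_diam n - 1.
        ((2 * real i + 1) ^ d - (2 * real i - 1) ^ d) * exp (- inverse z * \<rho> (real i)))
     + (real n ^ d - (2 * real (torus_diam n) - 1) ^ d)
         * exp (- inverse z * \<rho> (real (torus_diam n)))
     = real n ^ d - 2"

definition zeta :: "nat \<Rightarrow> (real \<Rightarrow> real) \<Rightarrow> nat \<Rightarrow> real" where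
  "zeta d \<rho> n = (THE z. 0 < z \<and> zeta_eq d \<rho> n z)"

definition rho_minus :: "real \<Rightarrow> (real \<Rightarrow> real) \<Rightarrow> nat \<Rightarrow> real \<Rightarrow> real" where
  "rho_minus \<theta> \<rho> n r = max (\<rho> r - real n powr (- \<theta>)) 0"

definition kappa_minus ::
    "real \<Rightarrow> (real \<Rightarrow> real) \<Rightarrow> nat \<Rightarrow> (int ^ 'd) set \<Rightarrow> (int ^ 'd) set \<Rightarrow> real" where
  "kappa_minus \<theta> \<rho> n x y = inverse (zeta CARD('d) \<rho> n) * rho_minus \<theta> \<rho> n (torus_dist x y)"

definition torus_pairs :: "nat \<Rightarrow> (int ^ 'd) set set set" where
  "torus_pairs n = {{x, y} | x y. x \<in> torus n \<and> y \<in> torus n \<and> x \<noteq> y}"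

text \<open>The description is unambiguous because the kernel is symmetric; see
  \<open>edge_prob_pair\<close> below.\<close>

definition edge_prob :: "real \<Rightarrow> (real \<Rightarrow> real) \<Rightarrow> nat \<Rightarrow> (int ^ 'd) set set \<Rightarrow> real" where
  "edge_prob \<theta> \<rho> n e =
     (THE p. \<exists>x y. e = {x, y} \<and> p = 1 - exp (- kappa_minus \<theta> \<rho> n x y))"

text \<open>A sample of the random graph is the indicator function of its edge set; it is constantly
  \<open>False\<close> outside \<open>torus_pairs n\<close>.\<close>

definition random_graph ::
    "real \<Rightarrow> (real \<Rightarrow> real) \<Rightarrow> nat \<Rightarrow> ((int ^ 'd) set set \<Rightarrow> bool) pmf" where
  "random_graph \<theta> \<rho> n =
     Pi_pmf (torus_pairs n) False (\<lambda>e. bernoulli_pmf (edge_prob \<theta> \<rho> n e))"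

definition connected_in :: "('v set \<Rightarrow> bool) \<Rightarrow> 'v \<Rightarrow> 'v \<Rightarrow> bool" where
  "connected_in G x y \<longleftrightarrow> (\<lambda>u v. u \<noteq> v \<and> G {u, v})\<^sup>*\<^sup>* x y"

definition conn_prob ::
    "real \<Rightarrow> (real \<Rightarrow> real) \<Rightarrow> nat \<Rightarrow> (int ^ 'd) set \<Rightarrow> (int ^ 'd) set \<Rightarrow> real" where
  "conn_prob \<theta> \<rho> n x y =
     measure_pmf.prob (random_graph \<theta> \<rho> n) {G. connected_in G x y}"

text \<open>The multiplicative constant is uniform in \<open>\<theta>\<close>, \<open>\<rho>\<close> and the index; the threshold may
  depend on \<open>\<theta>\<close>, but not on \<open>\<rho>\<close> or the index. Both may depend on whatever determines the
  remaining arguments (in particular on A1, A2, the dimension and \<open>\<alpha>\<close>).\<close>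

definition uniform_lesssim ::
    "real set \<Rightarrow> ((real \<Rightarrow> real) \<Rightarrow> bool) \<Rightarrow> (nat \<Rightarrow> 'i set)
     \<Rightarrow> (real \<Rightarrow> (real \<Rightarrow> real) \<Rightarrow> nat \<Rightarrow> 'i \<Rightarrow> real)
     \<Rightarrow> (real \<Rightarrow> (real \<Rightarrow> real) \<Rightarrow> nat \<Rightarrow> 'i \<Rightarrow> real) \<Rightarrow> bool" where
  "uniform_lesssim \<Theta> R I a b \<longleftrightarrow>
     (\<exists>C>0. \<forall>\<theta>\<in>\<Theta>. \<exists>n0. \<forall>\<rho>. R \<rho> \<longrightarrow> (\<forall>n\<ge>n0. \<forall>i\<in>I n. a \<theta> \<rho> n i \<le> C * b \<theta> \<rho> n i))"

definition uniform_asymp ::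
    "real set \<Rightarrow> ((real \<Rightarrow> real) \<Rightarrow> bool) \<Rightarrow> (nat \<Rightarrow> 'i set)
     \<Rightarrow> (real \<Rightarrow> (real \<Rightarrow> real) \<Rightarrow> nat \<Rightarrow> 'i \<Rightarrow> real)
     \<Rightarrow> (real \<Rightarrow> (real \<Rightarrow> real) \<Rightarrow> nat \<Rightarrow> 'i \<Rightarrow> real) \<Rightarrow> bool" where
  "uniform_asymp \<Theta> R I a b \<longleftrightarrow> uniform_lesssim \<Theta> R I a b \<and> uniform_lesssim \<Theta> R I b a"

definition far_value :: "nat \<Rightarrow> real \<Rightarrow> real \<Rightarrow> nat \<Rightarrow> real" where
  "far_value d \<alpha> \<theta> n = real n powr (- (real d + \<alpha> - \<theta>))"

definition two_regime ::
    "real \<Rightarrow> real \<Rightarrow> (real \<Rightarrow> real) \<Rightarrow> nat \<Rightarrow> (int ^ 'd) set \<Rightarrow> real" where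
  "two_regime \<alpha> \<theta> \<rho> n x =
     (if 0 < torus_norm n x \<and> torus_norm n x \<le> real (torus_diam n) powr (2 - \<theta> / \<alpha>)
      then inverse (zeta CARD('d) \<rho> n) * torus_norm n x powr (- \<alpha>)
      else far_value CARD('d) \<alpha> \<theta> n)"

definition conn_estimate ::
    "real \<Rightarrow> real \<Rightarrow> real \<Rightarrow> real set
     \<Rightarrow> (real \<Rightarrow> (real \<Rightarrow> real) \<Rightarrow> nat \<Rightarrow> (int ^ 'd) set \<Rightarrow> real) \<Rightarrow> bool" where
  "conn_estimate A1 A2 \<alpha> \<Theta> f \<longleftrightarrow>
     uniform_asymp \<Theta> (admissible_rho A1 A2 \<alpha>) (\<lambda>n. torus n - {torus_zero n})
       (\<lambda>\<theta> \<rho> n x. conn_prob \<theta> \<rho> n (torus_zero n) x) f"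

lemma equiv_torus_rel: "equiv UNIV (torus_rel n)"
  by (auto simp: equiv_def refl_on_def sym_def trans_def torus_rel_def cong_def)

lemma finite_torus:
  assumes "n > 0"
  shows "finite (torus n :: (int ^ 'd) set set)"
proof -
  let ?V = "{v :: int ^ 'd. \<forall>i. v $ i \<in> {0..<int n}}"
  have "torus n \<subseteq> (\<lambda>v. torus_rel n `` {v}) ` ?V"
  proof
    fix X :: "(int ^ 'd) set" assume "X \<in> torus n"
    then obtain a where a: "X = torus_rel n `` {a}"
      unfolding torus_def by (auto elim: quotientE)
    let ?b = "\<chi> i. a $ i mod int n"
    have "(a, ?b) \<in> torus_rel n" by (simp add: torus_rel_def cong_def)
    then have "X = torus_rel n `` {?b}" 
      using a equiv_class_eq[OF equiv_torus_rel] by metis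
    moreover have "?b \<in> ?V" using assms by simp
    ultimately show "X \<in> (\<lambda>v. torus_rel n `` {v}) ` ?V" by blast
  qed
  moreover have "finite ?V"
  proof -
    have "?V \<subseteq> vec_lambda ` (PiE UNIV (\<lambda>_. {0..<int n}))"
    proof
      fix v assume "v \<in> ?V"
      then show "v \<in> vec_lambda ` (PiE UNIV (\<lambda>_. {0..<int n}))"
        by (intro image_eqI[of _ _ "\<lambda>i. v $ i"]) auto
    qed
    moreover have "finite (PiE (UNIV :: 'd set) (\<lambda>_. {0..<int n}))"
      by (rule finite_PiE) auto
    ultimately show ?thesis by (meson finite_imageI finite_subset)
  qed
  ultimately show ?thesis by (meson finite_imageI finite_subset)
qed

lemma finite_torus_pairs:
  assumes "n > 0"
  shows "finite (torus_pairs n :: (int ^ 'd) set set set)"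
  by (rule finite_subset[of _ "Pow (torus n)"]) (auto simp: torus_pairs_def finite_torus[OF assms])

lemma torus_dist_commute: "torus_dist x y = torus_dist y x"
proof -
  have "linf_dist a b = linf_dist b a" for a b :: "int ^ 'd"
    by (simp add: linf_dist_def abs_minus_commute)
  then have "(\<lambda>(a, b). linf_dist a b) ` (x \<times> y) = (\<lambda>(a, b). linf_dist a b) ` (y \<times> x)"
    by (force simp: image_def)
  then show ?thesis by (simp add: torus_dist_def)
qed

lemma edge_prob_pair: "edge_prob \<theta> \<rho> n {x, y} = 1 - exp (- kappa_minus \<theta> \<rho> n x y)"
  unfolding edge_prob_def
  by (rule the_equality)
     (auto simp: doubleton_eq_iff kappa_minus_def torus_dist_commute)

lemma zeta_unique:
  assumes "0 < A1" "admissible_rho A1 A2 \<alpha> \<rho>" "d \<ge> 1" "n \<ge> 3"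
  shows "\<exists>!z. 0 < z \<and> zeta_eq d \<rho> n z"
proof -
  define m where "m = torus_diam n"
  define w where "w i = (if i = m then real n ^ d - (2 * real m - 1) ^ d
    else (2 * real i + 1) ^ d - (2 * real i - 1) ^ d)" for i
  define g where "g u = (\<Sum>i = 1..m. w i * exp (- u * \<rho> (real i)))" for u
  have m: "1 \<le> m" "2 * m \<le> n" using assms(4) by (auto simp: m_def torus_diam_def)
  have spl: "{1..m} = insert m {1..m - 1}" using m by auto
  have eq: "zeta_eq d \<rho> n z \<longleftrightarrow> g (inverse z) = real n ^ d - 2" for z
  proof -
    have "g (inverse z) = w m * exp (- inverse z * \<rho> (real m))
        + (\<Sum>i = 1..m - 1. w i * exp (- inverse z * \<rho> (real i)))"
      unfolding g_def using m by (subst spl, subst sum.insert) auto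
    also have "(\<Sum>i = 1..m - 1. w i * exp (- inverse z * \<rho> (real i))) =
       (\<Sum>i = 1..m - 1. ((2 * real i + 1) ^ d - (2 * real i - 1) ^ d) * exp (- inverse z * \<rho> (real i)))"
      by (rule sum.cong) (auto simp: w_def)
    finally show ?thesis by (simp add: zeta_eq_def w_def m_def add.commute)
  qed
  have wpos: "w i > 0" if "i \<in> {1..m}" for i
  proof -
    have "2 * real m - 1 < real n" using m by linarith
    then show ?thesis using that assms(3)
      by (auto simp: w_def intro!: power_strict_mono)
  qed
  have rpos: "\<rho> (real i) > 0" if "i \<in> {1..m}" for i
  proof -
    have "A1 * real i powr (- \<alpha>) \<le> \<rho> (real i)"
      using assms(2) that by (auto simp: admissible_rho_def)
    moreover have "A1 * real i powr (- \<alpha>) > 0" using assms(1) that by auto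
    ultimately show ?thesis by linarith
  qed
  have decr: "g v < g u" if "u < v" for u v
    unfolding g_def
    by (rule sum_strict_mono) (use m wpos rpos that in auto)
  have "(\<Sum>i = 1..k. (2 * real i + 1) ^ d - (2 * real i - 1) ^ d) = (2 * real k + 1) ^ d - 1" for k
    by (induction k) (auto simp: algebra_simps)
  then have tot: "(\<Sum>i = 1..m - 1. (2 * real i + 1) ^ d - (2 * real i - 1) ^ d)
      = (2 * real m - 1) ^ d - 1"
    using m by (simp add: of_nat_diff algebra_simps)
  have "g 0 = w m + (\<Sum>i = 1..m - 1. w i)"
    unfolding g_def using m by (subst spl, subst sum.insert) auto
  also have "(\<Sum>i = 1..m - 1. w i) = (\<Sum>i = 1..m - 1. (2 * real i + 1) ^ d - (2 * real i - 1) ^ d)"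
    by (rule sum.cong) (auto simp: w_def)
  finally have g0: "g 0 = real n ^ d - 1" unfolding tot by (simp add: w_def)
  have "((\<lambda>u. exp (- u * c)) \<longlongrightarrow> 0) at_top" if "c > 0" for c :: real
    using that by real_asymp
  then have "(g \<longlongrightarrow> (\<Sum>i = 1..m. w i * 0)) at_top"
    unfolding g_def by (intro tendsto_sum tendsto_mult tendsto_const) (use rpos in blast)
  then have lim: "(g \<longlongrightarrow> 0) at_top" by simp
  have "real n ^ 1 \<le> real n ^ d" using assms(3,4) by (intro power_increasing) auto
  moreover have "real n \<ge> 3" using assms(4) by simp
  ultimately have "real n ^ d - 2 > 0" unfolding power_one_right by linarith
  with lim have "\<forall>\<^sub>F u in at_top. g u < real n ^ d - 2" by (rule order_tendstoD)
  then have "\<forall>\<^sub>F u in at_top. g u < real n ^ d - 2 \<and> u > 0"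
    using eventually_gt_at_top[of 0] by eventually_elim auto
  then obtain v where v: "g v < real n ^ d - 2" "v > 0"
    by (auto simp: eventually_at_top_linorder)
  have "continuous_on {0..v} g" unfolding g_def by (intro continuous_intros)
  then obtain u where u: "0 \<le> u" "g u = real n ^ d - 2"
    using IVT2'[of g v "real n ^ d - 2" 0] v g0 by auto
  have "u \<noteq> 0" using u g0 by auto
  show ?thesis
  proof (rule ex1I[of _ "inverse u"])
    show "0 < inverse u \<and> zeta_eq d \<rho> n (inverse u)" using u \<open>u \<noteq> 0\<close> by (simp add: eq)
    fix z assume z: "0 < z \<and> zeta_eq d \<rho> n z"
    then have "g (inverse z) = g u" using u by (simp add: eq)
    then have "inverse z = u" using decr by (metis linorder_neqE_linordered_idom less_irrefl)
    then show "z = inverse u" by auto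
  qed
qed

end

theory Submission
  imports Defs
begin

text \<open>
  With \<open>W = \<zeta>\<^sub>n\<^sup>-\<^sup>1\<close> the kernel \<open>W \<rho>\<close> has mean degree exactly one, by the equation that defines
  \<open>\<zeta>\<^sub>n\<close>, and that equation forces \<open>W\<close> to be of order \<open>n\<^sup>\<alpha>\<^sup>-\<^sup>d\<close>. Lowering \<open>\<rho>\<close> by \<open>n\<^sup>-\<^sup>\<theta>\<close> lowers the mean
  degree to \<open>1 - \<epsilon>\<close> with \<open>\<epsilon>\<close> of order \<open>n\<^sup>\<alpha>\<^sup>-\<^sup>\<theta>\<close>. The graph is thus slightly subcritical, and the
  condition \<open>\<theta> < \<alpha> + d/3\<close> says that \<open>\<epsilon>\<close> is still far larger than \<open>n\<^sup>-\<^sup>d\<^sup>/\<^sup>3\<close>, the width of the critical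
  window on \<open>n\<^sup>d\<close> vertices. The two-point function then behaves like the Green function of the
  random walk killed with probability \<open>\<epsilon>\<close> per step.

  Upper bound. The connection probability is at most any supersolution of the Green equation,
  that is, any \<open>G \<ge> 0\<close> with \<open>\<delta> + p G \<le> G\<close> (\<open>Pr_joined_le\<close>). One step of the walk contributes
  \<open>Q(x) = n\<^sup>\<alpha>\<^sup>-\<^sup>d \<parallel>x\<parallel>\<^sup>-\<^sup>\<alpha>\<close>; a bounded number of convolutions turns this profile into a constant one
  (\<open>profile_convolution\<close>), and the remaining geometric series has mass of order \<open>1/\<epsilon>\<close>, spread
  evenly over \<open>n\<^sup>d\<close> vertices. So \<open>G \<le> \<delta> + K (Q + \<eta>)\<close> with \<open>\<eta> = n\<^sup>-\<^sup>d/\<epsilon>\<close>, which is of order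
  \<open>n\<^sup>-\<^sup>(\<^sup>d\<^sup>+\<^sup>\<alpha>\<^sup>-\<^sup>\<theta>\<^sup>)\<close> (\<open>supersolution\<close>, \<open>subcritical_graph_exists\<close>).

  Lower bound. The single edge from \<open>0\<close> to \<open>x\<close> already gives the term \<open>W \<parallel>x\<parallel>\<^sup>-\<^sup>\<alpha>\<close>. For the term \<open>\<eta>\<close>,
  decompose over the first edge of a path and apply Bonferroni's inequality. This loses only
  the paths that come back to their start, and the configurations in which two different first
  edges lead to \<open>x\<close>; both consist of edge-disjoint paths, so that products of Green functions
  bound them (\<open>Pr_joined_only_through_le\<close>, \<open>Pr_tree_le\<close>, \<open>Pr_joined_lower\<close>). Summed over \<open>x\<close>, the
  loss is at most a constant times \<open>(S + \<eta>/\<epsilon>)/\<epsilon>\<close> with \<open>S = \<Sum>\<^sub>x Q(x)\<^sup>2\<close>. Now \<open>\<eta>/\<epsilon>\<close> is much smaller than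
  \<open>\<epsilon>\<close> because \<open>\<theta> < \<alpha> + d/3\<close>, and \<open>S\<close> is much smaller than \<open>\<epsilon>\<close> because also \<open>\<theta> < 2 d - \<alpha>\<close>; the
  latter bound is the stronger one exactly if \<open>\<alpha> > 5 d/6\<close>. Hence the mean cluster size is at least
  \<open>1/(2 \<epsilon>)\<close> (\<open>cluster_size_lower\<close>). Every edge has probability at least of order \<open>n\<^sup>-\<^sup>d\<close>, so one
  edge from \<open>0\<close> into the cluster of \<open>x\<close> gives the pointwise bound \<open>\<eta>\<close> wherever \<open>Q\<close> is at most of
  order \<open>\<eta>\<close> (\<open>Pr_joined_lower_far\<close>).

  The two terms \<open>Q\<close> and \<open>\<eta>\<close> balance at \<open>\<parallel>x\<parallel> = n\<^sup>2\<^sup>-\<^sup>\<theta>\<^sup>/\<^sup>\<alpha>\<close>, which separates the two regimes. If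
  \<open>\<theta> \<ge> 2 \<alpha>\<close> this radius is at most one and \<open>\<eta>\<close> dominates everywhere.
\<close>

section \<open>Connections in a graph with independent edges\<close>

text \<open>Paths are confined to a vertex set, because the estimates below explore a path by deleting the
  vertices that it has used.\<close>

definition joined :: "'v set \<Rightarrow> ('v set \<Rightarrow> bool) \<Rightarrow> 'v \<Rightarrow> 'v \<Rightarrow> bool" where
  "joined A g = (\<lambda>u v. u \<in> A \<and> v \<in> A \<and> u \<noteq> v \<and> g {u, v})\<^sup>*\<^sup>*"

lemma joined_refl [simp]: "joined A g x x"
  by (simp add: joined_def)

lemma joined_trans: "joined A g x y \<Longrightarrow> joined A g y z \<Longrightarrow> joined A g x z"
  unfolding joined_def by (rule rtranclp_trans)

lemma joined_sym: "joined A g x y \<Longrightarrow> joined A g y x"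
  unfolding joined_def
proof (induction rule: rtranclp_induct)
  case (step y z)
  then show ?case
    by (intro converse_rtranclp_into_rtranclp[of _ z y]) (auto simp: insert_commute)
qed simp

lemma joined_commute: "joined A g x y = joined A g y x"
  using joined_sym by metis

lemma joined_mono:
  assumes "joined A g x y" "A \<subseteq> B"
  shows "joined B g x y"
proof -
  have "(\<lambda>u v. u \<in> A \<and> v \<in> A \<and> u \<noteq> v \<and> g {u, v}) \<le> (\<lambda>u v. u \<in> B \<and> v \<in> B \<and> u \<noteq> v \<and> g {u, v})"
    using assms(2) by auto
  from rtranclp_mono[OF this] show ?thesis using assms(1) unfolding joined_def by auto
qed

lemma joined_edge: "x \<in> A \<Longrightarrow> u \<in> A \<Longrightarrow> x \<noteq> u \<Longrightarrow> g {x, u} \<Longrightarrow> joined A g x u"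
  unfolding joined_def by (intro r_into_rtranclp) auto

lemma joined_endpoint:
  assumes "joined A g x y" "x \<noteq> y"
  shows "x \<in> A"
  using assms unfolding joined_def by (auto elim: converse_rtranclpE)

text \<open>Cut the path at its last visit to the starting vertex.\<close>

lemma joined_first_step:
  assumes "joined A g x y" "x \<noteq> y"
  obtains u where "u \<in> A - {x}" "g {x, u}" "joined (A - {x}) g u y"
proof -
  have "x = y \<or> (\<exists>u\<in>A - {x}. g {x, u} \<and> joined (A - {x}) g u y)"
    using assms(1) unfolding joined_def
  proof (induction rule: rtranclp_induct)
    case (step y z)
    show ?case
    proof (cases "z = x \<or> y = x")
      case True
      then show ?thesis using step.hyps by auto
    next
      case False
      then obtain u where u: "u \<in> A - {x}" "g {x, u}"
        "(\<lambda>u v. u \<in> A - {x} \<and> v \<in> A - {x} \<and> u \<noteq> v \<and> g {u, v})\<^sup>*\<^sup>* u y"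
        using step.IH by auto
      have "(\<lambda>u v. u \<in> A - {x} \<and> v \<in> A - {x} \<and> u \<noteq> v \<and> g {u, v})\<^sup>*\<^sup>* u z"
        by (rule rtranclp.rtrancl_into_rtrancl[OF u(3)]) (use False step.hyps in auto)
      then show ?thesis using u by blast
    qed
  qed simp
  then show ?thesis using assms(2) that by blast
qed

text \<open>A path that never meets the cluster of \<open>u\<close> survives the deletion of \<open>u\<close>.\<close>

lemma joined_avoids:
  assumes "joined A g v w" "\<not> joined A g v u"
  shows "joined (A - {u}) g v w"
proof -
  have "joined A g v w \<and> joined (A - {u}) g v w"
    using assms(1) unfolding joined_def
  proof (induction rule: rtranclp_induct)
    case (step y z)
    have "(\<lambda>u v. u \<in> A \<and> v \<in> A \<and> u \<noteq> v \<and> g {u, v})\<^sup>*\<^sup>* v z"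
      by (rule rtranclp.rtrancl_into_rtrancl[OF conjunct1[OF step.IH] step.hyps(2)])
    moreover have "y \<noteq> u" "z \<noteq> u"
      using assms(2) calculation step.IH unfolding joined_def by auto
    then have "(\<lambda>a v. a \<in> A - {u} \<and> v \<in> A - {u} \<and> a \<noteq> v \<and> g {a, v})\<^sup>*\<^sup>* v z"
      by (intro rtranclp.rtrancl_into_rtrancl[OF conjunct2[OF step.IH]]) (use step.hyps in auto)
    ultimately show ?case by blast
  qed simp
  then show ?thesis ..
qed

lemma joined_fun_upd:
  assumes "x \<notin> A"
  shows "joined A (g({x, u} := b)) v w = joined A g v w"
proof -
  have "(\<lambda>v w. v \<in> A \<and> w \<in> A \<and> v \<noteq> w \<and> (g({x, u} := b)) {v, w}) =
        (\<lambda>v w. v \<in> A \<and> w \<in> A \<and> v \<noteq> w \<and> g {v, w})"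
    using assms by (auto simp: fun_eq_iff doubleton_eq_iff)
  then show ?thesis unfolding joined_def by simp
qed

text \<open>Independence of the edges is used only in the form \<open>edge_indep\<close>: the state of an edge is
  independent of every event that does not look at this edge. Applied repeatedly while vertices
  are deleted, this replaces every appeal to disjoint occurrence of events.\<close>

locale bernoulli_graph =
  fixes V :: "'v set" and p :: "'v \<Rightarrow> 'v \<Rightarrow> real" and M :: "('v set \<Rightarrow> bool) pmf"
  assumes finV: "finite V"
    and p_nonneg: "0 \<le> p x y"
    and p_diag: "x \<in> V \<Longrightarrow> p x x = 0"
    and p_sym: "p x y = p y x"
    and edge_indep: "x \<in> V \<Longrightarrow> y \<in> V \<Longrightarrow> x \<noteq> y \<Longrightarrow> (\<And>g b. F (g({x, y} := b)) = F g) \<Longrightarrow>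
        measure_pmf.prob M {g. g {x, y} \<and> F g} = p x y * measure_pmf.prob M {g. F g}"
begin

definition Pr :: "(('v set \<Rightarrow> bool) \<Rightarrow> bool) \<Rightarrow> real" where
  "Pr F = measure_pmf.prob M {g. F g}"

lemma Pr_nonneg: "0 \<le> Pr F" and Pr_le_1: "Pr F \<le> 1"
  by (auto simp: Pr_def)

lemma Pr_mono: "(\<And>g. F g \<Longrightarrow> H g) \<Longrightarrow> Pr F \<le> Pr H"
  unfolding Pr_def by (intro measure_pmf.finite_measure_mono) auto

lemma Pr_True: "(\<And>g. F g) \<Longrightarrow> Pr F = 1"
  unfolding Pr_def by (subst Collect_cong[of _ "\<lambda>_. True"]) auto

lemma Pr_False: "(\<And>g. \<not> F g) \<Longrightarrow> Pr F = 0"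
  unfolding Pr_def by (subst Collect_cong[of _ "\<lambda>_. False"]) auto

lemma Pr_disj: "Pr (\<lambda>g. F g \<or> H g) \<le> Pr F + Pr H"
proof -
  have "{g. F g \<or> H g} = {g. F g} \<union> {g. H g}" by auto
  then show ?thesis unfolding Pr_def
    using measure_Un_le[of "{g. F g}" M "{g. H g}"] by simp
qed

lemma Pr_disj_conj: "Pr (\<lambda>g. F g \<or> H g) = Pr F + Pr H - Pr (\<lambda>g. F g \<and> H g)"
proof -
  have "{g. F g \<or> H g} = {g. F g} \<union> {g. H g}" "{g. F g \<and> H g} = {g. F g} \<inter> {g. H g}" by auto
  then show ?thesis unfolding Pr_def
    using measure_Un3[of "{g. F g}" M "{g. H g}"] 
    by (simp add: measure_pmf.fmeasurable_eq_sets)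
qed

lemma Pr_Ex_le:
  assumes "finite I"
  shows "Pr (\<lambda>g. \<exists>i\<in>I. F i g) \<le> (\<Sum>i\<in>I. Pr (F i))"
  using assms
proof (induction I)
  case (insert i I)
  have "Pr (\<lambda>g. \<exists>j\<in>insert i I. F j g) \<le> Pr (\<lambda>g. F i g \<or> (\<exists>j\<in>I. F j g))"
    by (rule Pr_mono) auto
  with insert Pr_disj[of "F i" "\<lambda>g. \<exists>j\<in>I. F j g"] show ?case by simp
qed (simp add: Pr_False)

lemma Pr_edge:
  assumes "x \<in> V" "y \<in> V" "x \<noteq> y" "\<And>g b. F (g({x, y} := b)) = F g"
  shows "Pr (\<lambda>g. g {x, y} \<and> F g) = p x y * Pr F"
  unfolding Pr_def by (rule edge_indep[of x y F]) (use assms in blast)+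

lemma bonferroni:
  assumes "finite I"
  shows "(\<Sum>i\<in>I. Pr (F i)) - (\<Sum>i\<in>I. \<Sum>j\<in>I - {i}. Pr (\<lambda>g. F i g \<and> F j g))
    \<le> Pr (\<lambda>g. \<exists>i\<in>I. F i g)"
  using assms
proof (induction I)
  case (insert i I)
  let ?P = "\<lambda>i j. Pr (\<lambda>g. F i g \<and> F j g)"
  have nn: "?P a b \<ge> 0" for a b by (rule Pr_nonneg)
  have "(\<Sum>a\<in>insert i I. \<Sum>b\<in>insert i I - {a}. ?P a b)
      = (\<Sum>b\<in>I. ?P i b) + (\<Sum>a\<in>I. \<Sum>b\<in>insert i I - {a}. ?P a b)"
    using insert by simp
  moreover have "(\<Sum>a\<in>I. \<Sum>b\<in>I - {a}. ?P a b) \<le> (\<Sum>a\<in>I. \<Sum>b\<in>insert i I - {a}. ?P a b)"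
    using insert by (intro sum_mono sum_mono2) (auto simp: nn)
  moreover have "Pr (\<lambda>g. F i g \<and> (\<exists>j\<in>I. F j g)) \<le> (\<Sum>b\<in>I. ?P i b)"
  proof -
    have "Pr (\<lambda>g. F i g \<and> (\<exists>j\<in>I. F j g)) \<le> Pr (\<lambda>g. \<exists>j\<in>I. F i g \<and> F j g)"
      by (rule Pr_mono) auto
    also have "\<dots> \<le> (\<Sum>b\<in>I. ?P i b)" by (rule Pr_Ex_le[OF insert(1)])
    finally show ?thesis .
  qed
  moreover have "Pr (\<lambda>g. \<exists>j\<in>insert i I. F j g) = Pr (\<lambda>g. F i g \<or> (\<exists>j\<in>I. F j g))"
    by simp
  ultimately show ?case
    using insert Pr_disj_conj[of "F i" "\<lambda>g. \<exists>j\<in>I. F j g"] by simp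
qed (simp add: Pr_False)

end

text \<open>Any supersolution \<open>G\<close> of the Green equation can take the place of the exact Green function
  of \<open>p\<close>: only the inequality \<open>\<delta> + p G \<le> G\<close> enters the inductions, and a supersolution can be
  chosen as an explicit combination of power laws.\<close>

locale green_bounded_graph = bernoulli_graph V p M
  for V :: "'v set" and p M +
  fixes G :: "'v \<Rightarrow> 'v \<Rightarrow> real"
  assumes G_nonneg: "0 \<le> G x y"
    and G_sym: "G x y = G y x"
    and G_super: "x \<in> V \<Longrightarrow> y \<in> V \<Longrightarrow> of_bool (x = y) + (\<Sum>u\<in>V. p x u * G u y) \<le> G x y"
begin

lemma of_bool_le_G: "x \<in> V \<Longrightarrow> y \<in> V \<Longrightarrow> of_bool (x = y) \<le> G x y"
  using G_super[of x y] sum_nonneg[of V "\<lambda>u. p x u * G u y"] p_nonneg G_nonneg by fastforce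

lemma G_refl: "x \<in> V \<Longrightarrow> 1 \<le> G x x"
  using of_bool_le_G[of x x] by simp

lemma pG_le_G: "x \<in> V \<Longrightarrow> y \<in> V \<Longrightarrow> (\<Sum>u\<in>V. p x u * G u y) \<le> G x y"
  using G_super[of x y] by (simp add: of_bool_def split: if_splits)

text \<open>The common induction behind all the upper bounds. An event that either stops at \<open>x\<close>, at cost
  \<open>h x\<close>, or follows an edge to \<open>u\<close> and continues without \<open>x\<close>, is dominated by a walk that pays
  \<open>h\<close> when it stops. Deleting the vertex \<open>x\<close> makes the edge independent of the continuation.\<close>

lemma renewal_bound:
  assumes step: "\<And>A x g. A \<subseteq> V \<Longrightarrow> x \<in> A \<Longrightarrow> \<Phi> A x g \<Longrightarrow>
      B A x g \<or> (\<exists>u\<in>A - {x}. g {x, u} \<and> \<Phi> (A - {x}) u g)"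
    and local: "\<And>A x u v g b. x \<notin> A \<Longrightarrow> \<Phi> A u (g({x, v} := b)) = \<Phi> A u g"
    and h: "\<And>A x. A \<subseteq> V \<Longrightarrow> x \<in> A \<Longrightarrow> Pr (B A x) \<le> h x"
    and h_nonneg: "\<And>x. 0 \<le> h x"
    and "A \<subseteq> V" "x \<in> A"
  shows "Pr (\<Phi> A x) \<le> (\<Sum>z\<in>V. G x z * h z)"
  using assms(5,6)
proof (induction "card A" arbitrary: A x rule: less_induct)
  case less
  have "finite A" using less.prems finV finite_subset by blast
  have xV: "x \<in> V" using less.prems by auto
  have "Pr (\<Phi> A x) \<le> Pr (\<lambda>g. B A x g \<or> (\<exists>u\<in>A - {x}. g {x, u} \<and> \<Phi> (A - {x}) u g))"
    using step less.prems by (intro Pr_mono) blast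
  also have "\<dots> \<le> Pr (B A x) + Pr (\<lambda>g. \<exists>u\<in>A - {x}. g {x, u} \<and> \<Phi> (A - {x}) u g)"
    by (rule Pr_disj)
  also have "\<dots> \<le> h x + (\<Sum>u\<in>A - {x}. Pr (\<lambda>g. g {x, u} \<and> \<Phi> (A - {x}) u g))"
    by (intro add_mono h less.prems Pr_Ex_le) (use \<open>finite A\<close> in auto)
  also have "(\<Sum>u\<in>A - {x}. Pr (\<lambda>g. g {x, u} \<and> \<Phi> (A - {x}) u g))
      = (\<Sum>u\<in>A - {x}. p x u * Pr (\<Phi> (A - {x}) u))"
    by (intro sum.cong refl Pr_edge local) (use less.prems in auto)
  also have "\<dots> \<le> (\<Sum>u\<in>A - {x}. p x u * (\<Sum>z\<in>V. G u z * h z))"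
    by (intro sum_mono mult_left_mono p_nonneg less.hyps psubset_card_mono)
       (use less.prems \<open>finite A\<close> in auto)
  also have "\<dots> \<le> (\<Sum>u\<in>V. p x u * (\<Sum>z\<in>V. G u z * h z))"
    using less.prems
    by (intro sum_mono2 finV mult_nonneg_nonneg sum_nonneg p_nonneg G_nonneg h_nonneg) auto
  also have "\<dots> = (\<Sum>z\<in>V. (\<Sum>u\<in>V. p x u * G u z) * h z)"
    by (subst sum_distrib_right, subst sum.swap) (simp add: sum_distrib_left mult.assoc)
  (* The cost of stopping at once is the diagonal term of the Green equation. *)
  also have "h x = (\<Sum>z\<in>V. of_bool (x = z) * h z)"
    using finV xV by (simp add: of_bool_def if_distrib[of "\<lambda>c. c * _"] cong: if_cong)
  also have "(\<Sum>z\<in>V. of_bool (x = z) * h z) + (\<Sum>z\<in>V. (\<Sum>u\<in>V. p x u * G u z) * h z)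
      = (\<Sum>z\<in>V. (of_bool (x = z) + (\<Sum>u\<in>V. p x u * G u z)) * h z)"
    by (simp add: sum.distrib distrib_right)
  also have "\<dots> \<le> (\<Sum>z\<in>V. G x z * h z)"
    by (intro sum_mono mult_right_mono G_super xV h_nonneg) auto
  finally show ?case by simp
qed

lemma sum_of_bool_mult: "y \<in> V \<Longrightarrow> (\<Sum>z\<in>V. f z * (of_bool (z = y) * c)) = f y * (c :: real)"
proof -
  assume "y \<in> V"
  have "(\<Sum>z\<in>V. f z * (of_bool (z = y) * c)) = (\<Sum>z\<in>V. if z = y then f z * c else 0)"
    by (rule sum.cong) auto
  then show ?thesis using finV \<open>y \<in> V\<close> by simp
qed

lemma Pr_joined_le:
  assumes "A \<subseteq> V" "x \<in> A" "y \<in> V"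
  shows "Pr (\<lambda>g. joined A g x y) \<le> G x y"
proof -
  have "Pr (\<lambda>g. joined A g x y) \<le> (\<Sum>z\<in>V. G x z * (of_bool (z = y) * 1))"
  proof (rule renewal_bound[where \<Phi> = "\<lambda>A x g. joined A g x y" and B = "\<lambda>A x g. x = y"])
    fix A x g assume "A \<subseteq> V" "x \<in> A" "joined A g x y"
    then show "x = y \<or> (\<exists>u\<in>A - {x}. g {x, u} \<and> joined (A - {x}) g u y)"
      by (metis joined_first_step)
  qed (use assms Pr_le_1 in \<open>auto simp: joined_fun_upd Pr_False\<close>)
  also have "\<dots> = G x y" using assms by (subst sum_of_bool_mult) auto
  finally show ?thesis .
qed

text \<open>A connection that breaks when \<open>v\<close> is deleted splits at \<open>v\<close> into two parts without a common
  edge: follow the path until it reaches \<open>v\<close>, then start afresh from there.\<close>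

lemma Pr_joined_only_through_le:
  assumes "A \<subseteq> V" "x \<in> A" "y \<in> V" "v \<in> V" "y \<noteq> v"
  shows "Pr (\<lambda>g. joined A g x y \<and> \<not> joined (A - {v}) g x y) \<le> G x v * G v y"
proof -
  have "Pr (\<lambda>g. joined A g x y \<and> \<not> joined (A - {v}) g x y)
      \<le> (\<Sum>z\<in>V. G x z * (of_bool (z = v) * G v y))"
  proof (rule renewal_bound[where \<Phi> = "\<lambda>A x g. joined A g x y \<and> \<not> joined (A - {v}) g x y"
        and B = "\<lambda>A x g. x = v \<and> joined A g x y"])
    fix A x g assume A: "A \<subseteq> V" "x \<in> A" "joined A g x y \<and> \<not> joined (A - {v}) g x y"
    show "(x = v \<and> joined A g x y) \<or> (\<exists>u\<in>A - {x}. g {x, u} \<and> joined (A - {x}) g u y \<and>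
        \<not> joined (A - {x} - {v}) g u y)"
    proof (cases "x = v")
      case False
      have "x \<noteq> y" using A by auto
      then obtain u where u: "u \<in> A - {x}" "g {x, u}" "joined (A - {x}) g u y"
        using A joined_first_step by metis
      have "\<not> joined (A - {x} - {v}) g u y"
      proof
        assume j: "joined (A - {x} - {v}) g u y"
        have "u \<noteq> v" using joined_endpoint[OF j] assms(5) by auto
        then have "joined (A - {v}) g x u" using u A False by (intro joined_edge) auto
        moreover have "joined (A - {v}) g u y" by (rule joined_mono[OF j]) auto
        ultimately show False using A joined_trans by metis
      qed
      then show ?thesis using u by blast
    qed (use A in auto)
  next
    fix A x assume "A \<subseteq> V" "x \<in> A"
    then show "Pr (\<lambda>g. x = v \<and> joined A g x y) \<le> of_bool (x = v) * G v y"
      using Pr_joined_le[of A x y] assms by (cases "x = v") (auto simp: Pr_False)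
  qed (use assms in \<open>auto simp: joined_fun_upd G_nonneg\<close>)
  also have "\<dots> = G x v * G v y" using assms by (subst sum_of_bool_mult) auto
  finally show ?thesis .
qed

text \<open>Connections within different clusters use different edges, and exploring the first path does
  not interfere with the second.\<close>

lemma Pr_two_clusters_le:
  assumes "A \<subseteq> V" "u \<in> A" "x \<in> V" "v \<in> V" "w \<in> V"
  shows "Pr (\<lambda>g. joined A g u x \<and> joined A g v w \<and> \<not> joined A g u v) \<le> G u x * G v w"
proof -
  have "Pr (\<lambda>g. joined A g u x \<and> joined A g v w \<and> \<not> joined A g u v)
      \<le> (\<Sum>z\<in>V. G u z * (of_bool (z = x) * G v w))"
  proof (rule renewal_bound[where
        \<Phi> = "\<lambda>A u g. joined A g u x \<and> joined A g v w \<and> \<not> joined A g u v"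
        and B = "\<lambda>A u g. u = x \<and> joined A g v w"])
    fix A u g assume A: "A \<subseteq> V" "u \<in> A" "joined A g u x \<and> joined A g v w \<and> \<not> joined A g u v"
    show "(u = x \<and> joined A g v w) \<or> (\<exists>y\<in>A - {u}. g {u, y} \<and> joined (A - {u}) g y x \<and>
        joined (A - {u}) g v w \<and> \<not> joined (A - {u}) g y v)"
    proof (cases "u = x")
      case False
      then obtain y where y: "y \<in> A - {u}" "g {u, y}" "joined (A - {u}) g y x"
        using A joined_first_step by metis
      have "joined (A - {u}) g v w"
        using A joined_commute[of A g u v] by (intro joined_avoids) auto
      moreover have "\<not> joined (A - {u}) g y v"
      proof
        assume "joined (A - {u}) g y v"
        then have "joined A g y v" by (rule joined_mono) auto
        moreover have "joined A g u y" using y A by (intro joined_edge) auto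
        ultimately show False using A joined_trans by metis
      qed
      ultimately show ?thesis using y by blast
    qed (use A in auto)
  next
    fix A u assume A: "A \<subseteq> V" "u \<in> A"
    have "Pr (\<lambda>g. joined A g v w) \<le> Pr (\<lambda>g. joined V g v w)"
      by (rule Pr_mono) (use A joined_mono in metis)
    also have "\<dots> \<le> G v w" by (rule Pr_joined_le) (use assms in auto)
    finally show "Pr (\<lambda>g. u = x \<and> joined A g v w) \<le> of_bool (u = x) * G v w"
      by (cases "u = x") (auto simp: Pr_False)
  qed (use assms in \<open>auto simp: joined_fun_upd G_nonneg\<close>)
  also have "\<dots> = G u x * G v w" using assms by (subst sum_of_bool_mult) auto
  finally show ?thesis .
qed

text \<open>The tree-graph bound. Paths from \<open>y\<close> and \<open>y'\<close> to \<open>x\<close> meet at a branch vertex \<open>z\<close>. Exploring from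
  \<open>y\<close>, the branch vertex is the first vertex whose deletion separates \<open>y'\<close> from \<open>x\<close>; at that moment
  its two continuations lie in different clusters, which is the situation of
  \<open>Pr_two_clusters_le\<close>.\<close>

lemma Pr_tree_le:
  assumes "A \<subseteq> V" "y \<in> A" "y' \<in> V" "x \<in> V"
  shows "Pr (\<lambda>g. joined A g y x \<and> joined A g y' x) \<le> (\<Sum>z\<in>V. G y z * (G z y' * G z x))"
proof (rule renewal_bound[where \<Phi> = "\<lambda>A y g. joined A g y x \<and> joined A g y' x"
      and B = "\<lambda>A y g. (y = x \<and> joined V g x y') \<or> (y = y' \<and> joined V g y' x) \<or>
        (\<exists>u\<in>A - {y}. \<exists>v\<in>A - {y}. u \<noteq> v \<and> g {y, u} \<and> g {y, v} \<and>
          joined (A - {y}) g u x \<and> joined (A - {y}) g v y' \<and> \<not> joined (A - {y}) g u v)"])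
  fix A y g assume A: "A \<subseteq> V" "y \<in> A" "joined A g y x \<and> joined A g y' x"
  show "((y = x \<and> joined V g x y') \<or> (y = y' \<and> joined V g y' x) \<or>
        (\<exists>u\<in>A - {y}. \<exists>v\<in>A - {y}. u \<noteq> v \<and> g {y, u} \<and> g {y, v} \<and>
          joined (A - {y}) g u x \<and> joined (A - {y}) g v y' \<and> \<not> joined (A - {y}) g u v))
      \<or> (\<exists>u\<in>A - {y}. g {y, u} \<and> joined (A - {y}) g u x \<and> joined (A - {y}) g y' x)"
  proof (cases "y = x \<or> y = y'")
    case True
    then show ?thesis using A joined_mono joined_sym by metis
  next
    case False
    then obtain u where u: "u \<in> A - {y}" "g {y, u}" "joined (A - {y}) g u x"
      using A joined_first_step by metis
    have "joined A g y y'" using A joined_sym joined_trans by metis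
    then obtain v where v: "v \<in> A - {y}" "g {y, v}" "joined (A - {y}) g v y'"
      using False joined_first_step by metis
    show ?thesis
    proof (cases "joined (A - {y}) g y' x")
      case False
      then have "\<not> joined (A - {y}) g u v" using u v joined_sym joined_trans by metis
      moreover from this have "u \<noteq> v" by auto
      ultimately show ?thesis using u v by blast
    qed (use u in blast)
  qed
next
  fix A y assume A: "A \<subseteq> V" "y \<in> A"
  then have yV: "y \<in> V" by auto
  have fA: "finite (A - {y})" using A finV finite_subset by blast
  let ?E = "\<lambda>u v g. u \<noteq> v \<and> g {y, u} \<and> g {y, v} \<and>
          joined (A - {y}) g u x \<and> joined (A - {y}) g v y' \<and> \<not> joined (A - {y}) g u v"
  show "Pr (\<lambda>g. (y = x \<and> joined V g x y') \<or> (y = y' \<and> joined V g y' x) \<or>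
        (\<exists>u\<in>A - {y}. \<exists>v\<in>A - {y}. ?E u v g)) \<le> G y y' * G y x"
  proof (cases "y = x \<or> y = y'")
    case True
    have "Pr (\<lambda>g. (y = x \<and> joined V g x y') \<or> (y = y' \<and> joined V g y' x) \<or>
        (\<exists>u\<in>A - {y}. \<exists>v\<in>A - {y}. ?E u v g)) \<le> Pr (\<lambda>g. joined V g x y')"
    proof (rule Pr_mono)
      fix g assume g: "(y = x \<and> joined V g x y') \<or> (y = y' \<and> joined V g y' x) \<or>
        (\<exists>u\<in>A - {y}. \<exists>v\<in>A - {y}. ?E u v g)"
      {
        fix u v assume uv: "u \<in> A - {y}" "v \<in> A - {y}" "?E u v g"
        have "joined V g y u" "joined V g y v" using uv A by (auto intro!: joined_edge)
        moreover have "joined V g u x" "joined V g v y'"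
          by (rule joined_mono[of "A - {y}"]; use uv A in blast)+
        ultimately have "joined V g x y'" using joined_sym joined_trans by metis
      }
      then show "joined V g x y'" using g joined_sym by metis
    qed
    also have "\<dots> \<le> G x y'" by (rule Pr_joined_le) (use assms in auto)
    also have "\<dots> \<le> G y y' * G y x"
      using True mult_left_mono[OF G_refl[OF yV] G_nonneg, of x y'] 
        mult_right_mono[OF G_refl[OF yV] G_nonneg, of y x] G_sym[of y x] by auto
    finally show ?thesis .
  next
    case False
    have E: "Pr (?E u v) \<le> (p y u * G u x) * (p y v * G v y')"
      if "u \<in> A - {y}" "v \<in> A - {y}" for u v
    proof (cases "u = v")
      case True
      then show ?thesis by (simp add: Pr_False p_nonneg G_nonneg)
    next
      case False
      let ?D = "\<lambda>g. joined (A - {y}) g u x \<and> joined (A - {y}) g v y' \<and> \<not> joined (A - {y}) g u v"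
      have "Pr (?E u v) = Pr (\<lambda>g. g {y, u} \<and> (g {y, v} \<and> ?D g))"
        using False by simp
      also have "\<dots> = p y u * Pr (\<lambda>g. g {y, v} \<and> ?D g)"
        by (rule Pr_edge) (use that A False in \<open>auto simp: joined_fun_upd doubleton_eq_iff\<close>)
      also have "Pr (\<lambda>g. g {y, v} \<and> ?D g) = p y v * Pr ?D"
        by (rule Pr_edge) (use that A in \<open>auto simp: joined_fun_upd\<close>)
      finally have eq: "Pr (?E u v) = p y u * (p y v * Pr ?D)" .
      have "Pr ?D \<le> G u x * G v y'"
        by (rule Pr_two_clusters_le) (use that A assms in auto)
      then have "p y u * (p y v * Pr ?D) \<le> p y u * (p y v * (G u x * G v y'))"
        by (intro mult_left_mono p_nonneg)
      then show ?thesis unfolding eq by (simp add: mult_ac)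
    qed
    have sub: "(\<Sum>u\<in>A - {y}. p y u * G u w) \<le> G y w" if "w \<in> V" for w
    proof -
      have "(\<Sum>u\<in>A - {y}. p y u * G u w) \<le> (\<Sum>u\<in>V. p y u * G u w)"
        by (intro sum_mono2 finV) (use A in \<open>auto simp: p_nonneg G_nonneg\<close>)
      also have "\<dots> \<le> G y w" by (rule pG_le_G[OF yV that])
      finally show ?thesis .
    qed
    have "Pr (\<lambda>g. (y = x \<and> joined V g x y') \<or> (y = y' \<and> joined V g y' x) \<or>
        (\<exists>u\<in>A - {y}. \<exists>v\<in>A - {y}. ?E u v g)) = Pr (\<lambda>g. \<exists>u\<in>A - {y}. \<exists>v\<in>A - {y}. ?E u v g)"
      using False by simp
    also have "\<dots> \<le> (\<Sum>u\<in>A - {y}. Pr (\<lambda>g. \<exists>v\<in>A - {y}. ?E u v g))"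
      by (rule Pr_Ex_le[OF fA])
    also have "\<dots> \<le> (\<Sum>u\<in>A - {y}. \<Sum>v\<in>A - {y}. Pr (?E u v))"
      by (intro sum_mono Pr_Ex_le[OF fA])
    also have "\<dots> \<le> (\<Sum>u\<in>A - {y}. \<Sum>v\<in>A - {y}. (p y u * G u x) * (p y v * G v y'))"
      by (intro sum_mono E)
    also have "\<dots> = (\<Sum>u\<in>A - {y}. p y u * G u x) * (\<Sum>v\<in>A - {y}. p y v * G v y')"
      by (simp add: sum_product)
    also have "\<dots> \<le> G y x * G y y'"
      by (intro mult_mono sub assms G_nonneg sum_nonneg mult_nonneg_nonneg p_nonneg)
    finally show ?thesis by (simp add: mult.commute)
  qed
qed (use assms in \<open>auto simp: joined_fun_upd G_nonneg\<close>)

text \<open>Bonferroni's inequality over the first edge. The first correction accounts for paths from the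
  second vertex that return to \<open>v\<close>, the second one for two distinct first edges that both lead to
  \<open>x\<close>; in the latter, \<open>z\<close> is the branch vertex of the tree-graph bound. The term
  \<open>of_bool (v = x)\<close> may be added because for \<open>v = x\<close> the first correction already cancels the sum.\<close>

lemma Pr_joined_lower:
  assumes "v \<in> V" "x \<in> V"
  shows "of_bool (v = x) + (\<Sum>y\<in>V. p v y * Pr (\<lambda>g. joined V g y x))
      - G v x * (\<Sum>y\<in>V. p v y * G y v)
      - (\<Sum>z\<in>V. (\<Sum>y\<in>V. p v y * G y z)\<^sup>2 * G z x)
    \<le> Pr (\<lambda>g. joined V g v x)"
proof (cases "v = x")
  case True
  have "(\<Sum>y\<in>V. p v y * Pr (\<lambda>g. joined V g y x)) \<le> (\<Sum>y\<in>V. p v y * G y v)"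
    by (intro sum_mono mult_left_mono p_nonneg) (use Pr_joined_le[of V] assms True in auto)
  also have "\<dots> \<le> G v x * (\<Sum>y\<in>V. p v y * G y v)"
    using mult_right_mono[OF G_refl[OF assms(1)], of "\<Sum>y\<in>V. p v y * G y v"] True
    by (simp add: sum_nonneg p_nonneg G_nonneg)
  finally show ?thesis
    using True sum_nonneg[of V "\<lambda>z. (\<Sum>y\<in>V. p v y * G y z)\<^sup>2 * G z x"] G_nonneg
    by (simp add: Pr_True)
next
  case False
  let ?B = "V - {v}"
  let ?F = "\<lambda>y g. g {v, y} \<and> joined ?B g y x"
  have "(\<Sum>y\<in>?B. Pr (?F y)) - (\<Sum>y\<in>?B. \<Sum>y'\<in>?B - {y}. Pr (\<lambda>g. ?F y g \<and> ?F y' g))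
      \<le> Pr (\<lambda>g. \<exists>y\<in>?B. ?F y g)"
    by (rule bonferroni) (use finV in auto)
  also have "\<dots> \<le> Pr (\<lambda>g. joined V g v x)"
  proof (rule Pr_mono)
    fix g assume "\<exists>y\<in>?B. ?F y g"
    then obtain y where y: "y \<in> ?B" "?F y g" by blast
    then have "joined V g v y" "joined V g y x"
      using assms joined_mono[of ?B g y x V] by (auto intro!: joined_edge)
    then show "joined V g v x" by (rule joined_trans)
  qed
  finally have main: "(\<Sum>y\<in>?B. Pr (?F y)) - (\<Sum>y\<in>?B. \<Sum>y'\<in>?B - {y}. Pr (\<lambda>g. ?F y g \<and> ?F y' g))
    \<le> Pr (\<lambda>g. joined V g v x)" .
  have one: "p v y * (Pr (\<lambda>g. joined V g y x) - G y v * G v x) \<le> Pr (?F y)" if "y \<in> ?B" for y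
  proof -
    have "Pr (\<lambda>g. joined V g y x) \<le>
        Pr (\<lambda>g. joined ?B g y x \<or> (joined V g y x \<and> \<not> joined ?B g y x))"
      by (rule Pr_mono) auto
    also have "\<dots> \<le> Pr (\<lambda>g. joined ?B g y x) + Pr (\<lambda>g. joined V g y x \<and> \<not> joined ?B g y x)"
      by (rule Pr_disj)
    also have "Pr (\<lambda>g. joined V g y x \<and> \<not> joined ?B g y x) \<le> G y v * G v x"
      by (rule Pr_joined_only_through_le) (use that assms False in auto)
    finally have "p v y * (Pr (\<lambda>g. joined V g y x) - G y v * G v x)
        \<le> p v y * Pr (\<lambda>g. joined ?B g y x)"
      by (intro mult_left_mono p_nonneg) simp
    also have "\<dots> = Pr (?F y)"
      by (rule Pr_edge[symmetric]) (use that assms in \<open>auto simp: joined_fun_upd\<close>)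
    finally show ?thesis .
  qed
  have two: "Pr (\<lambda>g. ?F y g \<and> ?F y' g) \<le> p v y * p v y' * (\<Sum>z\<in>V. G y z * (G z y' * G z x))"
    if "y \<in> ?B" "y' \<in> ?B - {y}" for y y'
  proof -
    let ?D = "\<lambda>g. joined ?B g y x \<and> joined ?B g y' x"
    have "Pr (\<lambda>g. ?F y g \<and> ?F y' g) = Pr (\<lambda>g. g {v, y} \<and> (g {v, y'} \<and> ?D g))"
      by (rule arg_cong[of _ _ Pr]) auto
    also have "\<dots> = p v y * Pr (\<lambda>g. g {v, y'} \<and> ?D g)"
      by (rule Pr_edge) (use that assms in \<open>auto simp: joined_fun_upd doubleton_eq_iff\<close>)
    also have "Pr (\<lambda>g. g {v, y'} \<and> ?D g) = p v y' * Pr ?D"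
      by (rule Pr_edge) (use that assms in \<open>auto simp: joined_fun_upd\<close>)
    finally have eq: "Pr (\<lambda>g. ?F y g \<and> ?F y' g) = p v y * (p v y' * Pr ?D)" .
    have "Pr ?D \<le> (\<Sum>z\<in>V. G y z * (G z y' * G z x))"
      by (rule Pr_tree_le) (use that assms in auto)
    then have "p v y * (p v y' * Pr ?D)
        \<le> p v y * (p v y' * (\<Sum>z\<in>V. G y z * (G z y' * G z x)))"
      by (intro mult_left_mono p_nonneg)
    then show ?thesis unfolding eq by (simp add: mult.assoc)
  qed
  have "(\<Sum>y\<in>V. p v y * (Pr (\<lambda>g. joined V g y x) - G y v * G v x)) =
      (\<Sum>y\<in>?B. p v y * (Pr (\<lambda>g. joined V g y x) - G y v * G v x))"
    using sum.remove[OF finV assms(1), of "\<lambda>y. p v y * (Pr (\<lambda>g. joined V g y x) - G y v * G v x)"]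
    by (simp add: p_diag[OF assms(1)])
  also have "\<dots> \<le> (\<Sum>y\<in>?B. Pr (?F y))" by (intro sum_mono one)
  finally have o: "(\<Sum>y\<in>V. p v y * (Pr (\<lambda>g. joined V g y x) - G y v * G v x)) 
    \<le> (\<Sum>y\<in>?B. Pr (?F y))" .
  have "(\<Sum>y\<in>?B. \<Sum>y'\<in>?B - {y}. Pr (\<lambda>g. ?F y g \<and> ?F y' g)) \<le>
     (\<Sum>y\<in>?B. \<Sum>y'\<in>?B - {y}. p v y * p v y' * (\<Sum>z\<in>V. G y z * (G z y' * G z x)))"
    by (intro sum_mono two)
  also have "\<dots> \<le> (\<Sum>y\<in>?B. \<Sum>y'\<in>V. p v y * p v y' * (\<Sum>z\<in>V. G y z * (G z y' * G z x)))"
    by (intro sum_mono sum_mono2 finV mult_nonneg_nonneg p_nonneg sum_nonneg G_nonneg) auto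
  also have "\<dots> \<le> (\<Sum>y\<in>V. \<Sum>y'\<in>V. p v y * p v y' * (\<Sum>z\<in>V. G y z * (G z y' * G z x)))"
    by (intro sum_mono2 finV mult_nonneg_nonneg p_nonneg sum_nonneg G_nonneg) auto
  also have "\<dots> = (\<Sum>y\<in>V. \<Sum>y'\<in>V. \<Sum>z\<in>V. (p v y * G y z) * (p v y' * G y' z) * G z x)"
    unfolding sum_distrib_left by (intro sum.cong refl) (simp add: G_sym mult_ac)
  also have "\<dots> = (\<Sum>z\<in>V. \<Sum>y\<in>V. \<Sum>y'\<in>V. (p v y * G y z) * (p v y' * G y' z) * G z x)"
    by (subst (2) sum.swap) (subst sum.swap, simp)
  also have "\<dots> = (\<Sum>z\<in>V. (\<Sum>y\<in>V. p v y * G y z)\<^sup>2 * G z x)"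
    by (simp only: power2_eq_square sum_product) (simp only: sum_distrib_right)
  finally have t: "(\<Sum>y\<in>?B. \<Sum>y'\<in>?B - {y}. Pr (\<lambda>g. ?F y g \<and> ?F y' g)) \<le>
    (\<Sum>z\<in>V. (\<Sum>y\<in>V. p v y * G y z)\<^sup>2 * G z x)" .
  have "(\<Sum>y\<in>V. p v y * (Pr (\<lambda>g. joined V g y x) - G y v * G v x)) =
     (\<Sum>y\<in>V. p v y * Pr (\<lambda>g. joined V g y x)) - G v x * (\<Sum>y\<in>V. p v y * G y v)"
    by (simp add: right_diff_distrib sum_subtractf sum_distrib_left mult_ac)
  then show ?thesis using main o t False by simp
qed

end

section \<open>Mean cluster size and the far regime\<close>

text \<open>The quantitative setting of the lower bound: \<open>U\<close> is the one-step profile, \<open>\<eta>\<close> the value of the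
  evenly spread part of the Green function, \<open>\<epsilon>\<close> the distance from criticality, and \<open>S\<close> bounds the
  weight of short cycles. All constants are collected in \<open>K\<close>.\<close>

locale subcritical_graph = green_bounded_graph V p M G
  for V :: "'v set" and p M G +
  fixes U :: "'v \<Rightarrow> 'v \<Rightarrow> real" and K \<epsilon> \<eta> S :: real
  assumes K: "1 \<le> K"
    and U_nonneg: "0 \<le> U x y"
    and p_le_U: "x \<in> V \<Longrightarrow> y \<in> V \<Longrightarrow> p x y \<le> K * U x y"
    and U_sym: "U x y = U y x"
    and U_conv: "x \<in> V \<Longrightarrow> y \<in> V \<Longrightarrow> (\<Sum>z\<in>V. U x z * U z y) \<le> K * U x y"
    and U_mass: "x \<in> V \<Longrightarrow> (\<Sum>z\<in>V. U x z) \<le> K"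
    and U_square: "x \<in> V \<Longrightarrow> (\<Sum>z\<in>V. (U x z)\<^sup>2) \<le> S"
    and G_le: "x \<in> V \<Longrightarrow> y \<in> V \<Longrightarrow> G x y \<le> of_bool (x = y) + K * (U x y + \<eta>)"
    and p_mass: "x \<in> V \<Longrightarrow> (\<Sum>y\<in>V. p x y) = 1 - \<epsilon>"
    and \<epsilon>: "0 < \<epsilon>" "\<epsilon> \<le> 1 / 4"
    and \<eta>: "0 < \<eta>" "\<eta> * real (card V) = 1 / \<epsilon>"
begin

lemma K_powers: "1 \<le> K ^ i" "i \<le> j \<Longrightarrow> K ^ i \<le> K ^ j"
  using K by (auto intro: power_increasing)

lemma V_nonempty: "V \<noteq> {}"
  using \<eta> \<epsilon> by auto

lemma S_nonneg: "0 \<le> S"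
proof -
  obtain x where "x \<in> V" using V_nonempty by auto
  have "0 \<le> (\<Sum>z\<in>V. (U x z)\<^sup>2)" by (intro sum_nonneg) auto
  then show ?thesis using U_square[OF \<open>x \<in> V\<close>] by linarith
qed

lemma sum_of_bool: "z \<in> V \<Longrightarrow> (\<Sum>y\<in>V. f y * of_bool (y = z)) = (f z :: real)"
  using sum_of_bool_mult[of z f 1] by simp

text \<open>In contrast to \<open>G\<close> itself, \<open>p G\<close> has no point mass. On the diagonal, where \<open>p v v = 0\<close>, this
  bound is much better than the pointwise bound by \<open>U\<close>; see \<open>pG_diag_le\<close>.\<close>

lemma pG_le:
  assumes "v \<in> V" "z \<in> V"
  shows "(\<Sum>y\<in>V. p v y * G y z) \<le> p v z + K\<^sup>2 * (\<Sum>y\<in>V. U v y * U y z) + K * \<eta>"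
proof -
  have "(\<Sum>y\<in>V. p v y * G y z) \<le> (\<Sum>y\<in>V. p v y * (of_bool (y = z) + K * (U y z + \<eta>)))"
    by (intro sum_mono mult_left_mono G_le p_nonneg) (use assms in auto)
  also have "\<dots> = (\<Sum>y\<in>V. p v y * of_bool (y = z)) + K * (\<Sum>y\<in>V. p v y * U y z)
      + K * \<eta> * (\<Sum>y\<in>V. p v y)"
    by (simp add: distrib_left sum.distrib sum_distrib_left mult_ac)
  also have "(\<Sum>y\<in>V. p v y * of_bool (y = z)) = p v z"
    using assms by (intro sum_of_bool)
  also have "K * (\<Sum>y\<in>V. p v y * U y z) \<le> K * (\<Sum>y\<in>V. K * U v y * U y z)"
    by (intro mult_left_mono sum_mono mult_right_mono p_le_U U_nonneg) (use assms K in auto)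
  also have "\<dots> = K\<^sup>2 * (\<Sum>y\<in>V. U v y * U y z)"
    by (simp add: sum_distrib_left power2_eq_square mult_ac)
  also have "K * \<eta> * (\<Sum>y\<in>V. p v y) \<le> K * \<eta> * 1"
    using p_mass[OF assms(1)] \<epsilon> \<eta> K by (intro mult_left_mono) auto
  finally show ?thesis by simp
qed

lemma pG_le_U:
  assumes "v \<in> V" "z \<in> V"
  shows "(\<Sum>y\<in>V. p v y * G y z) \<le> 2 * K ^ 3 * (U v z + \<eta>)"
proof -
  have "(\<Sum>y\<in>V. p v y * G y z) \<le> K * U v z + K\<^sup>2 * (K * U v z) + K * \<eta>"
    using pG_le[OF assms] p_le_U[OF assms]
      mult_left_mono[OF U_conv[OF assms], of "K\<^sup>2"] by simp
  also have "\<dots> = K * U v z + K ^ 3 * U v z + K * \<eta>"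
    by (simp add: power3_eq_cube power2_eq_square)
  also have "K * U v z \<le> K ^ 3 * U v z"
    using K_powers(2)[of 1 3] by (intro mult_right_mono U_nonneg) simp
  also have "K * \<eta> \<le> 2 * K ^ 3 * \<eta>"
    using K_powers(2)[of 1 3] K_powers(1)[of 3] \<eta> by (intro mult_right_mono) simp_all
  finally show ?thesis by (simp add: algebra_simps)
qed

lemma pG_diag_le:
  assumes "v \<in> V"
  shows "(\<Sum>y\<in>V. p v y * G y v) \<le> K\<^sup>2 * (S + \<eta>)"
proof -
  have "(\<Sum>y\<in>V. U v y * U y v) \<le> S"
    using U_square[OF assms] by (simp add: U_sym[of _ v] power2_eq_square)
  then have "K\<^sup>2 * (\<Sum>y\<in>V. U v y * U y v) \<le> K\<^sup>2 * S" by (intro mult_left_mono) auto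
  moreover have "K * \<eta> \<le> K\<^sup>2 * \<eta>"
    using K_powers(2)[of 1 2] \<eta> by (intro mult_right_mono) simp_all
  ultimately show ?thesis using pG_le[OF assms assms] by (simp add: p_diag[OF assms] distrib_left)
qed

lemma pG_square_le:
  assumes "v \<in> V" "z \<in> V"
  shows "(\<Sum>y\<in>V. p v y * G y z)\<^sup>2 \<le> 8 * K ^ 6 * ((U v z)\<^sup>2 + \<eta>\<^sup>2)"
proof -
  have "(\<Sum>y\<in>V. p v y * G y z)\<^sup>2 \<le> (2 * K ^ 3 * (U v z + \<eta>))\<^sup>2"
    by (intro power_mono pG_le_U assms sum_nonneg mult_nonneg_nonneg p_nonneg G_nonneg)
  also have "\<dots> = 4 * K ^ 6 * (U v z + \<eta>)\<^sup>2"
    by (simp add: power_mult_distrib flip: power_mult)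
  also have "(U v z + \<eta>)\<^sup>2 \<le> 2 * ((U v z)\<^sup>2 + \<eta>\<^sup>2)"
    using zero_le_power2[of "U v z - \<eta>"] by (simp add: power2_eq_square algebra_simps)
  then have "4 * K ^ 6 * (U v z + \<eta>)\<^sup>2 \<le> 4 * K ^ 6 * (2 * ((U v z)\<^sup>2 + \<eta>\<^sup>2))"
    using K by (intro mult_left_mono) auto
  finally show ?thesis by (simp add: algebra_simps)
qed

lemma G_mass:
  assumes "z \<in> V"
  shows "(\<Sum>x\<in>V. G z x) \<le> 3 * K\<^sup>2 / \<epsilon>"
proof -
  have "(\<Sum>x\<in>V. G z x) \<le> (\<Sum>x\<in>V. of_bool (z = x) + K * (U z x + \<eta>))"
    by (intro sum_mono G_le) (use assms in auto)
  also have "\<dots> = (\<Sum>x\<in>V. 1 * of_bool (x = z)) + K * ((\<Sum>x\<in>V. U z x) + \<eta> * real (card V))"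
    by (simp add: sum.distrib sum_distrib_left algebra_simps eq_commute[of z])
  also have "(\<Sum>x\<in>V. 1 * of_bool (x = z)) = (1 :: real)" by (rule sum_of_bool[OF assms])
  also have "1 + K * ((\<Sum>x\<in>V. U z x) + \<eta> * real (card V)) \<le> 1 + K * (K + 1 / \<epsilon>)"
    using U_mass[OF assms] \<eta> K by simp
  also have "\<dots> \<le> 1 / \<epsilon> * K\<^sup>2 + 1 / \<epsilon> * K\<^sup>2 + 1 / \<epsilon> * K\<^sup>2"
  proof -
    have "1 \<le> 1 / \<epsilon>" using \<epsilon> by (simp add: field_simps)
    then have "1 * 1 \<le> 1 / \<epsilon> * K\<^sup>2" "1 * K\<^sup>2 \<le> 1 / \<epsilon> * K\<^sup>2" "K * (1 / \<epsilon>) \<le> K\<^sup>2 * (1 / \<epsilon>)"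
      using K_powers(1)[of 2] K_powers(2)[of 1 2] \<epsilon> by (intro mult_mono; simp)+
    moreover have "K * (K + 1 / \<epsilon>) = K\<^sup>2 + K * (1 / \<epsilon>)"
      by (simp add: distrib_left power2_eq_square)
    moreover have "K\<^sup>2 * (1 / \<epsilon>) = 1 / \<epsilon> * K\<^sup>2" by simp
    ultimately show ?thesis by linarith
  qed
  finally show ?thesis by simp
qed

definition cluster_size :: "'v \<Rightarrow> real" where
  "cluster_size v = (\<Sum>x\<in>V. Pr (\<lambda>g. joined V g v x))"

text \<open>Summing \<open>Pr_joined_lower\<close> over the endpoint turns the corrections into products of masses:
  the tree term becomes \<open>\<Sum>\<^sub>z (U\<^sup>2 + \<eta>\<^sup>2)\<close> times the mass of \<open>G\<close>, and \<open>\<eta>\<^sup>2\<close> times the number of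
  vertices is \<open>\<eta>/\<epsilon>\<close>.\<close>

lemma cluster_size_recursion:
  assumes "v \<in> V"
  shows "1 + (\<Sum>y\<in>V. p v y * cluster_size y) - 27 * K ^ 8 * (S + 2 * \<eta> / \<epsilon>) / \<epsilon> \<le> cluster_size v"
proof -
  let ?g = "\<lambda>z. \<Sum>y\<in>V. p v y * G y z"
  have "(\<Sum>x\<in>V. 1 * of_bool (x = v) + (\<Sum>y\<in>V. p v y * Pr (\<lambda>g. joined V g y x))
      - G v x * ?g v - (\<Sum>z\<in>V. (?g z)\<^sup>2 * G z x)) \<le> cluster_size v"
    unfolding cluster_size_def using Pr_joined_lower[OF assms]
    by (intro sum_mono) (simp add: eq_commute[of _ v])
  also have "(\<Sum>x\<in>V. 1 * of_bool (x = v) + (\<Sum>y\<in>V. p v y * Pr (\<lambda>g. joined V g y x))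
      - G v x * ?g v - (\<Sum>z\<in>V. (?g z)\<^sup>2 * G z x))
    = 1 + (\<Sum>y\<in>V. p v y * cluster_size y) - (\<Sum>x\<in>V. G v x) * ?g v
      - (\<Sum>z\<in>V. (?g z)\<^sup>2 * (\<Sum>x\<in>V. G z x))"
  proof -
    have "(\<Sum>x\<in>V. \<Sum>y\<in>V. p v y * Pr (\<lambda>g. joined V g y x)) = (\<Sum>y\<in>V. p v y * cluster_size y)"
      unfolding cluster_size_def by (subst sum.swap) (simp add: sum_distrib_left)
    moreover have "(\<Sum>x\<in>V. \<Sum>z\<in>V. (?g z)\<^sup>2 * G z x) = (\<Sum>z\<in>V. (?g z)\<^sup>2 * (\<Sum>x\<in>V. G z x))"
      by (subst sum.swap) (simp add: sum_distrib_left)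
    ultimately show ?thesis
      unfolding sum_subtractf sum.distrib sum_of_bool[OF assms] by (simp add: sum_distrib_right)
  qed
  finally have main: "1 + (\<Sum>y\<in>V. p v y * cluster_size y) - (\<Sum>x\<in>V. G v x) * ?g v
      - (\<Sum>z\<in>V. (?g z)\<^sup>2 * (\<Sum>x\<in>V. G z x)) \<le> cluster_size v" .
  have \<eta>\<epsilon>: "\<eta> \<le> \<eta> / \<epsilon>" using \<eta> \<epsilon> by (simp add: field_simps)
  have "(\<Sum>x\<in>V. G v x) * ?g v \<le> 3 * K\<^sup>2 / \<epsilon> * (K\<^sup>2 * (S + \<eta>))"
    using assms \<epsilon> by (intro mult_mono G_mass pG_diag_le sum_nonneg mult_nonneg_nonneg
        p_nonneg G_nonneg) auto
  also have "\<dots> = 3 / \<epsilon> * (K ^ 4 * (S + \<eta>))" by (simp add: algebra_simps power_def)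
  also have "\<dots> \<le> 3 / \<epsilon> * (K ^ 8 * (S + \<eta> / \<epsilon>))"
    using \<eta> \<epsilon> \<eta>\<epsilon> S_nonneg K_powers(2)[of 4 8] K_powers(1)[of 8]
    by (intro mult_left_mono mult_mono) auto
  finally have a: "(\<Sum>x\<in>V. G v x) * ?g v \<le> 3 / \<epsilon> * (K ^ 8 * (S + \<eta> / \<epsilon>))" .
  have "(\<Sum>z\<in>V. (?g z)\<^sup>2 * (\<Sum>x\<in>V. G z x))
      \<le> (\<Sum>z\<in>V. 8 * K ^ 6 * ((U v z)\<^sup>2 + \<eta>\<^sup>2) * (3 * K\<^sup>2 / \<epsilon>))"
    using assms K by (intro sum_mono mult_mono G_mass pG_square_le sum_nonneg G_nonneg) auto
  also have "\<dots> = 24 / \<epsilon> * (K ^ 8 * ((\<Sum>z\<in>V. (U v z)\<^sup>2) + \<eta>\<^sup>2 * real (card V)))"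
    unfolding sum_distrib_right[symmetric] sum_distrib_left[symmetric] sum.distrib
    by (simp add: power_def algebra_simps)
  also have "\<eta>\<^sup>2 * real (card V) = \<eta> / \<epsilon>"
    using \<eta>(2) by (simp add: power2_eq_square mult.assoc)
  also have "24 / \<epsilon> * (K ^ 8 * ((\<Sum>z\<in>V. (U v z)\<^sup>2) + \<eta> / \<epsilon>)) \<le> 24 / \<epsilon> * (K ^ 8 * (S + \<eta> / \<epsilon>))"
    using U_square[OF assms] \<epsilon> K by (intro mult_left_mono add_right_mono) auto
  finally have b: "(\<Sum>z\<in>V. (?g z)\<^sup>2 * (\<Sum>x\<in>V. G z x)) \<le> 24 / \<epsilon> * (K ^ 8 * (S + \<eta> / \<epsilon>))" .
  have "3 / \<epsilon> * (K ^ 8 * (S + \<eta> / \<epsilon>)) + 24 / \<epsilon> * (K ^ 8 * (S + \<eta> / \<epsilon>))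
    = 27 * K ^ 8 * (S + \<eta> / \<epsilon>) / \<epsilon>" by (simp flip: distrib_right add_divide_distrib)
  also have "\<dots> \<le> 27 * K ^ 8 * (S + 2 * \<eta> / \<epsilon>) / \<epsilon>"
    using \<eta> \<epsilon> K by (intro divide_right_mono mult_left_mono) (auto simp: field_simps)
  finally show ?thesis using main a b by linarith
qed

text \<open>At a vertex with the smallest mean cluster size, the recursion reads
  \<open>\<chi> \<ge> 1 + (1 - \<epsilon>) \<chi> - 1/2\<close>. Choosing the minimum replaces translation invariance.\<close>

lemma cluster_size_lower:
  assumes "54 * K ^ 8 * (S + 2 * \<eta> / \<epsilon>) \<le> \<epsilon>" "x \<in> V"
  shows "1 / (2 * \<epsilon>) \<le> cluster_size x"
proof -
  obtain v where v: "v \<in> V" "\<And>y. y \<in> V \<Longrightarrow> cluster_size v \<le> cluster_size y"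
  proof -
    have "Min (cluster_size ` V) \<in> cluster_size ` V" using finV V_nonempty by (intro Min_in) auto
    then obtain v where "v \<in> V" "cluster_size v = Min (cluster_size ` V)" by auto
    then show ?thesis using that[of v] finV by simp
  qed
  have "cluster_size v * (1 - \<epsilon>) = (\<Sum>y\<in>V. p v y * cluster_size v)"
    using p_mass[OF v(1)] by (simp flip: sum_distrib_right)
  also have "\<dots> \<le> (\<Sum>y\<in>V. p v y * cluster_size y)"
    by (intro sum_mono mult_left_mono v p_nonneg)
  finally have "1 + cluster_size v * (1 - \<epsilon>) - 27 * K ^ 8 * (S + 2 * \<eta> / \<epsilon>) / \<epsilon> \<le> cluster_size v"
    using cluster_size_recursion[OF v(1)] by linarith
  moreover have "27 * K ^ 8 * (S + 2 * \<eta> / \<epsilon>) / \<epsilon> \<le> 1 / 2"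
    using assms(1) \<epsilon> by (simp add: field_simps)
  moreover have "cluster_size v * (1 - \<epsilon>) = cluster_size v - cluster_size v * \<epsilon>"
    by (simp add: right_diff_distrib)
  ultimately have "1 / 2 \<le> cluster_size v * \<epsilon>" by linarith
  then have "1 / (2 * \<epsilon>) \<le> cluster_size v" using \<epsilon> by (simp add: field_simps)
  then show ?thesis using v(2)[OF assms(2)] by simp
qed

text \<open>The main term of \<open>Pr_joined_lower\<close> is at least \<open>c / card V\<close> times a mean cluster size, hence of
  order \<open>\<eta>\<close>. Far away, where \<open>U v x\<close> is at most of order \<open>\<eta>\<close>, each correction is a small multiple
  of \<open>\<eta>\<close>: a convolution of \<open>U\<^sup>2 \<le> u U\<close> with \<open>U\<close> reproduces \<open>u U\<close>, and the flat part of \<open>G\<close> contributes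
  \<open>S \<eta>\<close> or \<open>\<eta>\<^sup>2/\<epsilon>\<close>.\<close>

lemma Pr_joined_lower_far:
  assumes vx: "v \<in> V" "x \<in> V" "v \<noteq> x"
    and p_lower: "\<And>y. y \<in> V \<Longrightarrow> y \<noteq> v \<Longrightarrow> c / real (card V) \<le> p v y" "0 < c"
    and far: "U v x \<le> L * \<eta>" "1 \<le> L"
    and small: "54 * K ^ 8 * (S + 2 * \<eta> / \<epsilon>) \<le> \<epsilon>"
      "26 * K ^ 8 * L * (S + \<eta> / \<epsilon> + u) \<le> c / 8"
    and U_le: "\<And>z. z \<in> V \<Longrightarrow> U v z \<le> u"
  shows "c / 8 * \<eta> \<le> Pr (\<lambda>g. joined V g v x)"
proof -
  let ?g = "\<lambda>z. \<Sum>y\<in>V. p v y * G y z" and ?\<tau> = "\<lambda>y. Pr (\<lambda>g. joined V g y x)"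
  let ?N = "real (card V)"
  have N: "0 < ?N" using finV vx by (simp add: card_gt_0_iff) blast
  have u: "0 \<le> u" using U_le[OF vx(1)] U_nonneg[of v v] by linarith
  have \<eta>\<epsilon>: "\<eta> \<le> \<eta> / \<epsilon>" using \<eta> \<epsilon> by (simp add: field_simps)
  (* Half of 1 / (2 \<epsilon>) absorbs the summand for y = v, where there is no edge. *)
  have "c / ?N * (1 / (4 * \<epsilon>)) \<le> c / ?N * (cluster_size x - ?\<tau> v)"
  proof (intro mult_left_mono)
    have "1 / (4 * \<epsilon>) \<ge> 1" using \<epsilon> by (simp add: field_simps)
    moreover have "1 / (2 * \<epsilon>) = 1 / (4 * \<epsilon>) + 1 / (4 * \<epsilon>)" by (simp add: field_simps)
    ultimately show "1 / (4 * \<epsilon>) \<le> cluster_size x - ?\<tau> v"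
      using cluster_size_lower[OF small(1) vx(2)] Pr_le_1[of "\<lambda>g. joined V g v x"] by linarith
  qed (use p_lower N in auto)
  also have "cluster_size x = (\<Sum>y\<in>V. ?\<tau> y)"
    unfolding cluster_size_def by (simp add: joined_commute)
  also have "c / ?N * ((\<Sum>y\<in>V. ?\<tau> y) - ?\<tau> v) = (\<Sum>y\<in>V - {v}. c / ?N * ?\<tau> y)"
    using finV vx by (simp add: sum_diff1 right_diff_distrib diff_divide_distrib flip: sum_distrib_left sum_divide_distrib)
  also have "\<dots> \<le> (\<Sum>y\<in>V - {v}. p v y * ?\<tau> y)"
    by (intro sum_mono mult_right_mono Pr_nonneg p_lower) auto
  also have "\<dots> = (\<Sum>y\<in>V. p v y * ?\<tau> y)"
    using finV vx by (simp add: sum_diff1 p_diag[OF vx(1)])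
  also have "c / ?N * (1 / (4 * \<epsilon>)) = c / 4 * \<eta>"
    using \<eta> \<epsilon> N by (simp add: field_simps)
  finally have one: "c / 4 * \<eta> \<le> (\<Sum>y\<in>V. p v y * ?\<tau> y)" .

  have "G v x * ?g v \<le> (K * (U v x + \<eta>)) * (K\<^sup>2 * (S + \<eta>))"
    using G_le[OF vx(1,2)] vx K pG_diag_le[OF vx(1)] U_nonneg[of v x] \<eta>
    by (intro mult_mono) (auto intro!: sum_nonneg mult_nonneg_nonneg p_nonneg G_nonneg)
  also have "\<dots> \<le> (K * (L * \<eta> + L * \<eta>)) * (K\<^sup>2 * (S + \<eta> / \<epsilon> + u))"
  proof -
    have "1 * \<eta> \<le> L * \<eta>" using far \<eta> by (intro mult_right_mono) auto
    then have "U v x + \<eta> \<le> L * \<eta> + L * \<eta>" "S + \<eta> \<le> S + \<eta> / \<epsilon> + u" "0 \<le> U v x + \<eta>"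
      using far \<eta>\<epsilon> u U_nonneg[of v x] \<eta> by linarith+
    then show ?thesis using K S_nonneg \<eta> by (intro mult_mono[OF mult_left_mono mult_left_mono]) auto
  qed
  also have "\<dots> = 2 * K ^ 3 * L * (S + \<eta> / \<epsilon> + u) * \<eta>"
    by (simp add: algebra_simps power2_eq_square power3_eq_cube)
  also have "\<dots> \<le> 2 * K ^ 8 * L * (S + \<eta> / \<epsilon> + u) * \<eta>"
    using K_powers(2)[of 3 8] far \<eta> \<epsilon> u S_nonneg
    by (intro mult_right_mono) auto
  finally have two: "G v x * ?g v \<le> 2 * K ^ 8 * L * (S + \<eta> / \<epsilon> + u) * \<eta>" .

  have conv: "(\<Sum>z\<in>V. (U v z)\<^sup>2 * U z x) \<le> u * (K * U v x)"
  proof -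
    have "(\<Sum>z\<in>V. (U v z)\<^sup>2 * U z x) \<le> (\<Sum>z\<in>V. u * (U v z * U z x))"
    proof (intro sum_mono)
      fix z assume "z \<in> V"
      have "U v z * (U v z * U z x) \<le> u * (U v z * U z x)"
        by (intro mult_right_mono U_le \<open>z \<in> V\<close> mult_nonneg_nonneg U_nonneg)
      then show "(U v z)\<^sup>2 * U z x \<le> u * (U v z * U z x)"
        by (simp add: power2_eq_square mult.assoc)
    qed
    also have "\<dots> \<le> u * (K * U v x)"
      unfolding sum_distrib_left[symmetric] by (intro mult_left_mono U_conv vx u)
    finally show ?thesis .
  qed
  have "(\<Sum>z\<in>V. (?g z)\<^sup>2 * G z x) \<le> (\<Sum>z\<in>V. 8 * K ^ 6 * ((U v z)\<^sup>2 + \<eta>\<^sup>2) * G z x)"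
    by (intro sum_mono mult_right_mono pG_square_le G_nonneg vx)
  also have "\<dots> = 8 * K ^ 6 * ((\<Sum>z\<in>V. (U v z)\<^sup>2 * G z x) + \<eta>\<^sup>2 * (\<Sum>z\<in>V. G x z))"
    by (simp add: sum_distrib_left sum.distrib algebra_simps G_sym[of x])
  also have "\<dots> \<le> 8 * K ^ 6 * ((u * (L * \<eta>) + K * (u * (K * (L * \<eta>)) + \<eta> * S))
      + \<eta>\<^sup>2 * (3 * K\<^sup>2 / \<epsilon>))"
  proof (intro mult_left_mono add_mono)
    have "(\<Sum>z\<in>V. (U v z)\<^sup>2 * G z x) \<le> (\<Sum>z\<in>V. (U v z)\<^sup>2 * (of_bool (z = x) + K * (U z x + \<eta>)))"
      by (intro sum_mono mult_left_mono G_le vx) auto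
    also have "\<dots> = (\<Sum>z\<in>V. (U v z)\<^sup>2 * of_bool (z = x))
        + K * ((\<Sum>z\<in>V. (U v z)\<^sup>2 * U z x) + \<eta> * (\<Sum>z\<in>V. (U v z)\<^sup>2))"
      by (simp add: distrib_left sum.distrib sum_distrib_left mult_ac)
    also have "(\<Sum>z\<in>V. (U v z)\<^sup>2 * of_bool (z = x)) = (U v x)\<^sup>2"
      by (rule sum_of_bool[OF vx(2)])
    also have "(U v x)\<^sup>2 \<le> u * (L * \<eta>)"
      unfolding power2_eq_square using far U_le[OF vx(2)] u by (intro mult_mono U_nonneg) auto
    also have "K * ((\<Sum>z\<in>V. (U v z)\<^sup>2 * U z x) + \<eta> * (\<Sum>z\<in>V. (U v z)\<^sup>2))
        \<le> K * (u * (K * (L * \<eta>)) + \<eta> * S)"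
    proof (intro mult_left_mono add_mono)
      have "u * (K * U v x) \<le> u * (K * (L * \<eta>))"
        using far u K by (intro mult_left_mono) auto
      then show "(\<Sum>z\<in>V. (U v z)\<^sup>2 * U z x) \<le> u * (K * (L * \<eta>))" using conv by linarith
    qed (use K \<eta> U_square vx in auto)
    finally show "(\<Sum>z\<in>V. (U v z)\<^sup>2 * G z x) \<le> u * (L * \<eta>) + K * (u * (K * (L * \<eta>)) + \<eta> * S)"
      by simp
  qed (use K G_mass vx in auto)
  also have "u * (L * \<eta>) + K * (u * (K * (L * \<eta>)) + \<eta> * S) + \<eta>\<^sup>2 * (3 * K\<^sup>2 / \<epsilon>)
      \<le> 3 * K\<^sup>2 * L * (S + \<eta> / \<epsilon> + u) * \<eta>"
  proof -
    have a: "1 * (u * L * \<eta>) \<le> K\<^sup>2 * (u * L * \<eta>)"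
      using K_powers(1)[of 2] u far \<eta> by (intro mult_right_mono) auto
    have b: "1 * K * S * \<eta> \<le> L * K\<^sup>2 * S * \<eta>"
      using K_powers(2)[of 1 2] far \<eta> S_nonneg K by (intro mult_right_mono mult_mono) auto
    have c: "1 * (K\<^sup>2 * (\<eta> / \<epsilon>) * \<eta>) \<le> L * (K\<^sup>2 * (\<eta> / \<epsilon>) * \<eta>)"
      using far \<eta> \<epsilon> by (intro mult_right_mono) auto
    have "0 \<le> K\<^sup>2 * L * S * \<eta>" "0 \<le> K\<^sup>2 * L * u * \<eta>" using far u \<eta> S_nonneg by auto
    moreover have "u * (L * \<eta>) + K * (u * (K * (L * \<eta>)) + \<eta> * S) + \<eta>\<^sup>2 * (3 * K\<^sup>2 / \<epsilon>)
        = 1 * (u * L * \<eta>) + K\<^sup>2 * (u * L * \<eta>) + 1 * K * S * \<eta> + 3 * (1 * (K\<^sup>2 * (\<eta> / \<epsilon>) * \<eta>))"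
      by (simp add: algebra_simps power2_eq_square)
    moreover have "3 * K\<^sup>2 * L * (S + \<eta> / \<epsilon> + u) * \<eta> = 3 * (K\<^sup>2 * L * S * \<eta>)
        + 3 * (L * (K\<^sup>2 * (\<eta> / \<epsilon>) * \<eta>)) + 3 * (K\<^sup>2 * L * u * \<eta>)"
      by (simp add: algebra_simps)
    moreover have "K\<^sup>2 * (u * L * \<eta>) = K\<^sup>2 * L * u * \<eta>" "L * K\<^sup>2 * S * \<eta> = K\<^sup>2 * L * S * \<eta>" by simp_all
    ultimately show ?thesis using a b c by linarith
  qed
  also have "8 * K ^ 6 * (3 * K\<^sup>2 * L * (S + \<eta> / \<epsilon> + u) * \<eta>)
      = 24 * K ^ 8 * L * (S + \<eta> / \<epsilon> + u) * \<eta>"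
    by (simp add: power_def algebra_simps)
  finally have three: "(\<Sum>z\<in>V. (?g z)\<^sup>2 * G z x) \<le> 24 * K ^ 8 * L * (S + \<eta> / \<epsilon> + u) * \<eta>"
    using K by (simp add: mult_left_mono)

  have four: "2 * K ^ 8 * L * (S + \<eta> / \<epsilon> + u) * \<eta> + 24 * K ^ 8 * L * (S + \<eta> / \<epsilon> + u) * \<eta>
      \<le> c / 8 * \<eta>"
  proof -
    have "26 * K ^ 8 * L * (S + \<eta> / \<epsilon> + u) * \<eta> \<le> c / 8 * \<eta>"
      using small(2) \<eta> by (intro mult_right_mono) auto
    then show ?thesis by (simp flip: distrib_right)
  qed
  have five: "(\<Sum>y\<in>V. p v y * ?\<tau> y) - G v x * ?g v - (\<Sum>z\<in>V. (?g z)\<^sup>2 * G z x)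
      \<le> Pr (\<lambda>g. joined V g v x)"
    using Pr_joined_lower[OF vx(1,2)] vx(3) by simp
  have six: "c / 4 * \<eta> = c / 8 * \<eta> + c / 8 * \<eta>" by simp
  have "b \<le> t" if "a \<le> s" "g \<le> e" "h \<le> f" "e + f \<le> b" "s - g - h \<le> t" "a = b + b"
    for a b s g h e f t :: real
    using that by linarith
  from this[OF one two three four five six] show ?thesis .
qed

end

section \<open>A supersolution from power laws\<close>

text \<open>If convolution with \<open>p\<close> moves each profile \<open>q j\<close> to the next one at the price of a factor \<open>B\<close>,
  then weights \<open>B ^ Suc j\<close> make the sum telescope under \<open>p\<close>. What is left over is the flat
  profile \<open>q J\<close>, which is at most what the constant \<open>\<eta>\<close> loses in one step, since \<open>p\<close> has
  mass \<open>1 - \<epsilon>\<close>.\<close>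

lemma (in bernoulli_graph) supersolution:
  assumes q_nonneg: "\<And>j x y. 0 \<le> q j x y"
    and q_sym: "\<And>j x y. q j x y = q j y x"
    and q_0: "\<And>x y. x \<in> V \<Longrightarrow> y \<in> V \<Longrightarrow> p x y \<le> B * q 0 x y"
    and q_Suc: "\<And>j x y. j < J \<Longrightarrow> x \<in> V \<Longrightarrow> y \<in> V \<Longrightarrow>
        (\<Sum>u\<in>V. p x u * q j u y) \<le> B * q (Suc j) x y"
    and q_J: "\<And>x y. x \<in> V \<Longrightarrow> y \<in> V \<Longrightarrow> q J x y \<le> \<eta> * \<epsilon>"
    and p_mass: "\<And>x. x \<in> V \<Longrightarrow> (\<Sum>y\<in>V. p x y) = 1 - \<epsilon>"
    and nonneg: "0 \<le> B" "0 \<le> \<eta>"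
  shows "green_bounded_graph V p M
    (\<lambda>x y. of_bool (x = y) + (\<Sum>j<J. B ^ Suc j * q j x y) + B ^ Suc J * \<eta>)"
proof
  fix x y
  let ?G = "\<lambda>x y. of_bool (x = y) + (\<Sum>j<J. B ^ Suc j * q j x y) + B ^ Suc J * \<eta>"
  show "0 \<le> ?G x y"
    by (intro add_nonneg_nonneg sum_nonneg mult_nonneg_nonneg zero_le_power q_nonneg nonneg) auto
  show "?G x y = ?G y x" using q_sym[of _ x y] by (simp add: eq_commute[of x])
  assume xy: "x \<in> V" "y \<in> V"
  have "(\<Sum>u\<in>V. p x u * ?G u y) = (\<Sum>u\<in>V. if u = y then p x u else 0)
      + (\<Sum>u\<in>V. \<Sum>j<J. B ^ Suc j * (p x u * q j u y)) + B ^ Suc J * \<eta> * (\<Sum>u\<in>V. p x u)"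
    unfolding sum_distrib_left sum.distrib[symmetric]
    by (intro sum.cong refl) (simp add: distrib_left sum_distrib_left mult_ac)
  also have "(\<Sum>u\<in>V. \<Sum>j<J. B ^ Suc j * (p x u * q j u y))
      = (\<Sum>j<J. B ^ Suc j * (\<Sum>u\<in>V. p x u * q j u y))"
    by (subst sum.swap) (simp add: sum_distrib_left)
  also have "(\<Sum>u\<in>V. if u = y then p x u else 0) = p x y" using finV xy by simp
  also have "(\<Sum>u\<in>V. p x u) = 1 - \<epsilon>" by (rule p_mass[OF xy(1)])
  also have "p x y + (\<Sum>j<J. B ^ Suc j * (\<Sum>u\<in>V. p x u * q j u y)) + B ^ Suc J * \<eta> * (1 - \<epsilon>)
      \<le> B * q 0 x y + (\<Sum>j<J. B ^ Suc j * (B * q (Suc j) x y)) + B ^ Suc J * \<eta> * (1 - \<epsilon>)"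
    by (intro add_mono sum_mono mult_left_mono q_Suc q_0 xy zero_le_power nonneg)
      (use nonneg in auto)
  also have "B * q 0 x y + (\<Sum>j<J. B ^ Suc j * (B * q (Suc j) x y))
      = (\<Sum>j<Suc J. B ^ Suc j * q j x y)"
    unfolding sum.lessThan_Suc_shift by (simp add: mult_ac)
  also have "\<dots> + B ^ Suc J * \<eta> * (1 - \<epsilon>)
      = (\<Sum>j<J. B ^ Suc j * q j x y) + B ^ Suc J * (q J x y - \<eta> * \<epsilon>) + B ^ Suc J * \<eta>"
    by (simp add: algebra_simps)
  also have "B ^ Suc J * (q J x y - \<eta> * \<epsilon>) \<le> 0"
    using q_J[OF xy] nonneg by (intro mult_nonneg_nonpos) auto
  finally show "of_bool (x = y) + (\<Sum>u\<in>V. p x u * ?G u y) \<le> ?G x y" by simp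
qed

text \<open>Think of \<open>h x y\<close> as \<open>n\<close> divided by the distance of \<open>x\<close> and \<open>y\<close>. The triangle inequality becomes
  \<open>h_min\<close>, and the growth of balls becomes \<open>h_sum\<close>. In these units the profiles are
  monotone in their exponent.\<close>

locale power_law_space =
  fixes V :: "'v set" and h :: "'v \<Rightarrow> 'v \<Rightarrow> real" and n d :: real and C :: "real \<Rightarrow> real"
  assumes fin: "finite V"
    and n_ge_1: "1 \<le> n"
    and card_V: "real (card V) = n powr d"
    and h_bounds: "1 \<le> h x y" "h x y \<le> n"
    and h_sym: "h x y = h y x"
    and h_min: "x \<in> V \<Longrightarrow> y \<in> V \<Longrightarrow> z \<in> V \<Longrightarrow> min (h x z) (h z y) \<le> 2 * h x y"
    and h_sum: "0 \<le> t \<Longrightarrow> t < d \<Longrightarrow> x \<in> V \<Longrightarrow> (\<Sum>y\<in>V. h x y powr t) \<le> C t * n powr d"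
begin

text \<open>The power law with exponent \<open>a\<close>, normalised to have mass of order one; for \<open>a = 0\<close> it is the
  uniform distribution.\<close>

definition profile :: "real \<Rightarrow> 'v \<Rightarrow> 'v \<Rightarrow> real" where
  "profile a x y = h x y powr a / n powr d"

lemma profile_nonneg: "0 \<le> profile a x y"
  by (simp add: profile_def)

lemma profile_sym: "profile a x y = profile a y x"
  by (simp add: profile_def h_sym)

lemma n_pos: "0 < n"
  using n_ge_1 by linarith

lemma profile_mono: "a \<le> b \<Longrightarrow> profile a x y \<le> profile b x y"
  unfolding profile_def using h_bounds by (intro divide_right_mono powr_mono) auto

lemma profile_mass:
  assumes "0 \<le> a" "a < d" "x \<in> V"
  shows "(\<Sum>y\<in>V. profile a x y) \<le> C a"
proof -
  have "(\<Sum>y\<in>V. profile a x y) = (\<Sum>y\<in>V. h x y powr a) / n powr d"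
    by (simp add: profile_def sum_divide_distrib)
  also have "\<dots> \<le> C a * n powr d / n powr d"
    by (intro divide_right_mono h_sum assms) auto
  finally show ?thesis using n_pos by simp
qed

lemma profile_le: "0 \<le> a \<Longrightarrow> profile a x y \<le> n powr (a - d)"
  unfolding profile_def powr_diff using h_bounds[of x y] n_pos
  by (intro divide_right_mono powr_mono2) auto

text \<open>The free exponent \<open>s\<close> covers the convergent and the divergent range of the sum, including the
  logarithmic case \<open>2 a = d\<close>, by one formula.\<close>

lemma profile_square:
  assumes "0 \<le> s" "s < d" "s \<le> 2 * a" "x \<in> V"
  shows "(\<Sum>y\<in>V. (profile a x y)\<^sup>2) \<le> C s * n powr (2 * a - s - d)"
proof -
  have "(profile a x y)\<^sup>2 \<le> h x y powr s * (n powr (2 * a - s) / n powr (2 * d))" for y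
  proof -
    have "(profile a x y)\<^sup>2 = h x y powr s * (h x y powr (2 * a - s) / n powr (2 * d))"
      unfolding profile_def power2_eq_square
      using h_bounds[of x y] by (simp flip: powr_add)
    also have "\<dots> \<le> h x y powr s * (n powr (2 * a - s) / n powr (2 * d))"
      using h_bounds[of x y] assms by (intro mult_left_mono divide_right_mono powr_mono2) auto
    finally show ?thesis .
  qed
  then have "(\<Sum>y\<in>V. (profile a x y)\<^sup>2)
      \<le> (\<Sum>y\<in>V. h x y powr s) * (n powr (2 * a - s) / n powr (2 * d))"
    unfolding sum_distrib_right by (intro sum_mono)
  also have "\<dots> \<le> C s * n powr d * (n powr (2 * a - s) / n powr (2 * d))"
    by (intro mult_right_mono h_sum assms) auto
  also have "\<dots> = C s * (n powr (2 * a - s) * n powr d / n powr (2 * d))"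
    by simp
  also have "n powr (2 * a - s) * n powr d / n powr (2 * d) = n powr (2 * a - s - d)"
    by (simp add: powr_add[symmetric] powr_diff[symmetric])
  finally show ?thesis .
qed

text \<open>One of \<open>h x z\<close> and \<open>h z y\<close> is at most \<open>2 h x y\<close>, and the factor \<open>g\<close> of its exponent can be pulled
  out of the sum. The larger one then carries the remaining exponent \<open>a + b - g\<close>, which is
  summable. So convolution with an exponent \<open>a < d\<close> lowers the exponent \<open>b\<close> by any amount less than
  \<open>d - a\<close>, until it reaches \<open>0\<close>.\<close>

lemma profile_convolution:
  assumes g: "0 \<le> g" "g \<le> a" "g \<le> b" "a + b - g < d" and xy: "x \<in> V" "y \<in> V"
  shows "(\<Sum>z\<in>V. profile a x z * profile b z y) \<le> 2 powr (g + 1) * C (a + b - g) * profile g x y"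
proof -
  define t where "t = a + b - g"
  have pw: "u powr a * v powr b \<le> 2 powr g * w powr g * (u powr t + v powr t)"
    if "1 \<le> u" "1 \<le> v" "1 \<le> w" "min u v \<le> 2 * w" for u v w
  proof (cases "u \<le> v")
    case True
    have "u powr a * v powr b = u powr g * (u powr (a - g) * v powr b)"
      using that by (simp add: powr_add[symmetric] mult.assoc[symmetric])
    also have "\<dots> \<le> (2 * w) powr g * (v powr (a - g) * v powr b)"
      using that True g by (intro mult_mono powr_mono2) auto
    also have "\<dots> = 2 powr g * w powr g * v powr t"
      using that by (simp add: powr_mult powr_add[symmetric] t_def algebra_simps)
    also have "\<dots> \<le> 2 powr g * w powr g * (u powr t + v powr t)"
      by (intro mult_left_mono) auto
    finally show ?thesis .
  next
    case False
    have "u powr a * v powr b = v powr g * (u powr a * v powr (b - g))"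
      using that by (simp add: powr_add[symmetric] mult.left_commute)
    also have "\<dots> \<le> (2 * w) powr g * (u powr a * u powr (b - g))"
      using that False g by (intro mult_mono powr_mono2) auto
    also have "\<dots> = 2 powr g * w powr g * u powr t"
      using that by (simp add: powr_mult powr_add[symmetric] t_def algebra_simps)
    also have "\<dots> \<le> 2 powr g * w powr g * (u powr t + v powr t)"
      by (intro mult_left_mono) auto
    finally show ?thesis .
  qed
  have "(\<Sum>z\<in>V. profile a x z * profile b z y)
      = (\<Sum>z\<in>V. h x z powr a * h z y powr b) / (n powr d * n powr d)"
    by (simp add: profile_def sum_divide_distrib)
  also have "\<dots> \<le> (\<Sum>z\<in>V. 2 powr g * h x y powr g * (h x z powr t + h y z powr t))
      / (n powr d * n powr d)"
    by (intro divide_right_mono sum_mono) (use pw h_bounds h_min xy in \<open>auto simp: h_sym[of y]\<close>)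
  also have "\<dots> = 2 powr g * h x y powr g * ((\<Sum>z\<in>V. h x z powr t) + (\<Sum>z\<in>V. h y z powr t))
      / (n powr d * n powr d)"
    by (simp only: sum_distrib_left[symmetric] sum.distrib)
  also have "\<dots> \<le> 2 powr g * h x y powr g * (C t * n powr d + C t * n powr d)
      / (n powr d * n powr d)"
    by (intro divide_right_mono mult_left_mono add_mono h_sum) (use g xy in \<open>auto simp: t_def\<close>)
  also have "\<dots> = 2 powr (g + 1) * C t * profile g x y"
    using n_pos by (simp add: profile_def powr_add)
  finally show ?thesis by (simp add: t_def)
qed

end

text \<open>The exponents \<open>\<beta> j\<close> descend from \<open>\<alpha>\<close> to \<open>0\<close> in steps of \<open>(d - \<alpha>)/2\<close>, and their profiles feed
  \<open>supersolution\<close>. The number of steps depends only on \<open>\<alpha>\<close> and \<open>d\<close>, so that the constant \<open>K\<close> is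
  uniform in the graph and in \<open>\<epsilon>\<close>.\<close>

lemma subcritical_graph_exists:
  fixes C :: "real \<Rightarrow> real" and \<alpha> d C1 :: real
  assumes "0 < \<alpha>" "\<alpha> < d" "0 \<le> C1"
  obtains K where "1 \<le> K"
    "\<And>(V :: 'v set) h n p M \<epsilon> S. power_law_space V h n d C \<Longrightarrow> bernoulli_graph V p M \<Longrightarrow>
      (\<forall>x\<in>V. \<forall>y\<in>V. p x y \<le> C1 * power_law_space.profile h n d \<alpha> x y) \<Longrightarrow>
      (\<forall>x\<in>V. (\<Sum>y\<in>V. p x y) = 1 - \<epsilon>) \<Longrightarrow> 0 < \<epsilon> \<Longrightarrow> \<epsilon> \<le> 1 / 4 \<Longrightarrow>
      (\<forall>x\<in>V. (\<Sum>y\<in>V. (power_law_space.profile h n d \<alpha> x y)\<^sup>2) \<le> S) \<Longrightarrow>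
      \<exists>G. subcritical_graph V p M G (power_law_space.profile h n d \<alpha>) K \<epsilon> (1 / (n powr d * \<epsilon>)) S"
proof -
  define \<delta> where "\<delta> = (d - \<alpha>) / 2"
  define \<beta> where "\<beta> j = max 0 (\<alpha> - real j * \<delta>)" for j :: nat
  define J where "J = nat \<lceil>\<alpha> / \<delta>\<rceil>"
  have \<delta>: "0 < \<delta>" "\<alpha> + \<delta> < d" using assms by (auto simp: \<delta>_def field_simps)
  have \<beta>_0: "\<beta> 0 = \<alpha>" using assms by (simp add: \<beta>_def)
  have "\<alpha> / \<delta> \<le> real J" unfolding J_def by linarith
  then have \<beta>_J: "\<beta> J = 0" using \<delta> by (simp add: \<beta>_def field_simps)
  have \<beta>: "0 \<le> \<beta> j" "\<beta> (Suc j) \<le> \<beta> j" "\<beta> j \<le> \<alpha>" "\<alpha> + \<beta> j - \<beta> (Suc j) < d" for j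
    using \<delta> assms by (auto simp: \<beta>_def max_def algebra_simps)
  define c where "c j = C1 * (2 powr (\<beta> (Suc j) + 1) * C (\<alpha> + \<beta> j - \<beta> (Suc j)))" for j
  define B where "B = Max ({1, C1, C \<alpha>, 2 powr (\<alpha> + 1) * C \<alpha>} \<union> c ` {..<J})"
  have B: "1 \<le> B" "C1 \<le> B" "C \<alpha> \<le> B" "2 powr (\<alpha> + 1) * C \<alpha> \<le> B" "\<And>j. j < J \<Longrightarrow> c j \<le> B"
    unfolding B_def by (rule Max_ge; simp)+
  (* Each of the J profiles and the flat part has weight at most B ^ Suc J. *)
  define K where "K = real (Suc J) * B ^ Suc J"
  have BK: "B ^ Suc j \<le> B ^ Suc J" if "j \<le> J" for j
    using B that by (intro power_increasing) auto
  have "1 * B ^ Suc 0 \<le> K" unfolding K_def using B BK[of 0] by (intro mult_mono) auto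
  then have K: "B \<le> K" by simp
  show thesis
  proof (rule that[of K])
    show "1 \<le> K" using B K by linarith
  next
    fix V :: "'v set" and h n p M \<epsilon> S
    assume sp: "power_law_space V h n d C" and gr: "bernoulli_graph V p M"
    interpret power_law_space V h n d C by (rule sp)
    interpret bernoulli_graph V p M by (rule gr)
    assume p: "\<forall>x\<in>V. \<forall>y\<in>V. p x y \<le> C1 * profile \<alpha> x y"
      and mass: "\<forall>x\<in>V. (\<Sum>y\<in>V. p x y) = 1 - \<epsilon>" and \<epsilon>: "0 < \<epsilon>" "\<epsilon> \<le> 1 / 4"
      and sq: "\<forall>x\<in>V. (\<Sum>y\<in>V. (profile \<alpha> x y)\<^sup>2) \<le> S"
    define \<eta> where "\<eta> = 1 / (n powr d * \<epsilon>)"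
    define G where "G x y = of_bool (x = y) + (\<Sum>j<J. B ^ Suc j * profile (\<beta> j) x y) + B ^ Suc J * \<eta>"
      for x y
    have \<eta>: "0 < \<eta>" "\<eta> * \<epsilon> = 1 / n powr d" using \<epsilon> n_pos by (auto simp: \<eta>_def)
    interpret green_bounded_graph V p M G
      unfolding G_def
    proof (rule supersolution)
      fix j x y assume xy: "x \<in> V" "y \<in> V"
      {
        have "p x y \<le> C1 * profile \<alpha> x y" using p xy by blast
        also have "\<dots> \<le> B * profile \<alpha> x y" using B by (intro mult_right_mono profile_nonneg)
        finally show "p x y \<le> B * profile (\<beta> 0) x y" by (simp add: \<beta>_0)
      next
        show "profile (\<beta> J) x y \<le> \<eta> * \<epsilon>"
          using h_bounds[of x y] by (simp add: \<beta>_J \<eta> profile_def)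
      next
        assume j: "j < J"
        have "(\<Sum>u\<in>V. p x u * profile (\<beta> j) u y)
            \<le> (\<Sum>u\<in>V. C1 * profile \<alpha> x u * profile (\<beta> j) u y)"
          using p xy by (intro sum_mono mult_right_mono profile_nonneg) auto
        also have "\<dots> = C1 * (\<Sum>u\<in>V. profile \<alpha> x u * profile (\<beta> j) u y)"
          by (simp add: sum_distrib_left mult.assoc)
        also have "\<dots> \<le> C1 * (2 powr (\<beta> (Suc j) + 1) * C (\<alpha> + \<beta> j - \<beta> (Suc j)) * profile (\<beta> (Suc j)) x y)"
          using \<beta>[of j] \<beta>[of "Suc j"] assms xy by (intro mult_left_mono profile_convolution) auto
        also have "\<dots> = c j * profile (\<beta> (Suc j)) x y" by (simp add: c_def)
        also have "\<dots> \<le> B * profile (\<beta> (Suc j)) x y"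
          using B j by (intro mult_right_mono profile_nonneg) auto
        finally show "(\<Sum>u\<in>V. p x u * profile (\<beta> j) u y) \<le> B * profile (\<beta> (Suc j)) x y" .
      }
    qed (use B \<eta> mass in \<open>auto simp: profile_nonneg profile_sym\<close>)
    have "subcritical_graph V p M G (profile \<alpha>) K \<epsilon> \<eta> S"
    proof
      fix x y assume xy: "x \<in> V" "y \<in> V"
      have "p x y \<le> C1 * profile \<alpha> x y" using p xy by blast
      also have "\<dots> \<le> K * profile \<alpha> x y" using B K by (intro mult_right_mono profile_nonneg) auto
      finally show "p x y \<le> K * profile \<alpha> x y" .
      have "(\<Sum>z\<in>V. profile \<alpha> x z * profile \<alpha> z y)
          \<le> 2 powr (\<alpha> + 1) * C (\<alpha> + \<alpha> - \<alpha>) * profile \<alpha> x y"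
        using assms xy by (intro profile_convolution) auto
      also have "\<dots> \<le> K * profile \<alpha> x y" using B K by (intro mult_right_mono profile_nonneg) auto
      finally show "(\<Sum>z\<in>V. profile \<alpha> x z * profile \<alpha> z y) \<le> K * profile \<alpha> x y" .
      have "(\<Sum>j<J. B ^ Suc j * profile (\<beta> j) x y) \<le> (\<Sum>j<J. B ^ Suc J * profile \<alpha> x y)"
        using B BK \<beta> by (intro sum_mono mult_mono profile_mono profile_nonneg) auto
      also have "\<dots> = real J * B ^ Suc J * profile \<alpha> x y" by simp
      also have "\<dots> \<le> K * profile \<alpha> x y"
        unfolding K_def using B by (intro mult_right_mono profile_nonneg) auto
      finally have "(\<Sum>j<J. B ^ Suc j * profile (\<beta> j) x y) \<le> K * profile \<alpha> x y" .
      moreover have "1 * B ^ Suc J * \<eta> \<le> K * \<eta>"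
        unfolding K_def using B \<eta> by (intro mult_right_mono) auto
      ultimately show "G x y \<le> of_bool (x = y) + K * (profile \<alpha> x y + \<eta>)"
        unfolding G_def by (simp add: distrib_left)
    next
      fix x assume "x \<in> V"
      show "(\<Sum>z\<in>V. profile \<alpha> x z) \<le> K"
        using profile_mass[of \<alpha> x] assms B K \<open>x \<in> V\<close> by simp
      show "(\<Sum>z\<in>V. (profile \<alpha> x z)\<^sup>2) \<le> S" using sq \<open>x \<in> V\<close> by blast
      show "(\<Sum>y\<in>V. p x y) = 1 - \<epsilon>" using mass \<open>x \<in> V\<close> by blast
    next
      show "\<eta> * real (card V) = 1 / \<epsilon>" using n_pos by (simp add: card_V \<eta>_def)
    qed (use B K \<epsilon> \<eta> in \<open>auto simp: profile_nonneg profile_sym\<close>)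
    then show "\<exists>G. subcritical_graph V p M G (profile \<alpha>) K \<epsilon> (1 / (n powr d * \<epsilon>)) S"
      unfolding \<eta>_def by blast
  qed
qed

section \<open>Spheres in the torus\<close>

text \<open>The \<open>\<ell>\<^sup>\<infinity>\<close> norm as a natural number, so that spheres can be counted.\<close>

definition vnorm :: "int ^ 'd \<Rightarrow> nat" where
  "vnorm v = Max (range (\<lambda>i. nat \<bar>v $ i\<bar>))"

lemma vnorm_le_iff: "vnorm v \<le> k \<longleftrightarrow> (\<forall>i. \<bar>v $ i\<bar> \<le> int k)"
  unfolding vnorm_def by (subst Max_le_iff) (auto simp: nat_le_iff)

lemma linf_dist_add: "linf_dist a (a + v) = real (vnorm v)"
proof -
  have "int (vnorm v) = Max (int ` range (\<lambda>i. nat \<bar>v $ i\<bar>))"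
    unfolding vnorm_def by (rule mono_Max_commute) (auto simp: mono_def)
  also have "int ` range (\<lambda>i. nat \<bar>v $ i\<bar>) = range (\<lambda>i. \<bar>a $ i - (a + v) $ i\<bar>)"
    by (auto simp: image_image)
  finally show ?thesis unfolding linf_dist_def by (metis of_int_of_nat_eq)
qed

lemma linf_dist_vnorm: "linf_dist a b = real (vnorm (b - a))"
  using linf_dist_add[of a "b - a"] by simp

lemma vnorm_triangle: "vnorm (v + w) \<le> vnorm v + vnorm w"
proof -
  have "\<bar>(v + w) $ i\<bar> \<le> int (vnorm v + vnorm w)" for i
  proof -
    have "\<bar>v $ i\<bar> \<le> int (vnorm v)" "\<bar>w $ i\<bar> \<le> int (vnorm w)"
      using vnorm_le_iff[of v "vnorm v"] vnorm_le_iff[of w "vnorm w"] by blast+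
    then show ?thesis using abs_triangle_ineq[of "v $ i" "w $ i"] by simp
  qed
  then show ?thesis unfolding vnorm_le_iff by blast
qed

abbreviation residue :: "nat \<Rightarrow> int ^ 'd \<Rightarrow> (int ^ 'd) set" where
  "residue n a \<equiv> torus_rel n `` {a}"

lemma residue_in_torus: "residue n a \<in> torus n"
  by (auto simp: torus_def intro: quotientI)

lemma torusE:
  assumes "x \<in> torus n"
  obtains a where "x = residue n a"
  using assms by (auto simp: torus_def elim: quotientE)

lemma residue_eq_iff: "residue n a = residue n b \<longleftrightarrow> (\<forall>i. [a $ i = b $ i] (mod int n))"
  using eq_equiv_class_iff[OF equiv_torus_rel, of a b n] by (simp add: torus_rel_def)

lemma mem_residue: "b \<in> residue n a \<longleftrightarrow> (\<forall>i. [a $ i = b $ i] (mod int n))"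
  by (simp add: torus_rel_def)

lemma residue_refl: "a \<in> residue n a"
  by (simp add: torus_rel_def)

text \<open>Representatives of smallest norm for the residue classes modulo \<open>n\<close>. For even \<open>n\<close> the box is
  not symmetric, as only one of \<open>n/2\<close> and \<open>- n/2\<close> may be kept.\<close>

definition centred_box :: "nat \<Rightarrow> (int ^ 'd) set" where
  "centred_box n = {v. \<forall>i. - int ((n - 1) div 2) \<le> v $ i \<and> v $ i \<le> int (n div 2)}"

lemma torus_dist_le:
  assumes "a \<in> x" "b \<in> y"
  shows "torus_dist x y \<le> linf_dist a b"
  unfolding torus_dist_def
proof (rule cINF_lower2[where x = "(a, b)"])
  show "bdd_below ((\<lambda>(a, b). linf_dist a b) ` (x \<times> y))"
    by (rule bdd_belowI[of _ 0]) (auto simp: linf_dist_vnorm)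
qed (use assms in auto)

text \<open>Any integer congruent to \<open>t\<close> modulo \<open>n\<close> has absolute value at least \<open>\<bar>t\<bar>\<close> if \<open>2 \<bar>t\<bar> \<le> n\<close>; so the
  infimum over representatives is attained in every coordinate at once.\<close>

lemma torus_dist_residue:
  fixes a v :: "int ^ 'd"
  assumes "v \<in> centred_box n"
  shows "torus_dist (residue n a) (residue n (a + v)) = real (vnorm v)"
proof (rule antisym)
  show "torus_dist (residue n a) (residue n (a + v)) \<le> real (vnorm v)"
    using torus_dist_le[of a "residue n a" "a + v" "residue n (a + v)"]
    by (simp only: residue_refl linf_dist_add)
  show "real (vnorm v) \<le> torus_dist (residue n a) (residue n (a + v))"
    unfolding torus_dist_def
  proof (rule cINF_greatest)
    have "(a, a + v) \<in> residue n a \<times> residue n (a + v)" by (simp only: residue_refl mem_Times_iff fst_conv snd_conv)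
    then show "residue n a \<times> residue n (a + v) \<noteq> {}" by blast
  next
    fix c assume c: "c \<in> residue n a \<times> residue n (a + v)"
    obtain a' b' where c_eq: "c = (a', b')" by (cases c)
    have "a' \<in> residue n a" "b' \<in> residue n (a + v)" using c unfolding c_eq by blast+
    then have ab: "[a $ i = a' $ i] (mod int n)" "[(a + v) $ i = b' $ i] (mod int n)" for i
      unfolding mem_residue by blast+
    define w where "w = b' - a'"
    have "\<bar>v $ i\<bar> \<le> \<bar>w $ i\<bar>" for i
    proof (rule ccontr)
      assume less: "\<not> \<bar>v $ i\<bar> \<le> \<bar>w $ i\<bar>"
      have "[(a + v) $ i - a $ i = b' $ i - a' $ i] (mod int n)"
        using ab[of i] by (intro cong_diff) auto
      then have dvd: "int n dvd v $ i - w $ i"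
        by (simp add: w_def cong_iff_dvd_diff)
      have "2 * \<bar>v $ i\<bar> \<le> int n"
      proof -
        have "- int ((n - 1) div 2) \<le> v $ i" "v $ i \<le> int (n div 2)"
          using assms unfolding centred_box_def by blast+
        moreover have "2 * int ((n - 1) div 2) \<le> int n" "2 * int (n div 2) \<le> int n"
          by linarith+
        ultimately show ?thesis by (simp add: abs_if)
      qed
      then have "\<bar>v $ i - w $ i\<bar> < int n" using less by linarith
      then have "v $ i - w $ i = 0" using dvd zdvd_imp_le[of "int n" "\<bar>v $ i - w $ i\<bar>"] by fastforce
      then show False using less by simp
    qed
    moreover have "\<bar>w $ i\<bar> \<le> int (vnorm w)" for i using vnorm_le_iff[of w "vnorm w"] by blast
    ultimately have "vnorm v \<le> vnorm w" unfolding vnorm_le_iff by (blast intro: order_trans)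
    then show "real (vnorm v) \<le> (case c of (a, b) \<Rightarrow> linf_dist a b)"
      by (simp add: c_eq linf_dist_vnorm w_def)
  qed
qed

lemma bij_betw_centred_box:
  fixes a :: "int ^ 'd"
  assumes "n \<ge> 1"
  shows "bij_betw (\<lambda>v. residue n (a + v)) (centred_box n) (torus n)"
proof (rule bij_betw_imageI)
  define m where "m = int ((n - 1) div 2)"
  have m: "int (n div 2) = int n - 1 - m" using assms unfolding m_def by linarith
  show "inj_on (\<lambda>v. residue n (a + v)) (centred_box n)"
  proof (rule inj_onI)
    fix v w assume v: "v \<in> centred_box n" and w: "w \<in> centred_box n"
      and eq: "residue n (a + v) = residue n (a + w)"
    show "v = w"
    proof (rule vec_eq_iff[THEN iffD2], rule allI)
      fix i
      have "[(a + v) $ i = (a + w) $ i] (mod int n)" using eq unfolding residue_eq_iff by blast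
      then have dvd: "int n dvd v $ i - w $ i" by (simp add: cong_iff_dvd_diff)
      have "\<bar>v $ i - w $ i\<bar> < int n"
      proof -
        have "- m \<le> v $ i" "v $ i \<le> int n - 1 - m" "- m \<le> w $ i" "w $ i \<le> int n - 1 - m"
          using v w unfolding centred_box_def m m_def[symmetric] by blast+
        then show ?thesis by linarith
      qed
      then have "v $ i - w $ i = 0" using dvd zdvd_imp_le[of "int n" "\<bar>v $ i - w $ i\<bar>"] by fastforce
      then show "v $ i = w $ i" by simp
    qed
  qed
  show "(\<lambda>v. residue n (a + v)) ` centred_box n = torus n"
  proof (intro equalityI subsetI)
    fix y :: "(int ^ 'd) set" assume "y \<in> torus n"
    then obtain b where b: "y = residue n b" by (rule torusE)
    (* The shift by m moves the remainders from {0..n-1} into the box. *)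
    define v where "v = (\<chi> i. (b $ i - a $ i + m) mod int n - m)"
    have "v \<in> centred_box n"
    proof -
      have "0 \<le> (b $ i - a $ i + m) mod int n" "1 + (b $ i - a $ i + m) mod int n \<le> int n" for i
      proof -
        have "0 < int n" using assms by simp
        from pos_mod_sign[OF this] pos_mod_bound[OF this]
        show "0 \<le> (b $ i - a $ i + m) mod int n" "1 + (b $ i - a $ i + m) mod int n \<le> int n"
          by (simp, metis add1_zle_eq add.commute)
      qed
      then show ?thesis unfolding centred_box_def v_def m m_def[symmetric]
        by (auto simp: algebra_simps)
    qed
    moreover have "residue n (a + v) = y"
      unfolding b residue_eq_iff v_def
    proof
      fix i
      have "[(b $ i - a $ i + m) mod int n = b $ i - a $ i + m] (mod int n)" by simp
      then have "[a $ i - m + (b $ i - a $ i + m) mod int n = a $ i - m + (b $ i - a $ i + m)] (mod int n)"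
        by (rule cong_add[OF cong_refl])
      then show "[(a + (\<chi> i. (b $ i - a $ i + m) mod int n - m)) $ i = b $ i] (mod int n)"
        by (simp add: algebra_simps)
    qed
    ultimately show "y \<in> (\<lambda>v. residue n (a + v)) ` centred_box n" by blast
  qed (auto simp: residue_in_torus)
qed

lemma card_vectors:
  assumes "finite S"
  shows "finite {v :: int ^ 'd. \<forall>i. v $ i \<in> S}" "card {v :: int ^ 'd. \<forall>i. v $ i \<in> S} = card S ^ CARD('d)"
proof -
  have "bij_betw vec_lambda (PiE (UNIV :: 'd set) (\<lambda>_. S)) {v :: int ^ 'd. \<forall>i. v $ i \<in> S}"
    by (rule bij_betwI[of _ _ _ vec_nth]) auto
  then have "card (PiE (UNIV :: 'd set) (\<lambda>_. S)) = card {v :: int ^ 'd. \<forall>i. v $ i \<in> S}"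
    "finite (PiE (UNIV :: 'd set) (\<lambda>_. S)) = finite {v :: int ^ 'd. \<forall>i. v $ i \<in> S}"
    by (rule bij_betw_same_card, rule bij_betw_finite)
  then show "finite {v :: int ^ 'd. \<forall>i. v $ i \<in> S}"
    "card {v :: int ^ 'd. \<forall>i. v $ i \<in> S} = card S ^ CARD('d)"
    using assms by (simp_all add: finite_PiE card_PiE)
qed

lemma finite_centred_box: "finite (centred_box n :: (int ^ 'd) set)"
  and card_centred_box: "n \<ge> 1 \<Longrightarrow> card (centred_box n :: (int ^ 'd) set) = n ^ CARD('d)"
proof -
  let ?S = "{- int ((n - 1) div 2)..int (n div 2)}"
  have eq: "centred_box n = {v :: int ^ 'd. \<forall>i. v $ i \<in> ?S}" by (auto simp: centred_box_def)
  show "finite (centred_box n :: (int ^ 'd) set)" unfolding eq by (rule card_vectors) simp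
  assume "n \<ge> 1"
  then have "card ?S = n" by (simp add: zdiv_int)
  then show "card (centred_box n :: (int ^ 'd) set) = n ^ CARD('d)"
    unfolding eq by (subst card_vectors) auto
qed

lemma vnorm_centred_box_le:
  assumes "v \<in> centred_box n"
  shows "vnorm v \<le> torus_diam n"
proof -
  have "(n - 1) div 2 \<le> n div 2" by (rule div_le_mono) simp
  then show ?thesis using assms unfolding vnorm_le_iff centred_box_def torus_diam_def
    by (auto simp: abs_le_iff) (smt (verit) of_nat_mono)
qed

lemma card_centred_box_ball:
  assumes "k < torus_diam n"
  shows "card {v \<in> centred_box n :: (int ^ 'd) set. vnorm v \<le> k} = (2 * k + 1) ^ CARD('d)"
proof -
  have "int k \<le> int ((n - 1) div 2)" "int k \<le> int (n div 2)"
    using assms unfolding torus_diam_def by linarith+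
  then have "{v \<in> centred_box n :: (int ^ 'd) set. vnorm v \<le> k} = {v. \<forall>i. v $ i \<in> {- int k..int k}}"
  proof -
    have "(- A \<le> t \<and> t \<le> B) \<and> \<bar>t\<bar> \<le> int k \<longleftrightarrow> t \<in> {- int k..int k}"
      if "int k \<le> A" "int k \<le> B" for A B t :: int
      using that by auto
    note this[OF \<open>int k \<le> int ((n - 1) div 2)\<close> \<open>int k \<le> int (n div 2)\<close>]
    then show ?thesis unfolding vnorm_le_iff centred_box_def
      by (simp only: mem_Collect_eq all_conj_distrib[symmetric])
  qed
  moreover have "card {v :: int ^ 'd. \<forall>i. v $ i \<in> {- int k..int k}} = card {- int k..int k} ^ CARD('d)"
    by (rule card_vectors) simp
  moreover have "card {- int k..int k} = 2 * k + 1" by simp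
  ultimately show ?thesis by simp
qed

text \<open>The weights are the numbers of vertices on the spheres around \<open>x\<close>; they are the same as in the
  equation for \<open>\<zeta>\<close>, so this identity reads that equation as a statement about the degree of \<open>x\<close>.\<close>

lemma torus_sum_dist:
  fixes x :: "(int ^ 'd) set" and f :: "real \<Rightarrow> real"
  assumes "x \<in> torus n" "n \<ge> 2"
  shows "(\<Sum>y\<in>torus n. f (torus_dist x y)) = f 0
    + (\<Sum>i = 1..torus_diam n - 1.
        ((2 * real i + 1) ^ CARD('d) - (2 * real i - 1) ^ CARD('d)) * f (real i))
    + (real n ^ CARD('d) - (2 * real (torus_diam n) - 1) ^ CARD('d)) * f (real (torus_diam n))"
proof -
  define m where "m = torus_diam n"
  have m: "1 \<le> m" using assms by (auto simp: m_def torus_diam_def)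
  let ?B = "centred_box n :: (int ^ 'd) set"
  let ?c = "\<lambda>k. card {v \<in> ?B. vnorm v \<le> k}" and ?s = "\<lambda>k. card {v \<in> ?B. vnorm v = k}"
  obtain a where a: "x = residue n a" using assms(1) by (rule torusE)
  have "(\<Sum>y\<in>torus n. f (torus_dist x y)) = (\<Sum>v\<in>?B. f (torus_dist x (residue n (a + v))))"
    using bij_betw_centred_box[of n a] assms by (intro sum.reindex_bij_betw[symmetric]) auto
  also have "\<dots> = (\<Sum>v\<in>?B. f (real (vnorm v)))"
    by (intro sum.cong refl) (simp add: a torus_dist_residue)
  also have "\<dots> = (\<Sum>k\<in>{0..m}. \<Sum>v\<in>{v \<in> ?B. vnorm v = k}. f (real (vnorm v)))"
    by (rule sum.group[symmetric]) (auto simp: finite_centred_box vnorm_centred_box_le m_def)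
  also have "\<dots> = (\<Sum>k\<in>{0..m}. real (?s k) * f (real k))" by simp
  also have "{0..m} = insert 0 (insert m {1..m - 1})" using m by auto
  also have "(\<Sum>k\<in>\<dots>. real (?s k) * f (real k))
      = real (?s 0) * f 0 + (real (?s m) * f (real m) + (\<Sum>k = 1..m - 1. real (?s k) * f (real k)))"
    using m by (subst sum.insert, simp, simp, subst sum.insert) auto
  also have "?s 0 = ?c 0" by (intro arg_cong[where f = card]) auto
  also have "?c 0 = 1" using card_centred_box_ball[where 'd = 'd, of 0 n] m by (simp add: m_def)
  finally have main: "(\<Sum>y\<in>torus n. f (torus_dist x y)) =
      f 0 + (\<Sum>k = 1..m - 1. real (?s k) * f (real k)) + real (?s m) * f (real m)" by simp
  have shell: "real (?s k) = real (?c k) - real (?c (k - 1))" if "1 \<le> k" for k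
  proof -
    have "{v \<in> ?B. vnorm v \<le> k} = {v \<in> ?B. vnorm v \<le> k - 1} \<union> {v \<in> ?B. vnorm v = k}"
      using that by auto
    moreover have "{v \<in> ?B. vnorm v \<le> k - 1} \<inter> {v \<in> ?B. vnorm v = k} = {}"
      using that by auto
    ultimately have "?c k = ?c (k - 1) + ?s k"
      using card_Un_disjoint[of "{v \<in> ?B. vnorm v \<le> k - 1}" "{v \<in> ?B. vnorm v = k}"]
      by (simp only:) (simp add: finite_centred_box)
    then show ?thesis by simp
  qed
  have c: "real (?c k) = (2 * real k + 1) ^ CARD('d)" if "k < m" for k
    using card_centred_box_ball[where 'd = 'd, of k n] that by (simp add: m_def add.commute)
  have "{v \<in> ?B. vnorm v \<le> m} = ?B" using vnorm_centred_box_le by (auto simp: m_def)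
  then have cm: "real (?c m) = real n ^ CARD('d)" using assms(2) by (simp only: card_centred_box) simp
  have "real (?s k) = (2 * real k + 1) ^ CARD('d) - (2 * real k - 1) ^ CARD('d)"
    if "k \<in> {1..m - 1}" for k
    using that m c[of k] c[of "k - 1"] shell[of k] by (auto simp: of_nat_diff algebra_simps)
  moreover have "real (?s m) = real n ^ CARD('d) - (2 * real m - 1) ^ CARD('d)"
    using m c[of "m - 1"] shell[of m] cm by (auto simp: of_nat_diff algebra_simps)
  ultimately show ?thesis unfolding main m_def[symmetric] by simp
qed

lemma card_torus:
  assumes "n \<ge> 1"
  shows "card (torus n :: (int ^ 'd) set set) = n ^ CARD('d)"
  using bij_betw_same_card[OF bij_betw_centred_box[OF assms, of 0]] card_centred_box[OF assms]
  by metis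

lemma torus_dist_cases:
  fixes x y :: "(int ^ 'd) set"
  assumes "x \<in> torus n" "y \<in> torus n" "n \<ge> 1"
  obtains a v where "x = residue n a" "y = residue n (a + v)" "v \<in> centred_box n"
    "torus_dist x y = real (vnorm v)"
proof -
  obtain a where a: "x = residue n a" using assms(1) by (rule torusE)
  have "y \<in> (\<lambda>v. residue n (a + v)) ` centred_box n"
    using bij_betw_centred_box[OF assms(3), of a] assms(2) by (simp add: bij_betw_def)
  then obtain v where v: "v \<in> centred_box n" "y = residue n (a + v)" by blast
  show thesis using that[OF a v(2,1)] torus_dist_residue[OF v(1)] a v by simp
qed

lemma torus_dist_le_diam:
  assumes "x \<in> torus n" "y \<in> torus n" "n \<ge> 1"
  shows "torus_dist x y \<le> real (torus_diam n)"
  using torus_dist_cases[OF assms] vnorm_centred_box_le by (metis of_nat_mono)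

lemma torus_dist_ge_1:
  assumes "x \<in> torus n" "y \<in> torus n" "n \<ge> 1" "x \<noteq> y"
  shows "1 \<le> torus_dist x y"
proof -
  obtain a v where v: "x = residue n a" "y = residue n (a + v)" "v \<in> centred_box n"
    "torus_dist x y = real (vnorm v)" using torus_dist_cases[OF assms(1-3)] .
  have "vnorm v \<noteq> 0"
  proof
    assume "vnorm v = 0"
    then have "v = 0" using vnorm_le_iff[of v 0] by (simp add: vec_eq_iff)
    then show False using v assms by simp
  qed
  then show ?thesis using v by simp
qed

lemma torus_dist_self:
  assumes "x \<in> torus n" "n \<ge> 1"
  shows "torus_dist x x = 0"
proof -
  obtain a where a: "x = residue n a" using assms(1) by (rule torusE)
  have "(0 :: int ^ 'a) \<in> centred_box n" by (simp add: centred_box_def)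
  moreover have "vnorm (0 :: int ^ 'a) = 0" using vnorm_le_iff[of "0 :: int ^ 'a" 0] by simp
  ultimately show ?thesis using torus_dist_residue[of 0 n a] a by simp
qed

lemma torus_dist_triangle:
  assumes "x \<in> torus n" "y \<in> torus n" "z \<in> torus n" "n \<ge> 1"
  shows "torus_dist x z \<le> torus_dist x y + torus_dist y z"
proof -
  obtain a v where v: "x = residue n a" "y = residue n (a + v)" "torus_dist x y = real (vnorm v)"
    using torus_dist_cases[OF assms(1,2,4)] .
  obtain b w where w: "y = residue n b" "z = residue n (b + w)" "torus_dist y z = real (vnorm w)"
    using torus_dist_cases[OF assms(2,3,4)] .
  have "a + v + w \<in> z"
    unfolding w mem_residue
  proof
    fix i
    have "[b $ i = (a + v) $ i] (mod int n)" using v w residue_eq_iff by metis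
    then show "[(b + w) $ i = (a + v + w) $ i] (mod int n)" by (simp add: cong_add)
  qed
  then have "torus_dist x z \<le> linf_dist a (a + (v + w))"
    unfolding v(1) by (intro torus_dist_le residue_refl) (simp only: add.assoc)
  also have "\<dots> \<le> real (vnorm v + vnorm w)"
    unfolding linf_dist_add using vnorm_triangle[of v w] by (simp only: of_nat_le_iff)
  finally show ?thesis using v w by simp
qed

section \<open>The torus as a power law space\<close>

lemma power_diff_le:
  fixes a b :: real
  assumes "0 \<le> b" "b \<le> a"
  shows "a ^ Suc k - b ^ Suc k \<le> real (Suc k) * (a - b) * a ^ k"
proof (induction k)
  case (Suc k)
  have "a ^ Suc (Suc k) - b ^ Suc (Suc k) = a * (a ^ Suc k - b ^ Suc k) + (a - b) * b ^ Suc k"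
    by (simp add: algebra_simps)
  also have "\<dots> \<le> a * (real (Suc k) * (a - b) * a ^ k) + (a - b) * a ^ Suc k"
    using assms Suc.IH by (intro add_mono mult_left_mono power_mono) auto
  also have "\<dots> = real (Suc (Suc k)) * (a - b) * a ^ Suc k" by (simp add: algebra_simps)
  finally show ?case .
qed simp

lemma shell_size_le:
  assumes "1 \<le> i" "1 \<le> d"
  shows "(2 * real i + 1) ^ d - (2 * real i - 1) ^ d \<le> 2 * real d * 3 ^ (d - 1) * real i powr (real d - 1)"
proof -
  obtain k where k: "d = Suc k" using assms by (cases d) auto
  have "(2 * real i + 1) ^ d - (2 * real i - 1) ^ d \<le> real d * 2 * (2 * real i + 1) ^ k"
    unfolding k using assms by (intro order_trans[OF power_diff_le]) auto
  also have "\<dots> \<le> real d * 2 * (3 * real i) ^ k"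
    using assms by (intro mult_left_mono power_mono) auto
  also have "\<dots> = 2 * real d * 3 ^ (d - 1) * real i powr (real d - 1)"
    using assms by (simp add: k power_mult_distrib powr_realpow)
  finally show ?thesis .
qed

text \<open>For \<open>s < 1\<close> the summands decrease; concavity of \<open>t \<mapsto> t powr s\<close>, here as Young's inequality,
  bounds each of them by \<open>1/s\<close> times the increment of \<open>t powr s\<close>.\<close>

lemma sum_powr_le:
  fixes s :: real
  assumes "0 < s"
  shows "(\<Sum>i = 1..m. real i powr (s - 1)) \<le> max 1 (1 / s) * real m powr s"
proof (cases "1 \<le> s")
  case True
  have "(\<Sum>i = 1..m. real i powr (s - 1)) \<le> (\<Sum>i = 1..m. real m powr (s - 1))"
    using True by (intro sum_mono powr_mono2) auto
  also have "\<dots> = real m powr 1 * real m powr (s - 1)" by simp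
  also have "\<dots> = real m powr s" by (subst powr_add[symmetric]) simp
  also have "\<dots> \<le> max 1 (1 / s) * real m powr s"
    using mult_right_mono[of 1 "max 1 (1 / s)" "real m powr s"] by simp
  finally show ?thesis .
next
  case False
  have "(\<Sum>i = 1..m. real i powr (s - 1)) \<le> 1 / s * real m powr s"
  proof (induction m)
    case (Suc m)
    define a where "a = real (Suc m)"
    have a: "0 < a" "real m = a - 1" by (auto simp: a_def)
    have "(real m / a) powr s \<le> 1 - s / a"
    proof (cases "m = 0")
      case True
      then show ?thesis using False assms by (simp add: a_def)
    next
      case m: False
      have "(real m / a) powr s * 1 powr (1 - s) \<le> s * (real m / a) + (1 - s) * 1"
        using assms False m a by (intro Youngs_inequality_0) auto
      also have "\<dots> = 1 - s / a" using a(1) unfolding a(2) by (simp add: field_simps)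
      finally show ?thesis by simp
    qed
    then have "(real m / a) powr s * a powr s \<le> (1 - s / a) * a powr s"
      by (intro mult_right_mono) auto
    then have "real m powr s \<le> a powr s - s * (a powr s / a)"
      using a(1) by (simp add: powr_divide left_diff_distrib)
    also have "a powr s / a = a powr (s - 1)" using a by (simp add: powr_diff)
    finally have "1 / s * real m powr s \<le> 1 / s * (a powr s - s * a powr (s - 1))"
      using assms by (intro mult_left_mono) auto
    also have "\<dots> = 1 / s * a powr s - a powr (s - 1)" using assms by (simp add: right_diff_distrib)
    finally show ?case using Suc.IH by (simp add: a_def)
  qed simp
  also have "\<dots> \<le> max 1 (1 / s) * real m powr s" by (intro mult_right_mono) auto
  finally show ?thesis .
qed

text \<open>The inner maximum gives a finite value on the diagonal; the outer one guarantees the bound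
  \<open>1 \<le> closeness\<close> also for arguments that are not vertices of the torus.\<close>

definition closeness :: "nat \<Rightarrow> (int ^ 'd) set \<Rightarrow> (int ^ 'd) set \<Rightarrow> real" where
  "closeness n x y = max 1 (real n / max 1 (torus_dist x y))"

definition closeness_const :: "nat \<Rightarrow> real \<Rightarrow> real" where
  "closeness_const d t = 1 + 2 * real d * 3 ^ (d - 1) * max 1 (1 / (real d - t))"

lemma closeness_sum:
  fixes x :: "(int ^ 'd) set"
  assumes "0 \<le> t" "t < real CARD('d)" "x \<in> torus n" "n \<ge> 2"
  shows "(\<Sum>y\<in>torus n. closeness n x y powr t) \<le> closeness_const CARD('d) t * real n powr real CARD('d)"
proof -
  define d where "d = CARD('d)"
  define m where "m = torus_diam n"
  define c where "c = 2 * real d * 3 ^ (d - 1)"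
  have d: "1 \<le> d" "t < real d" using assms by (auto simp: d_def Suc_le_eq)
  have m: "1 \<le> m" "2 * m \<le> n" "n \<le> 2 * m + 1" using assms unfolding m_def torus_diam_def by linarith+
  have c: "0 \<le> c" by (simp add: c_def)
  define f where "f r = max 1 (real n / max 1 r) powr t" for r
  have f0: "f 0 = real n powr t" using assms by (simp add: f_def)
  have fi: "f (real i) = real n powr t * real i powr (- t)" if "1 \<le> i" "i \<le> m" for i
    using that m by (simp add: f_def powr_divide powr_minus_divide max_def)
  have shell: "w * f (real i) \<le> c * real n powr t * real i powr (real d - t - 1)"
    if "1 \<le> i" "i \<le> m" "w \<le> (2 * real i + 1) ^ d - (2 * real i - 1) ^ d" for i w
  proof -
    have "w * f (real i) \<le> (c * real i powr (real d - 1)) * (real n powr t * real i powr (- t))"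
      using shell_size_le[OF that(1) d(1)] that unfolding fi[OF that(1,2)] c_def
      by (intro mult_right_mono) auto
    also have "\<dots> = c * real n powr t * (real i powr (real d - 1) * real i powr (- t))"
      by simp
    also have "real i powr (real d - 1) * real i powr (- t) = real i powr (real d - t - 1)"
      by (subst powr_add[symmetric]) (simp add: algebra_simps)
    finally show ?thesis .
  qed
  have "(\<Sum>y\<in>torus n. closeness n x y powr t) = (\<Sum>y\<in>torus n. f (torus_dist x y))"
    by (simp add: closeness_def f_def)
  also have "\<dots> = f 0 + (\<Sum>i = 1..m - 1. ((2 * real i + 1) ^ d - (2 * real i - 1) ^ d) * f (real i))
    + (real n ^ d - (2 * real m - 1) ^ d) * f (real m)"
    unfolding d_def m_def by (rule torus_sum_dist) (use assms in auto)
  also have "\<dots> \<le> real n powr t + (\<Sum>i = 1..m - 1. c * real n powr t * real i powr (real d - t - 1))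
    + c * real n powr t * real m powr (real d - t - 1)"
    unfolding f0
  proof (intro add_mono sum_mono shell)
    have "real n \<le> 2 * real m + 1" using m by linarith
    then show "real n ^ d - (2 * real m - 1) ^ d \<le> (2 * real m + 1) ^ d - (2 * real m - 1) ^ d"
      by (intro diff_right_mono power_mono) auto
  qed (use m in auto)
  also have "\<dots> = real n powr t + c * real n powr t * (\<Sum>i = 1..m. real i powr (real d - t - 1))"
  proof -
    have "{1..m} = insert m {1..m - 1}" using m by auto
    then show ?thesis using m by (simp add: sum_distrib_left distrib_left)
  qed
  also have "\<dots> \<le> real n powr t + c * real n powr t * (max 1 (1 / (real d - t)) * real m powr (real d - t))"
    using c d by (intro add_left_mono mult_left_mono sum_powr_le) auto
  also have "\<dots> \<le> real n powr d + c * real n powr t * (max 1 (1 / (real d - t)) * real n powr (real d - t))"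
    using c d m assms by (intro add_mono mult_left_mono powr_mono2 powr_mono) auto
  also have "\<dots> = real n powr d + c * max 1 (1 / (real d - t)) * (real n powr t * real n powr (real d - t))"
    by simp
  also have "real n powr t * real n powr (real d - t) = real n powr d"
    by (simp add: powr_add[symmetric])
  finally show ?thesis by (simp add: closeness_const_def c_def d_def algebra_simps)
qed

lemma power_law_space_torus:
  assumes "n \<ge> 2"
  shows "power_law_space (torus n :: (int ^ 'd) set set) (closeness n) (real n) (real CARD('d))
    (closeness_const CARD('d))"
proof
  show "finite (torus n :: (int ^ 'd) set set)" using assms by (intro finite_torus) auto
  show "1 \<le> real n" using assms by simp
  show "real (card (torus n :: (int ^ 'd) set set)) = real n powr real CARD('d)"
    using assms by (simp add: card_torus powr_realpow)
  fix x y z :: "(int ^ 'd) set" and t :: real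
  show "1 \<le> closeness n x y" by (simp add: closeness_def)
  have "real n / max 1 (torus_dist x y) \<le> real n / 1" by (intro divide_left_mono) auto
  then show "closeness n x y \<le> real n" using assms by (simp add: closeness_def)
  show "closeness n x y = closeness n y x" by (simp add: closeness_def torus_dist_commute)
  show "(\<Sum>y\<in>torus n. closeness n x y powr t) \<le> closeness_const CARD('d) t * real n powr real CARD('d)"
    if "0 \<le> t" "t < real CARD('d)" "x \<in> torus n"
    using closeness_sum[OF that assms] .
  assume xyz: "x \<in> torus n" "y \<in> torus n" "z \<in> torus n"
  let ?r = "\<lambda>x y. max 1 (torus_dist x y)"
  have "torus_dist x y \<le> torus_dist x z + torus_dist z y"
    by (rule torus_dist_triangle[OF xyz(1,3,2)]) (use assms in auto)
  then have "?r x y \<le> 2 * ?r x z \<or> ?r x y \<le> 2 * ?r z y" by linarith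
  moreover have "real n / b \<le> 2 * (real n / a)" if "a \<le> 2 * b" "0 < a" "0 < b" for a b :: real
    using mult_left_mono[OF that(1), of "real n"] that by (simp add: field_simps)
  moreover have "0 < ?r x y" "0 < ?r x z" "0 < ?r z y" by linarith+
  ultimately have "real n / ?r x z \<le> 2 * (real n / ?r x y) \<or> real n / ?r z y \<le> 2 * (real n / ?r x y)"
    by blast
  then show "min (closeness n x z) (closeness n z y) \<le> 2 * closeness n x y"
    unfolding closeness_def by linarith
qed

section \<open>The random graph on the torus\<close>

text \<open>Condition on the state of the edge \<open>e\<close> and use that the remaining coordinates keep their law.\<close>

lemma prob_Pi_pmf_edge:
  fixes q :: "'e \<Rightarrow> real"
  assumes "finite A" "e \<in> A" "0 \<le> q e" "q e \<le> 1" and F: "\<And>g b. F (g(e := b)) = F g"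
  shows "measure_pmf.prob (Pi_pmf A False (\<lambda>e. bernoulli_pmf (q e))) {g. g e \<and> F g}
    = q e * measure_pmf.prob (Pi_pmf A False (\<lambda>e. bernoulli_pmf (q e))) {g. F g}"
proof -
  let ?Q = "Pi_pmf (A - {e}) False (\<lambda>e. bernoulli_pmf (q e))"
  have A: "insert e (A - {e}) = A" using assms by auto
  have eq: "Pi_pmf A False (\<lambda>e. bernoulli_pmf (q e))
      = bind_pmf (bernoulli_pmf (q e)) (\<lambda>b. map_pmf (\<lambda>g. g(e := b)) ?Q)"
    using Pi_pmf_insert'[of "A - {e}" e False "\<lambda>e. bernoulli_pmf (q e)"] assms(1)
    unfolding A map_pmf_def by simp
  have prob: "measure_pmf.prob (Pi_pmf A False (\<lambda>e. bernoulli_pmf (q e))) X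
      = q e * measure_pmf.prob ?Q {g. g(e := True) \<in> X}
        + (1 - q e) * measure_pmf.prob ?Q {g. g(e := False) \<in> X}" for X
  proof -
    have mp: "measure_pmf.prob N Y = pmf (map_pmf (\<lambda>g. g \<in> Y) N) True" for N :: "('e \<Rightarrow> bool) pmf" and Y
      by (simp add: pmf_map vimage_def)
    have "measure_pmf.prob (Pi_pmf A False (\<lambda>e. bernoulli_pmf (q e))) X
        = pmf (map_pmf (\<lambda>g. g \<in> X) (Pi_pmf A False (\<lambda>e. bernoulli_pmf (q e)))) True"
      by (rule mp)
    then show ?thesis
      unfolding eq using assms(3,4)
      by (simp add: map_bind_pmf pmf_bind integral_bernoulli_pmf map_pmf_comp pmf_map vimage_def)
  qed
  show ?thesis unfolding prob by (simp add: F algebra_simps)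
qed

text \<open>Almost surely all edges lie between vertices of the torus.\<close>

lemma conn_prob_eq_joined:
  fixes x y :: "(int ^ 'd) set"
  assumes "n > 0"
  shows "conn_prob \<theta> \<rho> n x y = measure_pmf.prob (random_graph \<theta> \<rho> n) {g. joined (torus n) g x y}"
  unfolding conn_prob_def
proof (rule measure_pmf.finite_measure_eq_AE)
  show "AE g in random_graph \<theta> \<rho> n. g \<in> {G. connected_in G x y} \<longleftrightarrow> g \<in> {g. joined (torus n) g x y}"
    unfolding AE_measure_pmf_iff
  proof
    fix g :: "(int ^ 'd) set set \<Rightarrow> bool" assume "g \<in> set_pmf (random_graph \<theta> \<rho> n)"
    then have "\<forall>e. e \<notin> torus_pairs n \<longrightarrow> \<not> g e"
      using set_Pi_pmf_subset[OF finite_torus_pairs[OF assms],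
          of False "\<lambda>e. bernoulli_pmf (edge_prob \<theta> \<rho> n e)"]
      unfolding random_graph_def by auto
    have "u \<in> torus n \<and> v \<in> torus n" if "g {u, v}" for u v
    proof -
      have "{u, v} \<in> torus_pairs n"
        using that \<open>\<forall>e. e \<notin> torus_pairs n \<longrightarrow> \<not> g e\<close> by blast
      then have "\<exists>a b. {u, v} = {a, b} \<and> a \<in> torus n \<and> b \<in> torus n \<and> a \<noteq> b"
        unfolding torus_pairs_def by (rule CollectD)
      then show ?thesis by (auto simp: doubleton_eq_iff)
    qed
    then have "(\<lambda>u v. u \<noteq> v \<and> g {u, v}) = (\<lambda>u v. u \<in> torus n \<and> v \<in> torus n \<and> u \<noteq> v \<and> g {u, v})"
      by blast
    then show "g \<in> {G. connected_in G x y} \<longleftrightarrow> g \<in> {g. joined (torus n) g x y}"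
      unfolding connected_in_def joined_def by simp
  qed
qed auto

text \<open>\<open>d\<close> and \<open>W\<close> are parameters fixed by equations, because their values depend on the dimension,
  which only the type of the vertices records.\<close>

locale long_range_torus =
  fixes V :: "(int ^ 'd :: finite) set set" and \<alpha> \<theta> A1 A2 :: real and \<rho> :: "real \<Rightarrow> real" and n :: nat
    and d W :: real
  assumes V_def: "V = torus n"
    and d_def: "d = real CARD('d)"
    and W_def: "W = inverse (zeta CARD('d) \<rho> n)"
    and A: "0 < A1" "A1 \<le> A2"
    and \<alpha>: "0 < \<alpha>" "\<alpha> < d"
    and adm: "admissible_rho A1 A2 \<alpha> \<rho>"
    and n: "3 \<le> n"
begin

sublocale power_law_space V "closeness n" "real n" d "closeness_const CARD('d)"
  unfolding V_def d_def by (rule power_law_space_torus) (use n in simp)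

definition p :: "(int ^ 'd) set \<Rightarrow> (int ^ 'd) set \<Rightarrow> real" where
  "p x y = 1 - exp (- kappa_minus \<theta> \<rho> n x y)"

lemma W_pos: "0 < W" and zeta_eq: "zeta_eq CARD('d) \<rho> n (inverse W)"
proof -
  have "CARD('d) \<ge> 1" by (simp add: Suc_le_eq)
  from theI'[OF zeta_unique[OF A(1) adm this n]]
  show "0 < W" "zeta_eq CARD('d) \<rho> n (inverse W)" unfolding W_def zeta_def by auto
qed

lemma card_pow: "real n ^ CARD('d) = real n powr d"
  using n by (simp add: powr_realpow d_def)

lemma card_ge_3: "3 \<le> real n powr d"
proof -
  have "1 \<le> d" by (simp add: d_def Suc_le_eq)
  then have "real n powr 1 \<le> real n powr d" using n by (intro powr_mono) auto
  then show ?thesis using n by simp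
qed

lemma zero_in_V: "torus_zero n \<in> V"
  by (simp add: V_def torus_zero_def residue_in_torus)

lemma rho_0: "\<rho> 0 = 0" and rho_nonneg: "0 \<le> r \<Longrightarrow> 0 \<le> \<rho> r"
  and rho_lower: "1 \<le> r \<Longrightarrow> A1 * r powr - \<alpha> \<le> \<rho> r"
  and rho_upper: "1 \<le> r \<Longrightarrow> \<rho> r \<le> A2 * r powr - \<alpha>"
  using adm unfolding admissible_rho_def by auto

lemma dist_self: "x \<in> V \<Longrightarrow> torus_dist x x = 0"
  unfolding V_def by (rule torus_dist_self) (use n in auto)

lemma dist_ge_1: "x \<in> V \<Longrightarrow> y \<in> V \<Longrightarrow> x \<noteq> y \<Longrightarrow> 1 \<le> torus_dist x y"
  unfolding V_def by (rule torus_dist_ge_1) (use n in auto)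

lemma dist_le_n: "x \<in> V \<Longrightarrow> y \<in> V \<Longrightarrow> torus_dist x y \<le> real n"
  unfolding V_def using torus_dist_le_diam[of x n y] n unfolding torus_diam_def by force

lemma dist_powr:
  assumes "x \<in> V" "y \<in> V" "x \<noteq> y"
  shows "torus_dist x y powr - \<alpha> = real n powr - \<alpha> * closeness n x y powr \<alpha>"
proof -
  have D: "1 \<le> torus_dist x y" "torus_dist x y \<le> real n"
    using dist_ge_1 dist_le_n assms by auto
  then have "closeness n x y = real n / torus_dist x y"
    by (simp add: closeness_def max_def)
  then show ?thesis using D n by (simp add: powr_divide powr_minus_divide)
qed

lemma dist_powr_profile:
  assumes "x \<in> V" "y \<in> V" "x \<noteq> y"
  shows "real n powr (\<alpha> - d) * torus_dist x y powr - \<alpha> = profile \<alpha> x y"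
  unfolding dist_powr[OF assms] profile_def
  using n by (simp add: powr_diff powr_minus_divide)

lemma rho_ge_far:
  assumes "x \<in> V" "y \<in> V" "x \<noteq> y"
  shows "A1 * real n powr - \<alpha> \<le> \<rho> (torus_dist x y)"
proof -
  have D: "1 \<le> torus_dist x y" "torus_dist x y \<le> real n" using dist_ge_1 dist_le_n assms by auto
  have "real n powr - \<alpha> \<le> torus_dist x y powr - \<alpha>"
    using D \<alpha> by (intro powr_mono2') auto
  then have "A1 * real n powr - \<alpha> \<le> A1 * torus_dist x y powr - \<alpha>" using A by (intro mult_left_mono) auto
  then show ?thesis using rho_lower[OF D(1)] by linarith
qed

lemma sum_exp_rho:
  assumes "x \<in> V"
  shows "(\<Sum>y\<in>V. exp (- W * \<rho> (torus_dist x y))) = real n powr d - 1"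
proof -
  have "(\<Sum>y\<in>V. exp (- W * \<rho> (torus_dist x y))) = exp (- W * \<rho> 0)
    + (\<Sum>i = 1..torus_diam n - 1.
        ((2 * real i + 1) ^ CARD('d) - (2 * real i - 1) ^ CARD('d)) * exp (- W * \<rho> (real i)))
    + (real n ^ CARD('d) - (2 * real (torus_diam n) - 1) ^ CARD('d)) * exp (- W * \<rho> (real (torus_diam n)))"
    unfolding V_def
    by (rule torus_sum_dist[where f = "\<lambda>r. exp (- W * \<rho> r)"]) (use assms n in \<open>auto simp: V_def\<close>)
  then show ?thesis using zeta_eq unfolding zeta_eq_def by (simp add: rho_0 card_pow)
qed

lemma sum_exp_rho_off:
  assumes "x \<in> V"
  shows "(\<Sum>y\<in>V - {x}. exp (- W * \<rho> (torus_dist x y))) = real n powr d - 2"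
  using sum_exp_rho[OF assms] fin assms by (simp add: sum_diff1 dist_self rho_0)

lemma card_off: "x \<in> V \<Longrightarrow> real (card (V - {x})) = real n powr d - 1"
  using fin card_V card_ge_3 by (subst card_Diff_singleton) (auto simp: of_nat_diff)

text \<open>All distances are at most \<open>n\<close>, so each of the \<open>n\<^sup>d - 1\<close> summands is at most \<open>exp (- u)\<close> with
  \<open>u = W A1 n\<^sup>-\<^sup>\<alpha>\<close>; their sum \<open>n\<^sup>d - 2\<close> then forces \<open>u\<close> to be at most \<open>3 / n\<^sup>d\<close>.\<close>

lemma W_upper: "W \<le> 3 / A1 * real n powr (\<alpha> - d)"
proof -
  define u where "u = W * (A1 * real n powr - \<alpha>)"
  have "real n powr d - 2 = (\<Sum>y\<in>V - {torus_zero n}. exp (- W * \<rho> (torus_dist (torus_zero n) y)))"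
    using sum_exp_rho_off[OF zero_in_V] by simp
  also have "\<dots> \<le> (\<Sum>y\<in>V - {torus_zero n}. exp (- u))"
    unfolding u_def using W_pos zero_in_V by (intro sum_mono) (auto intro!: rho_ge_far)
  also have "\<dots> = (real n powr d - 1) * exp (- u)" using card_off[OF zero_in_V] by simp
  finally have "real n powr d - 2 \<le> (real n powr d - 1) * exp (- u)" .
  from mult_right_mono[OF this, of "exp u"]
  have "(real n powr d - 2) * exp u \<le> (real n powr d - 1) * (exp (- u) * exp u)"
    by (simp only: mult.assoc exp_ge_zero)
  then have "(real n powr d - 2) * exp u \<le> real n powr d - 1" by (simp flip: exp_add)
  moreover have "(real n powr d - 2) * (1 + u) \<le> (real n powr d - 2) * exp u"
    using card_ge_3 exp_ge_add_one_self[of u] by (intro mult_left_mono) auto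
  ultimately have "(real n powr d - 2) * u \<le> 1" by (simp add: algebra_simps)
  moreover have "real n powr d / 3 * u \<le> (real n powr d - 2) * u"
    using card_ge_3 A W_pos by (intro mult_right_mono) (auto simp: u_def)
  ultimately have "real n powr d * (W * (A1 * real n powr - \<alpha>)) \<le> 3" unfolding u_def by linarith
  then have "W * (A1 * (real n powr d * real n powr - \<alpha>)) \<le> 3" by (simp add: mult_ac)
  then show ?thesis using A n by (simp add: powr_diff powr_minus_divide field_simps)
qed

lemma rho_le_closeness:
  assumes "x \<in> V" "y \<in> V"
  shows "\<rho> (torus_dist x y) \<le> A2 * (real n powr - \<alpha> * closeness n x y powr \<alpha>)"
proof (cases "x = y")
  case True
  then show ?thesis using assms A by (simp add: dist_self rho_0)
next
  case False
  then show ?thesis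
    using rho_upper[OF dist_ge_1[OF assms False]] dist_powr[OF assms False] by simp
qed

text \<open>The mean degree \<open>1\<close> is at most \<open>W\<close> times the sum of \<open>\<rho>\<close> over the torus, which is of order
  \<open>n\<^sup>d\<^sup>-\<^sup>\<alpha>\<close>.\<close>

lemma W_lower: "real n powr (\<alpha> - d) \<le> A2 * closeness_const CARD('d) \<alpha> * W"
proof -
  let ?o = "torus_zero n"
  have "1 = (\<Sum>y\<in>V. 1 - exp (- W * \<rho> (torus_dist ?o y)))"
    using sum_exp_rho[OF zero_in_V] by (simp add: sum_subtractf card_V)
  also have "\<dots> \<le> (\<Sum>y\<in>V. W * (A2 * (real n powr - \<alpha> * closeness n ?o y powr \<alpha>)))"
  proof (rule sum_mono)
    fix y assume "y \<in> V"
    have "1 - exp (- W * \<rho> (torus_dist ?o y)) \<le> W * \<rho> (torus_dist ?o y)"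
      using exp_ge_add_one_self[of "- W * \<rho> (torus_dist ?o y)"] by simp
    also have "\<dots> \<le> W * (A2 * (real n powr - \<alpha> * closeness n ?o y powr \<alpha>))"
      using W_pos zero_in_V \<open>y \<in> V\<close> by (intro mult_left_mono rho_le_closeness) auto
    finally show "1 - exp (- W * \<rho> (torus_dist ?o y)) \<le> W * (A2 * (real n powr - \<alpha> * closeness n ?o y powr \<alpha>))" .
  qed
  also have "\<dots> = W * A2 * real n powr - \<alpha> * (\<Sum>y\<in>V. closeness n ?o y powr \<alpha>)"
    by (simp add: sum_distrib_left mult_ac)
  also have "\<dots> \<le> W * A2 * real n powr - \<alpha> * (closeness_const CARD('d) \<alpha> * real n powr d)"
    using W_pos A \<alpha> zero_in_V by (intro mult_left_mono h_sum) auto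
  finally have "real n powr (\<alpha> - d) * 1 \<le> real n powr (\<alpha> - d) * (W * A2 * real n powr - \<alpha> * (closeness_const CARD('d) \<alpha> * real n powr d))"
    by (intro mult_left_mono) auto
  also have "\<dots> = A2 * closeness_const CARD('d) \<alpha> * W * (real n powr (\<alpha> - d) * real n powr - \<alpha> * real n powr d)"
    by (simp add: mult_ac)
  also have "real n powr (\<alpha> - d) * real n powr - \<alpha> * real n powr d = 1"
    using n by (simp add: powr_add[symmetric])
  finally show ?thesis by simp
qed

lemma kappa_minus_eq:
  fixes x y :: "(int ^ 'd) set"
  shows "kappa_minus \<theta> \<rho> n x y = W * max (\<rho> (torus_dist x y) - real n powr - \<theta>) 0"
  by (simp add: kappa_minus_def rho_minus_def W_def)

lemma kappa_minus_nonneg: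
  fixes x y :: "(int ^ 'd) set"
  shows "0 \<le> kappa_minus \<theta> \<rho> n x y"
  unfolding kappa_minus_eq using W_pos by (intro mult_nonneg_nonneg) auto

sublocale bernoulli_graph V p "random_graph \<theta> \<rho> n"
proof
  show "finite V" by (rule fin)
  fix x y :: "(int ^ 'd) set"
  show "0 \<le> p x y" using kappa_minus_nonneg by (simp add: p_def)
  show "p x y = p y x" by (simp add: p_def kappa_minus_def torus_dist_commute)
  show "p x x = 0" if "x \<in> V" using that by (simp add: p_def kappa_minus_eq dist_self rho_0 max_def)
  fix F :: "((int ^ 'd) set set \<Rightarrow> bool) \<Rightarrow> bool"
  assume "x \<in> V" "y \<in> V" "x \<noteq> y" and F: "\<And>g b. F (g({x, y} := b)) = F g"
  then have e: "{x, y} \<in> torus_pairs n" unfolding torus_pairs_def V_def by blast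
  have q: "edge_prob \<theta> \<rho> n {x, y} = p x y" by (simp add: edge_prob_pair p_def)
  show "measure_pmf.prob (random_graph \<theta> \<rho> n) {g. g {x, y} \<and> F g}
      = p x y * measure_pmf.prob (random_graph \<theta> \<rho> n) {g. F g}"
    unfolding random_graph_def
    using prob_Pi_pmf_edge[of "torus_pairs n" "{x, y}" "edge_prob \<theta> \<rho> n" F]
      finite_torus_pairs[of n] n e F kappa_minus_nonneg[of x y] unfolding q p_def by simp
qed

lemma p_le_W:
  assumes "x \<in> V" "y \<in> V"
  shows "p x y \<le> W * \<rho> (torus_dist x y)"
proof -
  have D: "0 \<le> torus_dist x y" using dist_ge_1[OF assms] dist_self assms by (cases "x = y") auto
  have "p x y \<le> kappa_minus \<theta> \<rho> n x y"
    unfolding p_def using exp_ge_add_one_self[of "- kappa_minus \<theta> \<rho> n x y"] by simp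
  also have "\<dots> \<le> W * \<rho> (torus_dist x y)"
    unfolding kappa_minus_eq using W_pos rho_nonneg[OF D] by (intro mult_left_mono) auto
  finally show ?thesis .
qed

lemma p_le_profile:
  assumes "x \<in> V" "y \<in> V"
  shows "p x y \<le> 3 * A2 / A1 * profile \<alpha> x y"
proof -
  have "p x y \<le> W * \<rho> (torus_dist x y)" by (rule p_le_W[OF assms])
  also have "\<dots> \<le> (3 / A1 * real n powr (\<alpha> - d)) * (A2 * (real n powr - \<alpha> * closeness n x y powr \<alpha>))"
    using W_pos A dist_ge_1[OF assms] dist_self assms
    by (intro mult_mono W_upper rho_le_closeness rho_nonneg) (cases "x = y"; force)+
  also have "\<dots> = 3 * A2 / A1 * profile \<alpha> x y"
    using n by (simp add: profile_def powr_diff powr_minus_divide)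
  finally show ?thesis .
qed

text \<open>The distance \<open>\<epsilon>\<close> from criticality. Lowering \<open>\<rho>\<close> by \<open>n\<^sup>-\<^sup>\<theta>\<close> multiplies every
  \<open>exp (- W \<rho>)\<close> by \<open>exp (W n\<^sup>-\<^sup>\<theta>)\<close>, and the sum of these terms is \<open>n\<^sup>d - 2\<close>; so the gap has a closed
  form.\<close>

definition gap :: real where
  "gap = (real n powr d - 2) * (exp (W * real n powr - \<theta>) - 1)"

lemma p_mass:
  assumes "real n powr - \<theta> \<le> A1 / 2 * real n powr - \<alpha>" "x \<in> V"
  shows "(\<Sum>y\<in>V. p x y) = 1 - gap"
proof -
  have "(\<Sum>y\<in>V. p x y) = (\<Sum>y\<in>V - {x}. p x y)"
    using fin assms by (simp add: sum_diff1 p_diag)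
  also have "\<dots> = (\<Sum>y\<in>V - {x}. 1 - exp (W * real n powr - \<theta>) * exp (- W * \<rho> (torus_dist x y)))"
  proof (rule sum.cong)
    fix y assume "y \<in> V - {x}"
    then have "A1 * real n powr - \<alpha> \<le> \<rho> (torus_dist x y)" using rho_ge_far assms by auto
    moreover have "0 \<le> A1 / 2 * real n powr - \<alpha>" using A by simp
    ultimately have "real n powr - \<theta> \<le> \<rho> (torus_dist x y)" using assms(1) by linarith
    then show "p x y = 1 - exp (W * real n powr - \<theta>) * exp (- W * \<rho> (torus_dist x y))"
      by (simp add: p_def kappa_minus_eq exp_add[symmetric] algebra_simps)
  qed simp
  also have "\<dots> = (real n powr d - 1) - exp (W * real n powr - \<theta>) * (real n powr d - 2)"
    using sum_exp_rho_off[OF assms(2)] card_off[OF assms(2)]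
    by (simp add: sum_subtractf sum_distrib_left[symmetric])
  finally show ?thesis by (simp add: gap_def algebra_simps)
qed

lemma gap_lower: "real n powr (\<alpha> - \<theta>) \<le> 3 * A2 * closeness_const CARD('d) \<alpha> * gap"
proof -
  let ?c = "A2 * closeness_const CARD('d) \<alpha>"
  have c: "0 \<le> ?c" using A by (simp add: closeness_const_def)
  have "real n powr (\<alpha> - \<theta>) = real n powr d * (real n powr (\<alpha> - d) * real n powr - \<theta>)"
    by (simp add: powr_add[symmetric])
  also have "\<dots> \<le> real n powr d * (?c * W * real n powr - \<theta>)"
    by (intro mult_left_mono mult_right_mono W_lower) auto
  also have "\<dots> = 3 * ?c * (real n powr d / 3 * (W * real n powr - \<theta>))" by simp
  also have "\<dots> \<le> 3 * ?c * gap"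
  proof -
    have "W * real n powr - \<theta> \<le> exp (W * real n powr - \<theta>) - 1"
      using exp_ge_add_one_self[of "W * real n powr - \<theta>"] by linarith
    then show ?thesis
      unfolding gap_def using c W_pos card_ge_3 by (intro mult_left_mono mult_mono) auto
  qed
  finally show ?thesis by simp
qed

lemma gap_upper:
  assumes "real n powr - \<theta> \<le> A1 / 2 * real n powr - \<alpha>"
  shows "gap \<le> 6 / A1 * real n powr (\<alpha> - \<theta>)"
proof -
  define v where "v = W * real n powr - \<theta>"
  have "v \<le> (3 / A1 * real n powr (\<alpha> - d)) * (A1 / 2 * real n powr - \<alpha>)"
    unfolding v_def using W_pos A assms by (intro mult_mono W_upper) auto
  also have "\<dots> = 3 / 2 * (real n powr (\<alpha> - d) * real n powr - \<alpha>)" using A by simp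
  also have "real n powr (\<alpha> - d) * real n powr - \<alpha> = 1 / real n powr d"
    by (subst powr_add[symmetric]) (simp add: powr_minus_divide)
  also have "3 / 2 * (1 / real n powr d) \<le> 1" using card_ge_3 by (simp add: divide_simps)
  finally have v: "0 \<le> v" "v \<le> 1" using W_pos by (auto simp: v_def)
  have "exp v - 1 \<le> v + v * v" using exp_bound[OF v] by (simp add: power2_eq_square)
  also have "\<dots> \<le> v + v * 1" using v by (intro add_left_mono mult_left_mono) auto
  finally have "exp v - 1 \<le> 2 * v" by simp
  then have "gap \<le> real n powr d * (2 * v)"
    unfolding gap_def v_def[symmetric] using card_ge_3 v by (intro mult_mono) auto
  also have "\<dots> \<le> real n powr d * (2 * ((3 / A1 * real n powr (\<alpha> - d)) * real n powr - \<theta>))"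
    unfolding v_def by (intro mult_left_mono mult_right_mono W_upper) auto
  also have "\<dots> = 6 / A1 * (real n powr d * real n powr (\<alpha> - d) * real n powr - \<theta>)" by simp
  also have "real n powr d * real n powr (\<alpha> - d) * real n powr - \<theta> = real n powr (\<alpha> - \<theta>)"
    by (simp add: powr_add[symmetric])
  finally show ?thesis .
qed

lemma p_lower:
  assumes "real n powr - \<theta> \<le> A1 / 2 * real n powr - \<alpha>" "3 * A2 / A1 * real n powr (\<alpha> - d) \<le> 1"
    "x \<in> V" "y \<in> V" "x \<noteq> y"
  shows "A1 / 4 * W * torus_dist x y powr - \<alpha> \<le> p x y"
proof -
  let ?\<rho> = "\<rho> (torus_dist x y)" and ?k = "kappa_minus \<theta> \<rho> n x y"
  have D: "1 \<le> torus_dist x y" by (rule dist_ge_1[OF assms(3-5)])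
  have "?k \<ge> W * (?\<rho> / 2)"
  proof -
    have "?\<rho> / 2 \<le> max (?\<rho> - real n powr - \<theta>) 0"
      using rho_ge_far[OF assms(3-5)] assms(1) by linarith
    then show ?thesis unfolding kappa_minus_eq using W_pos by (intro mult_left_mono) auto
  qed
  moreover have "?k \<le> 1"
  proof -
    have "torus_dist x y powr - \<alpha> \<le> 1" using 
      powr_mono2'[of "- \<alpha>" 1 "torus_dist x y"] D \<alpha> by simp
    then have "?\<rho> \<le> A2 * 1" using rho_upper[OF D] A
      by (intro order_trans[OF rho_upper[OF D]] mult_left_mono) auto
    then have "max (?\<rho> - real n powr - \<theta>) 0 \<le> A2"
      using powr_ge_zero[of "real n" "- \<theta>"] A by linarith
    then have "?k \<le> W * A2"
      unfolding kappa_minus_eq using W_pos by (intro mult_left_mono) auto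
    also have "\<dots> \<le> 3 / A1 * real n powr (\<alpha> - d) * A2" using A by (intro mult_right_mono W_upper) auto
    also have "\<dots> = 3 * A2 / A1 * real n powr (\<alpha> - d)" by simp
    finally show ?thesis using assms(2) by linarith
  qed
  moreover have "?k / 2 \<le> p x y"
  proof -
    have k: "0 \<le> ?k" by (rule kappa_minus_nonneg)
    have "exp (- ?k) \<le> 1 / (1 + ?k)"
      using exp_ge_add_one_self[of ?k] k by (simp add: exp_minus_inverse exp_minus field_simps)
    also have "\<dots> \<le> 1 - ?k / 2"
      using k \<open>?k \<le> 1\<close> mult_left_mono[of ?k 1 ?k] by (simp add: field_simps)
    finally show ?thesis by (simp add: p_def)
  qed
  moreover have "W * (A1 * torus_dist x y powr - \<alpha>) \<le> W * ?\<rho>"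
    using rho_lower[OF D] W_pos by (intro mult_left_mono) auto
  ultimately have "W * (A1 * torus_dist x y powr - \<alpha>) \<le> 4 * p x y" by simp
  then show ?thesis by (simp add: mult_ac)
qed

lemma p_lower_uniform:
  assumes "real n powr - \<theta> \<le> A1 / 2 * real n powr - \<alpha>" "3 * A2 / A1 * real n powr (\<alpha> - d) \<le> 1"
    "x \<in> V" "y \<in> V" "x \<noteq> y"
  shows "A1 / (4 * A2 * closeness_const CARD('d) \<alpha>) / real (card V) \<le> p x y"
proof -
  let ?c = "A2 * closeness_const CARD('d) \<alpha>"
  have c: "0 < ?c" using A by (auto simp: closeness_const_def intro!: mult_pos_pos add_pos_nonneg)
  have D: "1 \<le> torus_dist x y" "torus_dist x y \<le> real n"
    using dist_ge_1[OF assms(3-5)] dist_le_n[OF assms(3,4)] .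
  have "1 / real n powr d = real n powr (\<alpha> - d) * real n powr - \<alpha>"
    by (subst powr_add[symmetric]) (simp add: powr_minus_divide)
  also have "\<dots> \<le> ?c * W * torus_dist x y powr - \<alpha>"
    using D \<alpha> c W_pos by (intro mult_mono W_lower powr_mono2') auto
  finally have "A1 / (4 * ?c) * (1 / real n powr d) \<le> A1 / (4 * ?c) * (?c * W * torus_dist x y powr - \<alpha>)"
    using A c by (intro mult_left_mono) auto
  also have "\<dots> = A1 / 4 * W * torus_dist x y powr - \<alpha>" 
  proof -
    have "A1 / (4 * c) * (c * W * t) = A1 / 4 * W * t" if "0 < c" for c t :: real
      using that by simp
    from this[OF c] show ?thesis .
  qed
  also have "\<dots> \<le> p x y" by (rule p_lower[OF assms])
  finally show ?thesis by (simp add: card_V mult.assoc)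
qed

lemma conn_prob_eq_Pr: "conn_prob \<theta> \<rho> n x y = Pr (\<lambda>g. joined V g x y)"
  unfolding Pr_def V_def by (rule conn_prob_eq_joined) (use n in auto)

end

section \<open>Uniform bounds for the connection probability\<close>

text \<open>The conditions \<open>small\<close> hold for large \<open>n\<close>; see \<open>eventually_scales_separate\<close>. Here \<open>C0\<close> is the
  constant with \<open>\<epsilon> \<ge> n\<^sup>\<alpha>\<^sup>-\<^sup>\<theta> / C0\<close>, \<open>H\<close> bounds \<open>\<eta>/\<epsilon>\<close>, and \<open>c2 / n\<^sup>d\<close> bounds all edge
  probabilities from below. Since \<open>\<eta>\<close> is at least \<open>A1 / 6\<close> times \<open>n\<^sup>\<theta>\<^sup>-\<^sup>\<alpha>\<^sup>-\<^sup>d\<close>, the choice of \<open>L\<close> turns the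
  far-regime condition with the factor \<open>3 powr \<alpha>\<close> into \<open>profile \<alpha> x0 x \<le> L * \<eta>\<close>.\<close>

lemma (in long_range_torus) connection_bounds:
  fixes K S :: real
  defines "C0 \<equiv> 3 * A2 * closeness_const CARD('d) \<alpha>"
  defines "c2 \<equiv> A1 / (4 * A2 * closeness_const CARD('d) \<alpha>)"
  defines "L \<equiv> max 1 (6 * 3 powr \<alpha> / A1)"
  defines "H \<equiv> C0\<^sup>2 * real n powr (2 * (\<theta> - \<alpha>) - d)"
  defines "x0 \<equiv> torus_zero n"
  assumes K: "1 \<le> K" "\<And>\<epsilon> S. (\<forall>x\<in>V. \<forall>y\<in>V. p x y \<le> 3 * A2 / A1 * profile \<alpha> x y) \<Longrightarrow>
    (\<forall>x\<in>V. (\<Sum>y\<in>V. p x y) = 1 - \<epsilon>) \<Longrightarrow> 0 < \<epsilon> \<Longrightarrow> \<epsilon> \<le> 1 / 4 \<Longrightarrow>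
    (\<forall>x\<in>V. (\<Sum>y\<in>V. (profile \<alpha> x y)\<^sup>2) \<le> S) \<Longrightarrow>
    \<exists>G. subcritical_graph V p (random_graph \<theta> \<rho> n) G (profile \<alpha>) K \<epsilon> (1 / (real n powr d * \<epsilon>)) S"
    and S: "\<And>x. x \<in> V \<Longrightarrow> (\<Sum>y\<in>V. (profile \<alpha> x y)\<^sup>2) \<le> S"
    and small: "real n powr - \<theta> \<le> A1 / 2 * real n powr - \<alpha>" "3 * A2 / A1 * real n powr (\<alpha> - d) \<le> 1"
      "6 / A1 * real n powr (\<alpha> - \<theta>) \<le> 1 / 4"
      "54 * K ^ 8 * (S + 2 * H) \<le> real n powr (\<alpha> - \<theta>) / C0"
      "26 * K ^ 8 * L * (S + H + real n powr (\<alpha> - d)) \<le> c2 / 8"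
    and x: "x \<in> V" "x \<noteq> x0"
  shows "conn_prob \<theta> \<rho> n x0 x
      \<le> K * (real n powr (\<alpha> - d) * torus_dist x0 x powr - \<alpha> + C0 * real n powr (\<theta> - \<alpha> - d))"
    and "A1 / 4 * W * torus_dist x0 x powr - \<alpha> \<le> conn_prob \<theta> \<rho> n x0 x"
    and "real n powr (\<alpha> - d) * torus_dist x0 x powr - \<alpha> \<le> 3 powr \<alpha> * real n powr (\<theta> - \<alpha> - d) \<Longrightarrow>
      c2 * A1 / 48 * real n powr (\<theta> - \<alpha> - d) \<le> conn_prob \<theta> \<rho> n x0 x"
proof -
  have C0: "0 < C0" unfolding C0_def using A
    by (auto simp: closeness_const_def intro!: mult_pos_pos add_pos_nonneg)
  have c2: "0 < c2" unfolding c2_def using A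
    by (auto simp: closeness_const_def intro!: mult_pos_pos divide_pos_pos add_pos_nonneg)
  have x0V: "x0 \<in> V" unfolding x0_def by (rule zero_in_V)
  have gap: "real n powr (\<alpha> - \<theta>) / C0 \<le> gap"
    using gap_lower C0 unfolding C0_def by (simp add: field_simps)
  have "0 < real n powr (\<alpha> - \<theta>) / C0" using C0 n by simp
  then have gap_pos: "0 < gap" using gap by linarith
  have gap_le: "gap \<le> 1 / 4" using gap_upper[OF small(1)] small(3) by linarith
  define \<eta> where "\<eta> = 1 / (real n powr d * gap)"
  have \<eta>_upper: "\<eta> \<le> C0 * real n powr (\<theta> - \<alpha> - d)"
  proof -
    have "1 / gap \<le> 1 / (real n powr (\<alpha> - \<theta>) / C0)"
      using gap gap_pos C0 n by (intro divide_left_mono) auto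
    also have "\<dots> = C0 * real n powr (\<theta> - \<alpha>)"
      using powr_minus_divide[of "real n" "\<alpha> - \<theta>"] by simp
    finally have "1 / gap * (1 / real n powr d) \<le> C0 * real n powr (\<theta> - \<alpha>) * (1 / real n powr d)"
      by (intro mult_right_mono) auto
    then show ?thesis by (simp add: \<eta>_def powr_diff mult.commute)
  qed
  have \<eta>_lower: "A1 / 6 * real n powr (\<theta> - \<alpha> - d) \<le> \<eta>"
  proof -
    have "1 / (6 / A1 * real n powr (\<alpha> - \<theta>)) \<le> 1 / gap"
      using gap_upper[OF small(1)] gap_pos A n by (intro divide_left_mono) auto
    moreover have "1 / (6 / A1 * real n powr (\<alpha> - \<theta>)) = A1 / 6 * real n powr (\<theta> - \<alpha>)"
      using powr_minus_divide[of "real n" "\<alpha> - \<theta>"] by simp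
    ultimately have "A1 / 6 * real n powr (\<theta> - \<alpha>) * (1 / real n powr d) \<le> 1 / gap * (1 / real n powr d)"
      by (intro mult_right_mono) auto
    then show ?thesis by (simp add: \<eta>_def powr_diff mult_ac)
  qed
  have \<eta>_gap: "\<eta> / gap \<le> H"
  proof -
    have "\<eta> / gap = (1 / gap)\<^sup>2 / real n powr d"
      by (simp add: \<eta>_def power2_eq_square)
    also have "\<dots> \<le> (C0 * real n powr (\<theta> - \<alpha>))\<^sup>2 / real n powr d"
    proof (intro divide_right_mono power_mono)
      have "1 / gap \<le> 1 / (real n powr (\<alpha> - \<theta>) / C0)"
        using gap gap_pos C0 n by (intro divide_left_mono) auto
      also have "\<dots> = C0 * real n powr (\<theta> - \<alpha>)"
        using powr_minus_divide[of "real n" "\<alpha> - \<theta>"] by simp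
      finally show "1 / gap \<le> C0 * real n powr (\<theta> - \<alpha>)" .
    qed (use gap_pos in auto)
    also have "\<dots> = H"
      unfolding H_def power_mult_distrib powr_diff[of "real n" "2 * (\<theta> - \<alpha>)" d]
      by (simp add: power2_eq_square flip: powr_add)
    finally show ?thesis .
  qed
  obtain G where "subcritical_graph V p (random_graph \<theta> \<rho> n) G (profile \<alpha>) K gap \<eta> S"
    unfolding \<eta>_def using K(2)[of gap S] p_le_profile p_mass[OF small(1)] gap_pos gap_le S by blast
  then interpret sub: subcritical_graph V p "random_graph \<theta> \<rho> n" G "profile \<alpha>" K gap \<eta> S .
  have Q: "real n powr (\<alpha> - d) * torus_dist x0 x powr - \<alpha> = profile \<alpha> x0 x"
    using dist_powr_profile[OF x0V x(1)] x(2) by metis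
  show "conn_prob \<theta> \<rho> n x0 x
      \<le> K * (real n powr (\<alpha> - d) * torus_dist x0 x powr - \<alpha> + C0 * real n powr (\<theta> - \<alpha> - d))"
  proof -
    have "conn_prob \<theta> \<rho> n x0 x \<le> G x0 x"
      unfolding conn_prob_eq_Pr by (rule sub.Pr_joined_le) (use x0V x in auto)
    also have "\<dots> \<le> K * (profile \<alpha> x0 x + \<eta>)"
      using sub.G_le[OF x0V x(1)] x(2) by simp
    also have "\<dots> \<le> K * (profile \<alpha> x0 x + C0 * real n powr (\<theta> - \<alpha> - d))"
      using K(1) \<eta>_upper by (intro mult_left_mono) auto
    finally show ?thesis unfolding Q .
  qed
  show "A1 / 4 * W * torus_dist x0 x powr - \<alpha> \<le> conn_prob \<theta> \<rho> n x0 x"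
  proof -
    have "A1 / 4 * W * torus_dist x0 x powr - \<alpha> \<le> p x0 x"
      by (rule p_lower[OF small(1,2) x0V x(1)]) (use x in auto)
    also have "p x0 x = Pr (\<lambda>g. g {x0, x} \<and> True)"
      using Pr_edge[of x0 x "\<lambda>_. True"] x0V x by (simp add: Pr_True)
    also have "\<dots> \<le> Pr (\<lambda>g. joined V g x0 x)"
      by (rule Pr_mono) (use x0V x in \<open>auto intro: joined_edge\<close>)
    finally show ?thesis unfolding conn_prob_eq_Pr .
  qed
  assume far: "real n powr (\<alpha> - d) * torus_dist x0 x powr - \<alpha> \<le> 3 powr \<alpha> * real n powr (\<theta> - \<alpha> - d)"
  have "c2 / 8 * \<eta> \<le> Pr (\<lambda>g. joined V g x0 x)"
  proof (rule sub.Pr_joined_lower_far[where u = "real n powr (\<alpha> - d)" and L = L])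
    show "c2 / real (card V) \<le> p x0 y" if "y \<in> V" "y \<noteq> x0" for y
      unfolding c2_def using p_lower_uniform[OF small(1,2) x0V that(1)] that by (simp add: mult.assoc)
    have "profile \<alpha> x0 x \<le> 3 powr \<alpha> * real n powr (\<theta> - \<alpha> - d)" using far unfolding Q .
    also have "\<dots> = 6 * 3 powr \<alpha> / A1 * (A1 / 6 * real n powr (\<theta> - \<alpha> - d))" using A by simp
    also have "\<dots> \<le> L * \<eta>"
      unfolding L_def using A \<eta>_lower by (intro mult_mono) auto
    finally show "profile \<alpha> x0 x \<le> L * \<eta>" .
    have "54 * K ^ 8 * (S + 2 * \<eta> / gap) \<le> 54 * K ^ 8 * (S + 2 * H)"
      using K(1) \<eta>_gap by (intro mult_left_mono) auto
    then show "54 * K ^ 8 * (S + 2 * \<eta> / gap) \<le> gap" using small(4) gap by linarith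
    have "26 * K ^ 8 * L * (S + \<eta> / gap + real n powr (\<alpha> - d))
        \<le> 26 * K ^ 8 * L * (S + H + real n powr (\<alpha> - d))"
      using K(1) \<eta>_gap by (intro mult_left_mono) (auto simp: L_def)
    then show "26 * K ^ 8 * L * (S + \<eta> / gap + real n powr (\<alpha> - d)) \<le> c2 / 8"
      using small(5) by linarith
    show "profile \<alpha> x0 z \<le> real n powr (\<alpha> - d)" for z using \<alpha> by (intro profile_le) auto
  qed (use x0V x c2 in \<open>auto simp: L_def\<close>)
  moreover have "c2 / 8 * (A1 / 6 * real n powr (\<theta> - \<alpha> - d)) \<le> c2 / 8 * \<eta>"
    using \<eta>_lower c2 by (intro mult_left_mono) auto
  ultimately show "c2 * A1 / 48 * real n powr (\<theta> - \<alpha> - d) \<le> conn_prob \<theta> \<rho> n x0 x"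
    unfolding conn_prob_eq_Pr by (simp add: mult_ac)
qed

lemma eventually_powr_le:
  assumes "a < 0" "0 < e"
  shows "\<forall>\<^sub>F n in sequentially. B * real n powr a \<le> e"
proof -
  have "((\<lambda>n. B * real n powr a) \<longlongrightarrow> B * 0) sequentially"
    by (intro tendsto_mult_left tendsto_neg_powr filterlim_real_sequentially assms)
  then have "\<forall>\<^sub>F n in sequentially. B * real n powr a < e"
    using assms by (intro order_tendstoD) auto
  then show ?thesis by eventually_elim simp
qed

text \<open>The exponents that must be negative: \<open>3 (\<theta> - \<alpha>) - d\<close> says that \<open>\<epsilon>\<close> lies above the critical
  window, and \<open>\<alpha> + \<theta> - s - d\<close> says that short cycles, of weight \<open>n\<close> to the power
  \<open>2 \<alpha> - s - d\<close>, are negligible against \<open>\<epsilon>\<close>.\<close>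

lemma eventually_scales_separate:
  fixes d \<alpha> \<theta> s K C0 c2 L A1 A2 Cs :: real
  assumes "0 < A1" "0 < C0" "0 < c2" "\<alpha> < d" "\<alpha> < \<theta>" "3 * (\<theta> - \<alpha>) < d" "\<alpha> + \<theta> < d + s"
  shows "\<forall>\<^sub>F n in sequentially. 3 \<le> n \<and>
    real n powr - \<theta> \<le> A1 / 2 * real n powr - \<alpha> \<and> 3 * A2 / A1 * real n powr (\<alpha> - d) \<le> 1 \<and>
    6 / A1 * real n powr (\<alpha> - \<theta>) \<le> 1 / 4 \<and>
    54 * K ^ 8 * (Cs * real n powr (2 * \<alpha> - s - d) + 2 * (C0\<^sup>2 * real n powr (2 * (\<theta> - \<alpha>) - d)))
      \<le> real n powr (\<alpha> - \<theta>) / C0 \<and>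
    26 * K ^ 8 * L * (Cs * real n powr (2 * \<alpha> - s - d) + C0\<^sup>2 * real n powr (2 * (\<theta> - \<alpha>) - d)
      + real n powr (\<alpha> - d)) \<le> c2 / 8"
proof -
  have exps: "\<alpha> - \<theta> < 0" "\<alpha> - d < 0" "\<alpha> + \<theta> - s - d < 0"
    "3 * (\<theta> - \<alpha>) - d < 0" "2 * \<alpha> - s - d < 0" "2 * (\<theta> - \<alpha>) - d < 0"
    and pos: "0 < A1 / 2" "0 < 1 / (2 * C0)" "0 < c2 / 24"
    using assms by auto
  show ?thesis
    using eventually_ge_at_top[of "3 :: nat"]
      eventually_powr_le[OF exps(1) pos(1), of 1]
      eventually_powr_le[OF exps(2) zero_less_one, of "3 * A2 / A1"]
      eventually_powr_le[OF exps(1), of "1 / 4" "6 / A1", simplified]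
      eventually_powr_le[OF exps(3) pos(2), of "54 * K ^ 8 * Cs"]
      eventually_powr_le[OF exps(4) pos(2), of "108 * K ^ 8 * C0\<^sup>2"]
      eventually_powr_le[OF exps(5) pos(3), of "26 * K ^ 8 * L * Cs"]
      eventually_powr_le[OF exps(6) pos(3), of "26 * K ^ 8 * L * C0\<^sup>2"]
      eventually_powr_le[OF exps(2) pos(3), of "26 * K ^ 8 * L"]
  proof eventually_elim
    case (elim n)
    have split: "real n powr b = real n powr (b + (\<theta> - \<alpha>)) * real n powr (\<alpha> - \<theta>)" for b
      using elim by (simp flip: powr_add)
    have "real n powr - \<theta> = real n powr (\<alpha> - \<theta>) * real n powr - \<alpha>"
      using elim by (simp flip: powr_add)
    also have "\<dots> \<le> A1 / 2 * real n powr - \<alpha>"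
      using elim by (intro mult_right_mono) auto
    finally have one: "real n powr - \<theta> \<le> A1 / 2 * real n powr - \<alpha>" .
    have "54 * K ^ 8 * Cs * real n powr (\<alpha> + \<theta> - s - d) * real n powr (\<alpha> - \<theta>)
        \<le> 1 / (2 * C0) * real n powr (\<alpha> - \<theta>)"
      "108 * K ^ 8 * C0\<^sup>2 * real n powr (3 * (\<theta> - \<alpha>) - d) * real n powr (\<alpha> - \<theta>)
        \<le> 1 / (2 * C0) * real n powr (\<alpha> - \<theta>)"
      using elim by (intro mult_right_mono; simp)+
    moreover have "54 * K ^ 8 * (Cs * real n powr (2 * \<alpha> - s - d) + 2 * (C0\<^sup>2 * real n powr (2 * (\<theta> - \<alpha>) - d)))
      = 54 * K ^ 8 * Cs * real n powr (\<alpha> + \<theta> - s - d) * real n powr (\<alpha> - \<theta>)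
      + 108 * K ^ 8 * C0\<^sup>2 * real n powr (3 * (\<theta> - \<alpha>) - d) * real n powr (\<alpha> - \<theta>)"
      unfolding split[of "2 * \<alpha> - s - d"] split[of "2 * (\<theta> - \<alpha>) - d"]
      by (simp add: algebra_simps)
    moreover have "1 / (2 * C0) * real n powr (\<alpha> - \<theta>) + 1 / (2 * C0) * real n powr (\<alpha> - \<theta>)
      = real n powr (\<alpha> - \<theta>) / C0" by simp
    ultimately have four: "54 * K ^ 8 * (Cs * real n powr (2 * \<alpha> - s - d)
        + 2 * (C0\<^sup>2 * real n powr (2 * (\<theta> - \<alpha>) - d))) \<le> real n powr (\<alpha> - \<theta>) / C0"
      by linarith
    have "26 * K ^ 8 * L * (Cs * real n powr (2 * \<alpha> - s - d) + C0\<^sup>2 * real n powr (2 * (\<theta> - \<alpha>) - d)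
        + real n powr (\<alpha> - d))
      = 26 * K ^ 8 * L * Cs * real n powr (2 * \<alpha> - s - d)
        + 26 * K ^ 8 * L * C0\<^sup>2 * real n powr (2 * (\<theta> - \<alpha>) - d) + 26 * K ^ 8 * L * real n powr (\<alpha> - d)"
      by (simp add: distrib_left mult.assoc)
    also have "\<dots> \<le> c2 / 24 + c2 / 24 + c2 / 24" using elim by (intro add_mono) auto
    finally show ?case using one four elim by auto
  qed
qed

text \<open>The two-point function is comparable to the larger one of \<open>Q\<close> and \<open>F\<close>. The factor \<open>3 powr \<alpha>\<close>
  leaves room for the difference between \<open>n\<close> and the diameter \<open>n div 2 \<ge> n / 3\<close> in the
  definition of the regimes.\<close>

definition two_scale_bounds ::
    "real \<Rightarrow> real \<Rightarrow> real \<Rightarrow> real \<Rightarrow> (real \<Rightarrow> real) \<Rightarrow> nat \<Rightarrow> (int ^ 'd) set \<Rightarrow> bool" where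
  "two_scale_bounds C c \<alpha> \<theta> \<rho> n x \<longleftrightarrow>
    (let P = conn_prob \<theta> \<rho> n (torus_zero n) x; r = torus_norm n x;
       W = inverse (zeta CARD('d) \<rho> n); Q = real n powr (\<alpha> - real CARD('d)) * r powr - \<alpha>;
       F = far_value CARD('d) \<alpha> \<theta> n
     in 3 \<le> n \<and> 1 \<le> r \<and> P \<le> C * (Q + F) \<and> Q \<le> C * (W * r powr - \<alpha>) \<and>
        c * (W * r powr - \<alpha>) \<le> P \<and> (Q \<le> 3 powr \<alpha> * F \<longrightarrow> c * F \<le> P))"

text \<open>The exponent \<open>s\<close> for \<open>profile_square\<close> has to satisfy \<open>s < d\<close>, \<open>s \<le> 2 \<alpha>\<close> and \<open>\<alpha> + \<theta> < d + s\<close>. Such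
  an \<open>s\<close> exists because \<open>\<theta> < 2 d - \<alpha>\<close> and \<open>\<theta> < \<alpha> + d\<close>. The constants \<open>C\<close> and \<open>c\<close> are fixed before
  \<open>\<theta>\<close>; only the threshold \<open>n0\<close> depends on it.\<close>

lemma torus_connection_bounds:
  fixes \<alpha> A1 A2 :: real
  assumes "0 < A1" "A1 \<le> A2" "0 < \<alpha>" "\<alpha> < real CARD('d :: finite)"
  obtains C c where "0 < C" "0 < c"
    "\<And>\<theta>. \<alpha> < \<theta> \<Longrightarrow> \<theta> < \<alpha> + real CARD('d) / 3 \<Longrightarrow> \<theta> < 2 * real CARD('d) - \<alpha> \<Longrightarrow>
      \<exists>n0. \<forall>\<rho>. admissible_rho A1 A2 \<alpha> \<rho> \<longrightarrow>
        (\<forall>n\<ge>n0. \<forall>x\<in>torus n - {torus_zero n :: (int ^ 'd) set}. two_scale_bounds C c \<alpha> \<theta> \<rho> n x)"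
proof -
  define d where "d = real CARD('d)"
  define Ca where "Ca = closeness_const CARD('d) \<alpha>"
  define C0 where "C0 = 3 * A2 * Ca"
  define c2 where "c2 = A1 / (4 * A2 * Ca)"
  define L where "L = max 1 (6 * 3 powr \<alpha> / A1)"
  have Ca: "0 < Ca" by (auto simp: Ca_def closeness_const_def intro!: add_pos_nonneg)
  have C0: "0 < C0" and c2: "0 < c2" using assms Ca by (auto simp: C0_def c2_def)
  obtain K where K: "1 \<le> K" and K': "\<And>(V :: (int ^ 'd) set set) h n p M \<epsilon> S.
    power_law_space V h n d (closeness_const CARD('d)) \<Longrightarrow> bernoulli_graph V p M \<Longrightarrow>
    (\<forall>x\<in>V. \<forall>y\<in>V. p x y \<le> 3 * A2 / A1 * power_law_space.profile h n d \<alpha> x y) \<Longrightarrow>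
    (\<forall>x\<in>V. (\<Sum>y\<in>V. p x y) = 1 - \<epsilon>) \<Longrightarrow> 0 < \<epsilon> \<Longrightarrow> \<epsilon> \<le> 1 / 4 \<Longrightarrow>
    (\<forall>x\<in>V. (\<Sum>y\<in>V. (power_law_space.profile h n d \<alpha> x y)\<^sup>2) \<le> S) \<Longrightarrow>
    \<exists>G. subcritical_graph V p M G (power_law_space.profile h n d \<alpha>) K \<epsilon> (1 / (n powr d * \<epsilon>)) S"
  proof -
    have nonneg: "\<alpha> < d" "0 \<le> 3 * A2 / A1" using assms by (auto simp: d_def)
    from that show thesis by (rule subcritical_graph_exists[OF assms(3) nonneg])
  qed
  define C where "C = K + K * C0 + A2 * Ca"
  define c where "c = min (A1 / 4) (c2 * A1 / 48)"
  have C: "K \<le> C" "K * C0 \<le> C" "A2 * Ca \<le> C" "0 < C"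
    using K C0 assms Ca by (auto simp: C_def intro!: add_pos_nonneg)
  have c: "0 < c" "c \<le> A1 / 4" "c \<le> c2 * A1 / 48" using c2 assms by (auto simp: c_def)
  show thesis
  proof (rule that[OF C(4) c(1)])
    fix \<theta> assume \<theta>: "\<alpha> < \<theta>" "\<theta> < \<alpha> + real CARD('d) / 3" "\<theta> < 2 * real CARD('d) - \<alpha>"
    have "max 0 (\<alpha> + \<theta> - d) < min d (2 * \<alpha>)" using \<theta> assms by (auto simp: d_def)
    then obtain s where "max 0 (\<alpha> + \<theta> - d) < s" "s < min d (2 * \<alpha>)" using dense by blast
    then have s: "0 \<le> s" "s < d" "s \<le> 2 * \<alpha>" "\<alpha> + \<theta> < d + s" by auto
    define Cs where "Cs = closeness_const CARD('d) s"
    obtain n0 where n0: "\<And>n. n \<ge> n0 \<Longrightarrow> 3 \<le> n \<and>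
      real n powr - \<theta> \<le> A1 / 2 * real n powr - \<alpha> \<and> 3 * A2 / A1 * real n powr (\<alpha> - d) \<le> 1 \<and>
      6 / A1 * real n powr (\<alpha> - \<theta>) \<le> 1 / 4 \<and>
      54 * K ^ 8 * (Cs * real n powr (2 * \<alpha> - s - d) + 2 * (C0\<^sup>2 * real n powr (2 * (\<theta> - \<alpha>) - d)))
        \<le> real n powr (\<alpha> - \<theta>) / C0 \<and>
      26 * K ^ 8 * L * (Cs * real n powr (2 * \<alpha> - s - d) + C0\<^sup>2 * real n powr (2 * (\<theta> - \<alpha>) - d)
        + real n powr (\<alpha> - d)) \<le> c2 / 8"
      using eventually_scales_separate[of A1 C0 c2 \<alpha> d \<theta> s A2 K Cs L] assms C0 c2 \<theta> s
      unfolding eventually_sequentially d_def by auto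
    show "\<exists>n0. \<forall>\<rho>. admissible_rho A1 A2 \<alpha> \<rho> \<longrightarrow>
        (\<forall>n\<ge>n0. \<forall>x\<in>torus n - {torus_zero n :: (int ^ 'd) set}. two_scale_bounds C c \<alpha> \<theta> \<rho> n x)"
    proof (intro exI[of _ n0] allI impI ballI)
      fix \<rho> n and x :: "(int ^ 'd) set"
      assume adm: "admissible_rho A1 A2 \<alpha> \<rho>" and "n \<ge> n0" and x: "x \<in> torus n - {torus_zero n}"
      note n = n0[OF \<open>n \<ge> n0\<close>]
      define W where "W = inverse (zeta CARD('d) \<rho> n)"
      interpret lrt: long_range_torus "torus n :: (int ^ 'd) set set" \<alpha> \<theta> A1 A2 \<rho> n d W
        by unfold_locales (use assms adm n in \<open>auto simp: d_def W_def\<close>)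
      let ?P = "conn_prob \<theta> \<rho> n (torus_zero n) x" and ?r = "torus_norm n x"
      have r: "?r = torus_dist (torus_zero n) x" by (simp add: torus_norm_def torus_dist_commute)
      have F: "far_value CARD('d) \<alpha> \<theta> n = real n powr (\<theta> - \<alpha> - d)"
        by (simp add: far_value_def d_def algebra_simps)
      have r1: "1 \<le> ?r" unfolding r using lrt.dist_ge_1 lrt.zero_in_V x by blast
      have sub: "\<exists>G. subcritical_graph (torus n) lrt.p (random_graph \<theta> \<rho> n) G (lrt.profile \<alpha>) K \<epsilon> (1 / (real n powr d * \<epsilon>)) S"
        if "\<forall>x\<in>torus n. \<forall>y\<in>torus n. lrt.p x y \<le> 3 * A2 / A1 * lrt.profile \<alpha> x y"
          "\<forall>x\<in>torus n. (\<Sum>y\<in>torus n. lrt.p x y) = 1 - \<epsilon>" "0 < \<epsilon>" "\<epsilon> \<le> 1 / 4"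
          "\<forall>x\<in>torus n. (\<Sum>y\<in>torus n. (lrt.profile \<alpha> x y)\<^sup>2) \<le> S" for \<epsilon> S
        by (rule K'[OF lrt.power_law_space_axioms lrt.bernoulli_graph_axioms that])
      note bounds = lrt.connection_bounds[OF K sub, where S = "Cs * real n powr (2 * \<alpha> - s - d)" and x = x,
          folded Ca_def, folded C0_def c2_def L_def]
      have sq: "(\<Sum>y\<in>torus n. (lrt.profile \<alpha> x y)\<^sup>2) \<le> Cs * real n powr (2 * \<alpha> - s - d)"
        if "x \<in> torus n" for x :: "(int ^ 'd) set"
        unfolding Cs_def by (rule lrt.profile_square) (use s that in auto)
      have b1: "?P \<le> K * (real n powr (\<alpha> - d) * ?r powr - \<alpha> + C0 * real n powr (\<theta> - \<alpha> - d))"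
        unfolding r by (rule bounds(1)) (use n sq x in auto)
      have b2: "A1 / 4 * W * ?r powr - \<alpha> \<le> ?P"
        unfolding r by (rule bounds(2)) (use n sq x in auto)
      have b3: "c2 * A1 / 48 * real n powr (\<theta> - \<alpha> - d) \<le> ?P"
        if "real n powr (\<alpha> - d) * ?r powr - \<alpha> \<le> 3 powr \<alpha> * real n powr (\<theta> - \<alpha> - d)"
        using that unfolding r by (intro bounds(3)) (use n sq x in auto)
      have "?P \<le> C * (real n powr (\<alpha> - d) * ?r powr - \<alpha> + real n powr (\<theta> - \<alpha> - d))"
      proof -
        have "K * (real n powr (\<alpha> - d) * ?r powr - \<alpha>) \<le> C * (real n powr (\<alpha> - d) * ?r powr - \<alpha>)"
          "K * C0 * real n powr (\<theta> - \<alpha> - d) \<le> C * real n powr (\<theta> - \<alpha> - d)"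
          using C by (intro mult_right_mono; simp)+
        then show ?thesis using b1 by (simp add: distrib_left)
      qed
      moreover have "real n powr (\<alpha> - d) * ?r powr - \<alpha> \<le> C * (W * ?r powr - \<alpha>)"
      proof -
        have "real n powr (\<alpha> - d) * ?r powr - \<alpha> \<le> A2 * Ca * W * ?r powr - \<alpha>"
          unfolding Ca_def by (intro mult_right_mono lrt.W_lower) auto
        also have "\<dots> \<le> C * W * ?r powr - \<alpha>"
          using C lrt.W_pos by (intro mult_right_mono) auto
        finally show ?thesis by (simp add: mult.assoc)
      qed
      moreover have "c * (W * ?r powr - \<alpha>) \<le> ?P"
      proof -
        have "c * (W * ?r powr - \<alpha>) \<le> A1 / 4 * (W * ?r powr - \<alpha>)"
          using c lrt.W_pos by (intro mult_right_mono) auto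
        then show ?thesis using b2 by (simp add: mult.assoc)
      qed
      moreover have "c * real n powr (\<theta> - \<alpha> - d) \<le> ?P"
        if "real n powr (\<alpha> - d) * ?r powr - \<alpha> \<le> 3 powr \<alpha> * real n powr (\<theta> - \<alpha> - d)"
      proof -
        have "c * real n powr (\<theta> - \<alpha> - d) \<le> c2 * A1 / 48 * real n powr (\<theta> - \<alpha> - d)"
          using c by (intro mult_right_mono) auto
        then show ?thesis using b3[OF that] by linarith
      qed
      ultimately show "two_scale_bounds C c \<alpha> \<theta> \<rho> n x"
        using n r1 unfolding two_scale_bounds_def Let_def F by (simp add: W_def d_def)
    qed
  qed
qed

section \<open>The two regimes\<close>

text \<open>It suffices that \<open>f\<close> selects the term that dominates, up to a constant, at each vertex.\<close>

lemma conn_estimate_by_regimes: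
  fixes \<alpha> A1 A2 :: real and f :: "real \<Rightarrow> (real \<Rightarrow> real) \<Rightarrow> nat \<Rightarrow> (int ^ 'd) set \<Rightarrow> real"
  assumes "0 < A1" "A1 \<le> A2" "0 < \<alpha>" "\<alpha> < real CARD('d :: finite)"
    and \<Theta>: "\<And>\<theta>. \<theta> \<in> \<Theta> \<Longrightarrow> \<alpha> < \<theta> \<and> \<theta> < \<alpha> + real CARD('d) / 3 \<and> \<theta> < 2 * real CARD('d) - \<alpha>"
    and regimes: "\<And>\<theta> \<rho> n x. \<theta> \<in> \<Theta> \<Longrightarrow> 3 \<le> n \<Longrightarrow> 1 \<le> torus_norm n x \<Longrightarrow>
      (let r = torus_norm n x; Q = real n powr (\<alpha> - real CARD('d)) * r powr - \<alpha>;
         F = far_value CARD('d) \<alpha> \<theta> n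
       in f \<theta> \<rho> n x = inverse (zeta CARD('d) \<rho> n) * r powr - \<alpha> \<and> F \<le> Q \<or>
          f \<theta> \<rho> n x = F \<and> Q \<le> 3 powr \<alpha> * F)"
  shows "conn_estimate A1 A2 \<alpha> \<Theta> f"
proof -
  obtain C c where C: "0 < C" and c: "0 < c" and
    bounds: "\<And>\<theta>. \<alpha> < \<theta> \<Longrightarrow> \<theta> < \<alpha> + real CARD('d) / 3 \<Longrightarrow> \<theta> < 2 * real CARD('d) - \<alpha> \<Longrightarrow>
      \<exists>n0. \<forall>\<rho>. admissible_rho A1 A2 \<alpha> \<rho> \<longrightarrow>
        (\<forall>n\<ge>n0. \<forall>x\<in>torus n - {torus_zero n :: (int ^ 'd) set}. two_scale_bounds C c \<alpha> \<theta> \<rho> n x)"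
    using that by (rule torus_connection_bounds[where 'd = 'd, OF assms(1-4)])
  define B where "B = 2 * C * C + C * (3 powr \<alpha> + 1)"
  have B: "2 * C * C \<le> B" "C * (3 powr \<alpha> + 1) \<le> B" "0 < B"
    using C by (auto simp: B_def add_pos_nonneg)
  have "\<exists>n0. \<forall>\<rho>. admissible_rho A1 A2 \<alpha> \<rho> \<longrightarrow> (\<forall>n\<ge>n0. \<forall>x\<in>torus n - {torus_zero n}.
      conn_prob \<theta> \<rho> n (torus_zero n) x \<le> B * f \<theta> \<rho> n x \<and>
      f \<theta> \<rho> n x \<le> 1 / c * conn_prob \<theta> \<rho> n (torus_zero n) x)" if \<theta>: "\<theta> \<in> \<Theta>" for \<theta>
  proof -
    obtain n0 where n0: "\<forall>\<rho>. admissible_rho A1 A2 \<alpha> \<rho> \<longrightarrow>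
        (\<forall>n\<ge>n0. \<forall>x\<in>torus n - {torus_zero n :: (int ^ 'd) set}. two_scale_bounds C c \<alpha> \<theta> \<rho> n x)"
      using bounds[of \<theta>] \<Theta>[OF \<theta>] by blast
    show ?thesis
    proof (intro exI[of _ n0] allI impI ballI)
      fix \<rho> n and x :: "(int ^ 'd) set"
      assume adm: "admissible_rho A1 A2 \<alpha> \<rho>" and n: "n \<ge> n0" and x: "x \<in> torus n - {torus_zero n}"
      let ?P = "conn_prob \<theta> \<rho> n (torus_zero n) x"
      let ?T = "inverse (zeta CARD('d) \<rho> n) * torus_norm n x powr - \<alpha>"
      let ?Q = "real n powr (\<alpha> - real CARD('d)) * torus_norm n x powr - \<alpha>"
      let ?F = "far_value CARD('d) \<alpha> \<theta> n"
      have P: "3 \<le> n" "1 \<le> torus_norm n x" "?P \<le> C * (?Q + ?F)" "?Q \<le> C * ?T" "c * ?T \<le> ?P"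
        "?Q \<le> 3 powr \<alpha> * ?F \<Longrightarrow> c * ?F \<le> ?P"
        using n0 adm n x unfolding two_scale_bounds_def Let_def by blast+
      have F: "0 \<le> ?F" and Q: "0 \<le> ?Q" by (simp_all add: far_value_def)
      then have T: "0 \<le> ?T" using P(4) C zero_le_mult_iff[of C ?T] by linarith
      from regimes[OF \<theta> P(1,2), of \<rho>]
      consider (near) "f \<theta> \<rho> n x = ?T" "?F \<le> ?Q" | (far) "f \<theta> \<rho> n x = ?F" "?Q \<le> 3 powr \<alpha> * ?F"
        unfolding Let_def by blast
      then show "?P \<le> B * f \<theta> \<rho> n x \<and> f \<theta> \<rho> n x \<le> 1 / c * ?P"
      proof cases
        case near
        have "?P \<le> C * (?Q + ?Q)" 
          by (intro order_trans[OF P(3)] mult_left_mono add_left_mono near(2)) (use C in simp)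
        also have "\<dots> \<le> C * (C * ?T + C * ?T)" using P(4) C by (intro mult_left_mono add_mono) auto
        also have "\<dots> = 2 * C * C * ?T" by simp
        also have "\<dots> \<le> B * ?T" using B T by (intro mult_right_mono) auto
        finally show ?thesis using P(5) c near(1) by (simp add: field_simps)
      next
        case far
        have "?P \<le> C * (3 powr \<alpha> * ?F + ?F)" 
          by (intro order_trans[OF P(3)] mult_left_mono add_right_mono far(2)) (use C in simp)
        also have "\<dots> = C * (3 powr \<alpha> + 1) * ?F" by (simp add: algebra_simps)
        also have "\<dots> \<le> B * ?F" using B F by (intro mult_right_mono) auto
        finally show ?thesis using P(6)[OF far(2)] c far(1) by (simp add: field_simps)
      qed
    qed
  qed
  then have main: "\<forall>\<theta>\<in>\<Theta>. \<exists>n0. \<forall>\<rho>. admissible_rho A1 A2 \<alpha> \<rho> \<longrightarrow> (\<forall>n\<ge>n0. \<forall>x\<in>torus n - {torus_zero n}.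
      conn_prob \<theta> \<rho> n (torus_zero n) x \<le> B * f \<theta> \<rho> n x \<and>
      f \<theta> \<rho> n x \<le> 1 / c * conn_prob \<theta> \<rho> n (torus_zero n) x)" by blast
  show ?thesis
    unfolding conn_estimate_def uniform_asymp_def uniform_lesssim_def
  proof (rule conjI)
    show "\<exists>C>0. \<forall>\<theta>\<in>\<Theta>. \<exists>n0. \<forall>\<rho>. admissible_rho A1 A2 \<alpha> \<rho> \<longrightarrow> (\<forall>n\<ge>n0. \<forall>x\<in>torus n - {torus_zero n}.
        conn_prob \<theta> \<rho> n (torus_zero n) x \<le> C * f \<theta> \<rho> n x)"
      using main B(3) by blast
    have "0 < 1 / c" using c by simp
    then show "\<exists>C>0. \<forall>\<theta>\<in>\<Theta>. \<exists>n0. \<forall>\<rho>. admissible_rho A1 A2 \<alpha> \<rho> \<longrightarrow> (\<forall>n\<ge>n0. \<forall>x\<in>torus n - {torus_zero n}.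
        f \<theta> \<rho> n x \<le> C * conn_prob \<theta> \<rho> n (torus_zero n) x)"
      using main by blast
  qed
qed

lemma far_value_eq: "far_value d \<alpha> \<theta> n = real n powr (\<alpha> - real d) * real n powr (\<theta> - 2 * \<alpha>)"
  by (simp add: far_value_def algebra_simps flip: powr_add)

text \<open>Let \<open>m\<close> be the diameter. At \<open>r = m powr (2 - \<theta> / \<alpha>)\<close> one has \<open>r powr - \<alpha> = m powr (\<theta> - 2 * \<alpha>)\<close>, which is the ratio of \<open>F\<close> to
  \<open>n\<^sup>\<alpha>\<^sup>-\<^sup>d\<close> up to replacing \<open>m\<close> by \<open>n\<close>; and \<open>n / 3 \<le> m \<le> n\<close>.\<close>

lemma two_regime_conn_estimate:
  fixes \<alpha> A1 A2 :: real
  assumes "0 < A1" "A1 \<le> A2" "0 < \<alpha>" "\<alpha> < real CARD('d :: finite)"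
    and \<Theta>: "\<And>\<theta>. \<theta> \<in> \<Theta> \<Longrightarrow> \<alpha> < \<theta> \<and> \<theta> < \<alpha> + real CARD('d) / 3 \<and> \<theta> < 2 * real CARD('d) - \<alpha> \<and> \<theta> \<le> 2 * \<alpha>"
  shows "conn_estimate A1 A2 \<alpha> \<Theta> (\<lambda>\<theta> \<rho> n (x :: (int ^ 'd) set). two_regime \<alpha> \<theta> \<rho> n x)"
proof (rule conn_estimate_by_regimes[OF assms(1-4)])
  fix \<theta> \<rho> n and x :: "(int ^ 'd) set"
  assume \<theta>: "\<theta> \<in> \<Theta>" and n: "3 \<le> n" and r: "1 \<le> torus_norm n x"
  define r where "r = torus_norm n x"
  define m where "m = real (torus_diam n)"
  have m: "real n / 3 \<le> m" "m \<le> real n" "1 \<le> m" using n unfolding m_def torus_diam_def by linarith+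
  have scale: "(m powr (2 - \<theta> / \<alpha>)) powr - \<alpha> = m powr (\<theta> - 2 * \<alpha>)"
  proof -
    have "(2 - \<theta> / \<alpha>) * - \<alpha> = \<theta> - 2 * \<alpha>" using assms(3) by (simp add: field_simps)
    then show ?thesis by (simp only: powr_powr)
  qed
  have r1: "1 \<le> r" using r by (simp add: r_def)
  show "let r = torus_norm n x; Q = real n powr (\<alpha> - real CARD('d)) * r powr - \<alpha>;
         F = far_value CARD('d) \<alpha> \<theta> n
       in two_regime \<alpha> \<theta> \<rho> n x = inverse (zeta CARD('d) \<rho> n) * r powr - \<alpha> \<and> F \<le> Q \<or>
          two_regime \<alpha> \<theta> \<rho> n x = F \<and> Q \<le> 3 powr \<alpha> * F"
  proof (cases "r \<le> m powr (2 - \<theta> / \<alpha>)")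
    case True
    have "real n powr (\<theta> - 2 * \<alpha>) \<le> m powr (\<theta> - 2 * \<alpha>)"
      using \<Theta>[OF \<theta>] m by (intro powr_mono2') auto
    also have "\<dots> \<le> r powr - \<alpha>"
      unfolding scale[symmetric] using True r1 assms(3) by (intro powr_mono2') auto
    finally have "far_value CARD('d) \<alpha> \<theta> n \<le> real n powr (\<alpha> - real CARD('d)) * r powr - \<alpha>"
      unfolding far_value_eq by (intro mult_left_mono) auto
    moreover have "two_regime \<alpha> \<theta> \<rho> n x = inverse (zeta CARD('d) \<rho> n) * r powr - \<alpha>"
      using True r1 unfolding two_regime_def r_def m_def by simp
    ultimately show ?thesis unfolding Let_def r_def by blast
  next
    case False
    have "r powr - \<alpha> \<le> m powr (\<theta> - 2 * \<alpha>)"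
      unfolding scale[symmetric] using False m assms(3) by (intro powr_mono2') auto
    also have "\<dots> \<le> (real n / 3) powr (\<theta> - 2 * \<alpha>)"
      using \<Theta>[OF \<theta>] m n by (intro powr_mono2') auto
    also have "\<dots> = 3 powr (2 * \<alpha> - \<theta>) * real n powr (\<theta> - 2 * \<alpha>)"
      by (simp add: powr_divide powr_diff)
    also have "\<dots> \<le> 3 powr \<alpha> * real n powr (\<theta> - 2 * \<alpha>)"
      using \<Theta>[OF \<theta>] by (intro mult_right_mono powr_mono) auto
    finally have "real n powr (\<alpha> - real CARD('d)) * r powr - \<alpha>
        \<le> real n powr (\<alpha> - real CARD('d)) * (3 powr \<alpha> * real n powr (\<theta> - 2 * \<alpha>))"
      by (intro mult_left_mono) auto
    then have "real n powr (\<alpha> - real CARD('d)) * r powr - \<alpha> \<le> 3 powr \<alpha> * far_value CARD('d) \<alpha> \<theta> n"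
      unfolding far_value_eq by (simp add: mult_ac)
    moreover have "two_regime \<alpha> \<theta> \<rho> n x = far_value CARD('d) \<alpha> \<theta> n"
      using False unfolding two_regime_def r_def m_def by simp
    ultimately show ?thesis unfolding Let_def r_def by blast
  qed
qed (use \<Theta> in blast)

lemma far_value_conn_estimate:
  fixes \<alpha> A1 A2 :: real
  assumes "0 < A1" "A1 \<le> A2" "0 < \<alpha>" "\<alpha> < real CARD('d :: finite)"
    and \<Theta>: "\<And>\<theta>. \<theta> \<in> \<Theta> \<Longrightarrow> \<alpha> < \<theta> \<and> \<theta> < \<alpha> + real CARD('d) / 3 \<and> \<theta> < 2 * real CARD('d) - \<alpha> \<and> 2 * \<alpha> \<le> \<theta>"
  shows "conn_estimate A1 A2 \<alpha> \<Theta> (\<lambda>\<theta> \<rho> n (x :: (int ^ 'd) set). far_value CARD('d) \<alpha> \<theta> n)"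
proof (rule conn_estimate_by_regimes[OF assms(1-4)])
  fix \<theta> and \<rho> :: "real \<Rightarrow> real" and n and x :: "(int ^ 'd) set"
  assume \<theta>: "\<theta> \<in> \<Theta>" and n: "3 \<le> n" and r: "1 \<le> torus_norm n x"
  have "torus_norm n x powr - \<alpha> \<le> 1" 
    using powr_mono2'[of "- \<alpha>" 1 "torus_norm n x"] r assms(3) by simp
  also have "1 \<le> 3 powr \<alpha> * real n powr (\<theta> - 2 * \<alpha>)"
    using \<Theta>[OF \<theta>] n assms(3) mult_mono[of 1 "3 powr \<alpha>" 1 "real n powr (\<theta> - 2 * \<alpha>)"]
    by (simp add: ge_one_powr_ge_zero)
  finally have "real n powr (\<alpha> - real CARD('d)) * torus_norm n x powr - \<alpha>
      \<le> real n powr (\<alpha> - real CARD('d)) * (3 powr \<alpha> * real n powr (\<theta> - 2 * \<alpha>))"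
    by (intro mult_left_mono) auto
  then have "real n powr (\<alpha> - real CARD('d)) * torus_norm n x powr - \<alpha>
      \<le> 3 powr \<alpha> * far_value CARD('d) \<alpha> \<theta> n"
    unfolding far_value_eq by (simp add: mult_ac)
  then show "let r = torus_norm n x; Q = real n powr (\<alpha> - real CARD('d)) * r powr - \<alpha>;
         F = far_value CARD('d) \<alpha> \<theta> n
       in far_value CARD('d) \<alpha> \<theta> n = inverse (zeta CARD('d) \<rho> n) * r powr - \<alpha> \<and> F \<le> Q \<or>
          far_value CARD('d) \<alpha> \<theta> n = F \<and> Q \<le> 3 powr \<alpha> * F"
    unfolding Let_def by blast
qed (use \<Theta> in blast)

theorem theorem2p9:
  fixes \<alpha> A1 A2 :: real
  assumes "0 < A1" "A1 \<le> A2"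
    and "0 < \<alpha>" "\<alpha> < real CARD('d :: finite)"
  shows
    "(\<alpha> < real CARD('d) / 3 \<longrightarrow>
        conn_estimate A1 A2 \<alpha>
          ({\<alpha><..<\<alpha> + real CARD('d) / 3} \<inter> {\<alpha><..<2 * \<alpha>})
          (\<lambda>\<theta> \<rho> n (x :: (int ^ 'd) set). two_regime \<alpha> \<theta> \<rho> n x)) \<and>
     (\<alpha> < real CARD('d) / 3 \<longrightarrow>
        conn_estimate A1 A2 \<alpha>
          ({\<alpha><..<\<alpha> + real CARD('d) / 3} \<inter> {2 * \<alpha>..<\<alpha> + real CARD('d) / 3})
          (\<lambda>\<theta> \<rho> n (x :: (int ^ 'd) set). far_value CARD('d) \<alpha> \<theta> n)) \<and>
     (real CARD('d) / 3 \<le> \<alpha> \<and> \<alpha> \<le> 5 * real CARD('d) / 6 \<longrightarrow>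
        conn_estimate A1 A2 \<alpha>
          {\<alpha><..<\<alpha> + real CARD('d) / 3}
          (\<lambda>\<theta> \<rho> n (x :: (int ^ 'd) set). two_regime \<alpha> \<theta> \<rho> n x)) \<and>
     (5 * real CARD('d) / 6 < \<alpha> \<longrightarrow>
        conn_estimate A1 A2 \<alpha>
          ({\<alpha><..<\<alpha> + real CARD('d) / 3} \<inter> {\<alpha><..<2 * real CARD('d) - \<alpha>})
          (\<lambda>\<theta> \<rho> n (x :: (int ^ 'd) set). two_regime \<alpha> \<theta> \<rho> n x))"
  by (intro conjI impI two_regime_conn_estimate far_value_conn_estimate assms) (use assms in auto)

end
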